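(* Every planar graph that contains no cycle of length $3$, no cycle of length $4$, and no cycle of length $6$ (as subgraphs, not necessarily induced) is $(2,4)$-colorable.
   Context: Graphs are finite and simple. For nonnegative integers $d_1,d_2$, a $(d_1,d_2)$-coloring of a graph $G$ is an assignment of colors from $\{1,2\}$ to the vertices of $G$ (adjacent vertices may share a color) such that, for each $i\in\{1,2\}$, every vertex colored $i$ has at most $d_i$ neighbors colored $i$. A graph is $(d_1,d_2)$-colorable if it admits a $(d_1,d_2)$-coloring. *)

theory Defs
  imports "HOL-Analysis.Analysis" "Graph_Theory.Pair_Digraph"
begin

text \<open>
  A finite simple graph is a \<^locale>\<open>pair_graph\<close>: finitely many vertices, and a symmetric,
  irreflexive set \<^const>\<open>parcs\<close> of ordered pairs, so that every undirected edge \<open>uv\<close> is represented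
  by both \<open>(u, v)\<close> and \<open>(v, u)\<close>.
\<close>

text \<open>
  A drawing without crossings: \<open>pos\<close> places the vertices at distinct points of the plane, and
  \<open>\<gamma> u v\<close> is the simple arc drawn for the edge \<open>uv\<close>, traversed from \<open>u\<close> to \<open>v\<close>. The two
  orientations of an edge are drawn as the same curve. The interior of an arc contains neither a
  vertex nor a point of the arc of another edge, so distinct edges meet at most in common end
  vertices.
\<close>

definition plane_drawing ::
    "'a pair_pre_digraph \<Rightarrow> ('a \<Rightarrow> complex) \<Rightarrow> ('a \<Rightarrow> 'a \<Rightarrow> real \<Rightarrow> complex) \<Rightarrow> bool" where
  "plane_drawing G pos \<gamma> \<longleftrightarrow>
     inj_on pos (pverts G) \<and>
     (\<forall>(u, v) \<in> parcs G.
        arc (\<gamma> u v) \<and> pathstart (\<gamma> u v) = pos u \<and> pathfinish (\<gamma> u v) = pos v \<and>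
        \<gamma> v u = reversepath (\<gamma> u v) \<and>
        (path_image (\<gamma> u v) - {pos u, pos v}) \<inter> pos ` pverts G = {} \<and>
        (\<forall>(x, y) \<in> parcs G. {x, y} \<noteq> {u, v} \<longrightarrow>
           (path_image (\<gamma> u v) - {pos u, pos v}) \<inter> path_image (\<gamma> x y) = {}))"

definition planar :: "'a pair_pre_digraph \<Rightarrow> bool" where
  "planar G \<longleftrightarrow> (\<exists>pos \<gamma>. plane_drawing G pos \<gamma>)"

text \<open>
  \<^const>\<open>pre_digraph.cycle\<close> is the directed notion, for which \<open>u, v, u\<close> is a cycle of length 2
  in a symmetric digraph. For \<open>k \<ge> 3\<close> its vertices are \<open>k\<close> distinct, cyclically adjacent vertices,
  which is a cycle (as a subgraph) of the undirected graph.
\<close>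

definition has_cycle_of_length :: "'a pair_pre_digraph \<Rightarrow> nat \<Rightarrow> bool" where
  "has_cycle_of_length G k \<longleftrightarrow> (\<exists>p. pre_digraph.cycle (with_proj G) p \<and> length p = k)"

definition defective_coloring ::
    "nat \<Rightarrow> nat \<Rightarrow> 'a pair_pre_digraph \<Rightarrow> ('a \<Rightarrow> nat) \<Rightarrow> bool" where
  "defective_coloring d1 d2 G c \<longleftrightarrow>
     (\<forall>v \<in> pverts G. c v \<in> {1, 2}) \<and>
     (\<forall>v \<in> pverts G. c v = 1 \<longrightarrow> card {w. (v, w) \<in> parcs G \<and> c w = 1} \<le> d1) \<and>
     (\<forall>v \<in> pverts G. c v = 2 \<longrightarrow> card {w. (v, w) \<in> parcs G \<and> c w = 2} \<le> d2)"

definition defective_colorable :: "nat \<Rightarrow> nat \<Rightarrow> 'a pair_pre_digraph \<Rightarrow> bool" where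
  "defective_colorable d1 d2 G \<longleftrightarrow> (\<exists>c. defective_coloring d1 d2 G c)"

end

theory Submission
  imports Defs
begin

text \<open>
  A block of a plane graph is built by attaching ears. Each ear lies in one face and, by the theorem
  on theta curves, splits it in two; hence there are at least \<open>|E| - |V| + 1\<close> cycles that together
  cover every edge at most twice. In the absence of cycles of length 3, 4 and 6 these cycles have
  length 5 or at least 7, and a vertex of degree 2 cannot lie on two of length 5. If no two vertices
  of degree 2 are adjacent, this gives \<open>9 (\<Sum>v. deg v) + 4 n\<^sub>2 + 30 \<le> 30 |V|\<close>, where \<open>n\<^sub>2\<close> is the
  number of vertices of degree 2.

  A minimal graph without a (2,4)-coloring violates this inequality: give each vertex the charge
  \<open>9 deg v - 30\<close>, increased by 4 if its degree is 2, and let the vertices of degree at least 6 send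
  4 to each smaller neighbor and the vertices of degree 4 and 5 send 4 to each neighbor of degree 2.
  Only a vertex of degree 4 with three neighbors of degree 2 is left in deficit, by 2. The four
  vertices of degree at least 6 around it are saturated in every coloring of the rest of the graph,
  which lets each of them contribute another 1/2.
\<close>

section \<open>Paths and cycles as edge sets\<close>

text \<open>The numbers 9 and 30 are those of plane graphs whose faces all have length at least 5:
  \<open>30 |F| \<le> 6 * 2 |E|\<close> and \<open>|F| \<ge> |E| - |V| + 1\<close> bound 9 times the
  degree sum by \<open>30 |V| - 30\<close>. This alone is too weak: a vertex of degree 2 lacks 12,
  and its two neighbors can spare only 4 each. The missing 4 is paid by a face of length at least 7,
  since a 7-face has the surplus \<open>6 * 7 - 30 = 12\<close> and at most three vertices of degree
  2. Hence the concern with 6-cycles and with two 5-cycles through one vertex.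

  The other obstacle is a vertex of degree exactly 6: its charge 24 is used up by six gifts of 4. An
  extra 1/2 must be saved on another neighbor. One of degree 5, or of degree 4 with two neighbors of
  degree at least 6, can do with 1 instead of 4, and \<open>give\<close> (with doubled amounts)
  assigns it no more; the 3 saved there pay for up to five extra halves. Such a neighbor exists
  whenever an extra 1/2 is due, since otherwise a recoloring would change the color of a vertex
  whose color is forced.\<close>

fun path_edges :: "'a list \<Rightarrow> 'a set set" where
  "path_edges (x # y # zs) = insert {x, y} (path_edges (y # zs))"
| "path_edges _ = {}"

lemma path_edges_Cons: "xs \<noteq> [] \<Longrightarrow> path_edges (x # xs) = insert {x, hd xs} (path_edges xs)"
  by (cases xs) auto

lemma path_edges_append:
  "path_edges (xs @ x # ys) = path_edges (xs @ [x]) \<union> path_edges (x # ys)"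
  by (induction xs rule: path_edges.induct) (auto simp: path_edges_Cons)

lemma path_edges_snoc:
  "xs \<noteq> [] \<Longrightarrow> path_edges (xs @ [x]) = insert {last xs, x} (path_edges xs)"
  by (induction xs rule: path_edges.induct) auto

lemma path_edges_rev: "path_edges (rev xs) = path_edges xs"
proof (induction xs)
  case (Cons x xs)
  note IH = Cons.IH
  show ?case
  proof (cases xs)
    case (Cons y ys)
    then show ?thesis
      using IH path_edges_snoc[of "rev xs" x] by (simp add: insert_commute[of x])
  qed simp
qed simp

lemma path_edges_subset: "e \<in> path_edges xs \<Longrightarrow> e \<subseteq> set xs"
  by (induction xs rule: path_edges.induct) auto

lemma Union_path_edges: "length xs \<ge> 2 \<Longrightarrow> \<Union>(path_edges xs) = set xs"
proof (induction xs rule: path_edges.induct)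
  case (1 x y zs)
  show ?case
  proof (cases zs)
    case (Cons z us)
    then show ?thesis using 1 by simp blast
  qed auto
qed auto

lemma finite_path_edges [simp]: "finite (path_edges xs)"
  by (induction xs rule: path_edges.induct) auto

lemma card_path_edges: "distinct xs \<Longrightarrow> card (path_edges xs) = length xs - 1"
proof (induction xs rule: path_edges.induct)
  case (1 x y zs)
  have "{x, y} \<notin> path_edges (y # zs)"
    using path_edges_subset[of "{x, y}" "y # zs"] 1(2) by auto
  then show ?case using 1 by simp
qed auto

lemma ends_notin_path_edges:
  assumes "distinct (a # p @ [b])" "p \<noteq> []"
  shows "{a, b} \<notin> path_edges (a # p @ [b])"
proof
  assume *: "{a, b} \<in> path_edges (a # p @ [b])"
  obtain x q where p: "p = x # q" using assms by (cases p) auto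
  have "{a, b} \<noteq> {a, x}" using assms p by (auto simp: doubleton_eq_iff)
  then have "{a, b} \<in> path_edges (x # q @ [b])" using * p by simp
  then show False using path_edges_subset[of "{a,b}" "x # q @ [b]"] assms p by auto
qed

text \<open>The vertex sets meet only in \<open>a\<close> and \<open>b\<close>, so a common edge
  could only be \<open>{a, b}\<close>, which a path with an inner vertex does not contain. With both
  inner parts empty the two paths would be the same edge, hence the condition that accompanies every
  presentation of a cycle.\<close>

lemma path_edges_disjoint:
  assumes "distinct (a # p @ b # q)" "p \<noteq> [] \<or> q \<noteq> []"
  shows "path_edges (a # p @ [b]) \<inter> path_edges (a # q @ [b]) = {}"
proof -
  have False if e: "e \<in> path_edges (a # p @ [b])" "e \<in> path_edges (a # q @ [b])" for e
  proof -
    have sub: "e \<subseteq> {a, b}" using path_edges_subset[OF e(1)] path_edges_subset[OF e(2)] assms by auto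
    have "\<exists>x y. x \<noteq> y \<and> e = {x, y}" if "e \<in> path_edges xs" "distinct xs" for xs
      using that by (induction xs rule: path_edges.induct) auto
    from this[OF e(1)] have "e = {a, b}" using sub assms by auto
    then show False
      using ends_notin_path_edges[of a p b] ends_notin_path_edges[of a q b] e assms by auto
  qed
  then show ?thesis by auto
qed

text \<open>A cycle is presented as two internally disjoint paths from \<open>a\<close> to \<open>b\<close>: attaching an ear at
  \<open>a\<close> and \<open>b\<close> then yields a theta graph.\<close>

definition is_cycle :: "'a set set \<Rightarrow> bool" where
  "is_cycle C \<longleftrightarrow> (\<exists>a b p q. distinct (a # p @ b # q) \<and> (p \<noteq> [] \<or> q \<noteq> []) \<and>
     C = path_edges (a # p @ [b]) \<union> path_edges (a # q @ [b]))"

lemma is_cycleI: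
  assumes "distinct (a # p @ b # q)" "p \<noteq> [] \<or> q \<noteq> []"
  shows "is_cycle (path_edges (a # p @ [b]) \<union> path_edges (a # q @ [b]))"
  using assms unfolding is_cycle_def by blast

lemma is_cycle_closed_list:
  assumes "is_cycle C"
  obtains xs where "distinct xs" "length xs \<ge> 3" "C = path_edges (xs @ [hd xs])"
proof -
  obtain a b p q where *: "distinct (a # p @ b # q)" "p \<noteq> [] \<or> q \<noteq> []"
     "C = path_edges (a # p @ [b]) \<union> path_edges (a # q @ [b])"
    using assms unfolding is_cycle_def by blast
  have "path_edges (b # rev q @ [a]) = path_edges (a # q @ [b])"
    using path_edges_rev[of "a # q @ [b]"] by simp
  then have "C = path_edges ((a # p @ b # rev q) @ [hd (a # p @ b # rev q)])"
    using *(3) path_edges_append[of "a # p" b "rev q @ [a]"] by simp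
  moreover have "length (a # p @ b # rev q) \<ge> 3" using *(2) by (cases p; cases q) auto
  ultimately show thesis using that[of "a # p @ b # rev q"] *(1) by auto
qed

lemma path_edges_rotate:
  "path_edges ((xs @ ys) @ [hd (xs @ ys)]) = path_edges ((ys @ xs) @ [hd (ys @ xs)])"
proof (cases "xs = [] \<or> ys = []")
  case False
  then obtain x xs' y ys' where "xs = x # xs'" "ys = y # ys'" by (meson neq_Nil_conv)
  then show ?thesis
    using path_edges_append[of xs y "ys' @ [x]"] path_edges_append[of ys x "xs' @ [y]"] by auto
qed auto

lemma is_cycle_from:
  assumes "is_cycle C" "a \<in> \<Union>C"
  obtains xs where "distinct (a # xs)" "length xs \<ge> 2" "C = path_edges (a # xs @ [a])"
proof -
  obtain xs where xs: "distinct xs" "length xs \<ge> 3" "C = path_edges (xs @ [hd xs])"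
    using is_cycle_closed_list[OF assms(1)] by blast
  have "a \<in> set xs"
    using assms(2) xs(2) Union_path_edges[of "xs @ [hd xs]"] unfolding xs(3)
    by (cases xs) auto
  then obtain us vs where uv: "xs = us @ a # vs" by (meson split_list)
  have "C = path_edges (a # (vs @ us) @ [a])"
    using xs(3) path_edges_rotate[of us "a # vs"] uv by simp
  then show thesis using that[of "vs @ us"] xs uv by auto
qed

text \<open>The definition of a cycle provides some pair of base points, but an ear attaches at a
  prescribed pair. The closed vertex list is rotated to start at \<open>a\<close> and cut at
  \<open>b\<close>, and its second half is reversed.\<close>

lemma is_cycle_split:
  assumes "is_cycle C" "a \<in> \<Union>C" "b \<in> \<Union>C" "a \<noteq> b"
  obtains p q where "distinct (a # p @ b # q)" "p \<noteq> [] \<or> q \<noteq> []"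
     "C = path_edges (a # p @ [b]) \<union> path_edges (a # q @ [b])"
proof -
  obtain xs where xs: "distinct (a # xs)" "length xs \<ge> 2" "C = path_edges (a # xs @ [a])"
    using is_cycle_from[OF assms(1,2)] by blast
  have "b \<in> set xs"
    using assms xs(2) Union_path_edges[of "a # xs @ [a]"] by (auto simp: xs(3))
  then obtain us vs where uv: "xs = us @ b # vs" by (meson split_list)
  have "path_edges (b # vs @ [a]) = path_edges (a # rev vs @ [b])"
    using path_edges_rev[of "b # vs @ [a]"] by simp
  then have "C = path_edges (a # us @ [b]) \<union> path_edges (a # rev vs @ [b])"
    using xs(3) uv path_edges_append[of "a # us" b "vs @ [a]"] by simp
  moreover have "us \<noteq> [] \<or> rev vs \<noteq> []" using xs uv by auto
  ultimately show thesis using that[of us "rev vs"] xs(1) uv by auto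
qed

section \<open>Theta curves\<close>

lemma Jordan_arcs:
  fixes g1 g2 :: "real \<Rightarrow> complex"
  assumes "arc g1" "arc g2" "pathstart g1 = a" "pathfinish g1 = b" "pathstart g2 = a" "pathfinish g2 = b"
    and "path_image g1 \<inter> path_image g2 = {a, b}"
  shows "inside (path_image g1 \<union> path_image g2) \<noteq> {}"
    "connected (inside (path_image g1 \<union> path_image g2))"
    "connected (outside (path_image g1 \<union> path_image g2))"
    "open (inside (path_image g1 \<union> path_image g2))"
    "open (outside (path_image g1 \<union> path_image g2))"
    "\<not> bounded (outside (path_image g1 \<union> path_image g2))"
    "inside (path_image g1 \<union> path_image g2) \<inter> outside (path_image g1 \<union> path_image g2) = {}"
    "inside (path_image g1 \<union> path_image g2) \<union> outside (path_image g1 \<union> path_image g2)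
      = - (path_image g1 \<union> path_image g2)"
    "frontier (inside (path_image g1 \<union> path_image g2)) = path_image g1 \<union> path_image g2"
    "frontier (outside (path_image g1 \<union> path_image g2)) = path_image g1 \<union> path_image g2"
proof -
  let ?c = "g1 +++ reversepath g2"
  have 1: "simple_path ?c"
    using assms by (intro simple_path_join_loop) (simp_all add: arc_reversepath)
  have 2: "pathfinish ?c = pathstart ?c" using assms by simp
  have 3: "path_image ?c = path_image g1 \<union> path_image g2"
    using assms by (simp add: path_image_join)
  note J = Jordan_inside_outside[OF 1 2, unfolded 3]
  show "inside (path_image g1 \<union> path_image g2) \<noteq> {}"
    "connected (inside (path_image g1 \<union> path_image g2))"
    "connected (outside (path_image g1 \<union> path_image g2))"
    "open (inside (path_image g1 \<union> path_image g2))"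
    "open (outside (path_image g1 \<union> path_image g2))"
    "\<not> bounded (outside (path_image g1 \<union> path_image g2))"
    "inside (path_image g1 \<union> path_image g2) \<inter> outside (path_image g1 \<union> path_image g2) = {}"
    "inside (path_image g1 \<union> path_image g2) \<union> outside (path_image g1 \<union> path_image g2)
      = - (path_image g1 \<union> path_image g2)"
    "frontier (inside (path_image g1 \<union> path_image g2)) = path_image g1 \<union> path_image g2"
    "frontier (outside (path_image g1 \<union> path_image g2)) = path_image g1 \<union> path_image g2"
    using J by blast+
qed

lemma connected_subset_component:
  assumes "connected T" "T \<inter> S \<noteq> {}" "T \<inter> frontier S = {}"
  shows "T \<subseteq> S"
  using connected_Int_frontier[OF assms(1,2)] assms(3) by blast

text \<open>If the insides of \<open>g1 \<union> g2\<close> and \<open>g1 \<union> g3\<close> met,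
  the first would lie in the second, being connected and disjoint from its frontier. An inner point
  of \<open>g2\<close> is a limit of the first, so it would lie inside \<open>g1 \<union> g3\<close>
  or on it, and both are excluded.\<close>

lemma inside_theta_disjoint:
  fixes g1 g2 g3 :: "real \<Rightarrow> complex"
  assumes "arc g1" "arc g2" "arc g3" "pathstart g1 = a" "pathfinish g1 = b"
    "pathstart g2 = a" "pathfinish g2 = b" "pathstart g3 = a" "pathfinish g3 = b"
    and 12: "path_image g1 \<inter> path_image g2 = {a, b}"
    and 13: "path_image g1 \<inter> path_image g3 = {a, b}"
    and 23: "path_image g2 \<inter> path_image g3 = {a, b}"
    and dis3: "path_image g3 \<inter> inside (path_image g1 \<union> path_image g2) = {}"
    and dis2: "path_image g2 \<inter> inside (path_image g1 \<union> path_image g3) = {}"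
  shows "inside (path_image g1 \<union> path_image g2) \<subseteq> outside (path_image g1 \<union> path_image g3)"
proof -
  let ?p1 = "path_image g1" and ?p2 = "path_image g2" and ?p3 = "path_image g3"
  note J12 = Jordan_arcs[OF assms(1,2,4-7) 12] and J13 = Jordan_arcs[OF assms(1,3,4,5,8,9) 13]
  have ni: "inside (?p1 \<union> ?p2) \<inter> (?p1 \<union> ?p2) = {}" using inside_no_overlap by blast
  have "\<not> ?p2 \<subseteq> {a, b}"
  proof
    assume "?p2 \<subseteq> {a, b}"
    moreover have "infinite ?p2"
    proof -
      have "infinite {0..1::real}" by (simp add: infinite_Icc)
      then show ?thesis
        using assms(2) by (simp add: arc_def path_image_def finite_image_iff)
    qed
    ultimately show False using finite_subset by blast
  qed
  then obtain z where z: "z \<in> ?p2" "z \<noteq> a" "z \<noteq> b" by auto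
  have "inside (?p1 \<union> ?p2) \<inter> inside (?p1 \<union> ?p3) = {}"
  proof (rule ccontr)
    assume "inside (?p1 \<union> ?p2) \<inter> inside (?p1 \<union> ?p3) \<noteq> {}"
    then have sub: "inside (?p1 \<union> ?p2) \<subseteq> inside (?p1 \<union> ?p3)"
      using connected_subset_component[OF J12(2), of "inside (?p1 \<union> ?p3)"] J13(9) ni dis3 by blast
    have "z \<in> closure (inside (?p1 \<union> ?p2))" using J12(9) z by (auto simp: frontier_def)
    then have "z \<in> closure (inside (?p1 \<union> ?p3))" using sub closure_mono by blast
    then have "z \<in> inside (?p1 \<union> ?p3) \<union> (?p1 \<union> ?p3)"
      using J13(9) J13(4) by (auto simp: frontier_def interior_open)
    moreover have "z \<notin> ?p1" "z \<notin> ?p3" using z 12 23 by auto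
    ultimately show False using dis2 z by blast
  qed
  then show ?thesis using J13(8) ni dis3 by blast
qed

text \<open>Were each of the three arcs outside the loop formed by the other two, a point inside
  \<open>g1 \<union> g2\<close> would be separated from infinity neither by \<open>g1 \<union> g3\<close> nor by \<open>g2 \<union> g3\<close>, whose
  intersection \<open>g3\<close> is connected, and hence by Janiszewski not by the whole theta curve.\<close>

lemma theta_arc_inside:
  fixes g1 g2 g3 :: "real \<Rightarrow> complex"
  assumes "arc g1" "arc g2" "arc g3" "pathstart g1 = a" "pathfinish g1 = b"
    "pathstart g2 = a" "pathfinish g2 = b" "pathstart g3 = a" "pathfinish g3 = b"
    and 12: "path_image g1 \<inter> path_image g2 = {a, b}"
    and 13: "path_image g1 \<inter> path_image g3 = {a, b}"
    and 23: "path_image g2 \<inter> path_image g3 = {a, b}"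
    and dis3: "path_image g3 \<inter> inside (path_image g1 \<union> path_image g2) = {}"
  shows "path_image g2 \<inter> inside (path_image g1 \<union> path_image g3) \<noteq> {} \<or>
    path_image g1 \<inter> inside (path_image g2 \<union> path_image g3) \<noteq> {}"
proof (rule ccontr)
  let ?p1 = "path_image g1" and ?p2 = "path_image g2" and ?p3 = "path_image g3"
  assume "\<not> ?thesis"
  then have dis2: "?p2 \<inter> inside (?p1 \<union> ?p3) = {}" and dis1: "?p1 \<inter> inside (?p2 \<union> ?p3) = {}"
    by blast+
  note J12 = Jordan_arcs[OF assms(1,2,4-7) 12] and J13 = Jordan_arcs[OF assms(1,3,4,5,8,9) 13]
    and J23 = Jordan_arcs[OF assms(2,3,6,7,8,9) 23]
  have s1: "inside (?p1 \<union> ?p2) \<subseteq> outside (?p1 \<union> ?p3)"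
    by (rule inside_theta_disjoint[OF assms(1-9) 12 13 23 dis3 dis2])
  have s2: "inside (?p2 \<union> ?p1) \<subseteq> outside (?p2 \<union> ?p3)"
    using 12 13 23 dis1 dis3
    by (intro inside_theta_disjoint[OF assms(2,1,3,6,7,4,5,8,9)]) (auto simp: Un_commute)
  obtain x where x: "x \<in> inside (?p1 \<union> ?p2)" using J12(1) by blast
  have "bounded (?p1 \<union> ?p2 \<union> ?p3)" using assms(1-3) by (simp add: bounded_arc_image)
  then obtain r where r: "?p1 \<union> ?p2 \<union> ?p3 \<subseteq> ball 0 r" using bounded_subset_ballD by blast
  \<comment> \<open>A point beyond a disc that contains all three arcs, hence outside every loop
    formed from them. The absolute value makes the radius nonnegative.\<close>
  define y :: complex where "y = of_real (\<bar>r\<bar> + 1)"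
  have far: "y \<in> outside T" if "T \<subseteq> ball 0 r" for T
  proof -
    have "- cball 0 \<bar>r\<bar> \<subseteq> outside (cball (0::complex) \<bar>r\<bar>)"
      by (simp add: outside_convex)
    moreover have "y \<in> - cball 0 \<bar>r\<bar>" by (simp add: y_def)
    moreover have "outside (cball (0::complex) \<bar>r\<bar>) \<subseteq> outside T" using that by (intro outside_mono) (auto simp: subset_iff)
    ultimately show ?thesis by blast
  qed
  have yo: "y \<in> outside (?p1 \<union> ?p3)" "y \<in> outside (?p2 \<union> ?p3)" "y \<in> outside (?p1 \<union> ?p2)"
    using far r by auto
  have "connected_component (- (?p1 \<union> ?p3)) x y"
    unfolding connected_component_def
    using x s1 yo J13(3) outside_no_overlap[of "?p1 \<union> ?p3"]
    by (intro exI[of _ "outside (?p1 \<union> ?p3)"]) blast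
  moreover have "connected_component (- (?p2 \<union> ?p3)) x y"
    unfolding connected_component_def
    using x s2 yo J23(3) outside_no_overlap[of "?p2 \<union> ?p3"] unfolding Un_commute[of ?p2 ?p1]
    by (intro exI[of _ "outside (?p2 \<union> ?p3)"]) blast
  moreover have "connected ((?p1 \<union> ?p3) \<inter> (?p2 \<union> ?p3))"
  proof -
    have "(?p1 \<union> ?p3) \<inter> (?p2 \<union> ?p3) = ?p3" using 12 13 23 by blast
    then show ?thesis using assms(3) by (simp add: connected_arc_image)
  qed
  moreover have "compact (?p1 \<union> ?p3)" "closed (?p2 \<union> ?p3)"
    using assms(1-3) by (simp_all add: compact_Un closed_Un compact_arc_image closed_arc_image)
  ultimately have "connected_component (- ((?p1 \<union> ?p3) \<union> (?p2 \<union> ?p3))) x y"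
    using Janiszewski by blast
  then have "connected_component (- (?p1 \<union> ?p2)) x y"
    by (rule connected_component_of_subset) auto
  then have "y \<in> inside (?p1 \<union> ?p2)"
    using x inside_same_component by blast
  then show False using yo(3) J12(7) by blast
qed

section \<open>Faces of a plane graph\<close>

text \<open>A drawing seen as a point set for each unordered edge. Arcs are recovered in the
  direction in which they are wanted, and unions of edges become unions of sets. Only endpoints of
  edges have to be placed injectively.\<close>

locale edge_drawing =
  fixes E :: "'a set set" and pos :: "'a \<Rightarrow> complex" and img :: "'a set \<Rightarrow> complex set"
  assumes finite_edges: "finite E"
    and edge_doubleton: "e \<in> E \<Longrightarrow> \<exists>u v. u \<noteq> v \<and> e = {u, v}"
    and inj_pos: "inj_on pos (\<Union>E)"
    and edge_arc: "{u, v} \<in> E \<Longrightarrow> u \<noteq> v \<Longrightarrow>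
      \<exists>g. arc g \<and> pathstart g = pos u \<and> pathfinish g = pos v \<and> path_image g = img {u, v}"
    and pos_in_img: "e \<in> E \<Longrightarrow> x \<in> \<Union>E \<Longrightarrow> pos x \<in> img e \<Longrightarrow> x \<in> e"
    and img_Int_img: "e \<in> E \<Longrightarrow> f \<in> E \<Longrightarrow> e \<noteq> f \<Longrightarrow> img e \<inter> img f \<subseteq> pos ` (e \<inter> f)"
begin

definition Img :: "'a set set \<Rightarrow> complex set" where "Img S = \<Union>(img ` S)"

lemma Img_Un: "Img (S \<union> T) = Img S \<union> Img T"
  by (auto simp: Img_def)

lemma Img_mono: "S \<subseteq> T \<Longrightarrow> Img S \<subseteq> Img T"
  by (auto simp: Img_def)

lemma pos_in_own_img:
  assumes "e \<in> E" "x \<in> e"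
  shows "pos x \<in> img e"
proof -
  obtain u v where uv: "u \<noteq> v" "e = {u, v}" using edge_doubleton assms by blast
  then obtain g where "arc g" "pathstart g = pos u" "pathfinish g = pos v" "path_image g = img e"
    using edge_arc assms by blast
  then have "pos u \<in> img e" "pos v \<in> img e"
    by (metis pathstart_in_path_image, metis pathfinish_in_path_image)
  then show ?thesis using assms uv by auto
qed

text \<open>This turns combinatorial disjointness into topological disjointness: drawings of
  edge-disjoint subgraphs meet exactly at common vertices. All intersection hypotheses on theta
  curves are derived from it.\<close>

lemma Img_Int:
  assumes "S \<subseteq> E" "T \<subseteq> E" "S \<inter> T = {}"
  shows "Img S \<inter> Img T = pos ` (\<Union>S \<inter> \<Union>T)"
proof
  show "Img S \<inter> Img T \<subseteq> pos ` (\<Union>S \<inter> \<Union>T)"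
  proof
    fix z assume "z \<in> Img S \<inter> Img T"
    then obtain e f where ef: "e \<in> S" "f \<in> T" "z \<in> img e \<inter> img f"
      unfolding Img_def by blast
    then have "e \<noteq> f" "e \<in> E" "f \<in> E" using assms by blast+
    then have "z \<in> pos ` (e \<inter> f)" using img_Int_img ef by blast
    then show "z \<in> pos ` (\<Union>S \<inter> \<Union>T)" using ef by blast
  qed
  show "pos ` (\<Union>S \<inter> \<Union>T) \<subseteq> Img S \<inter> Img T"
  proof
    fix z assume "z \<in> pos ` (\<Union>S \<inter> \<Union>T)"
    then obtain x e f where "z = pos x" "x \<in> e" "e \<in> S" "x \<in> f" "f \<in> T" by blast
    then show "z \<in> Img S \<inter> Img T" using pos_in_own_img assms unfolding Img_def by blast
  qed
qed

lemma pos_in_Img: "S \<subseteq> E \<Longrightarrow> x \<in> \<Union>E \<Longrightarrow> pos x \<in> Img S \<longleftrightarrow> x \<in> \<Union>S"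
  unfolding Img_def using pos_in_img pos_in_own_img by blast

lemma path_arc:
  assumes "distinct xs" "length xs \<ge> 2" "path_edges xs \<subseteq> E"
  shows "\<exists>g. arc g \<and> pathstart g = pos (hd xs) \<and> pathfinish g = pos (last xs) \<and>
    path_image g = Img (path_edges xs)"
  using assms
proof (induction xs rule: path_edges.induct)
  case (1 x y zs)
  have "x \<noteq> y" "{x, y} \<in> E" using 1 by auto
  then obtain g where g: "arc g" "pathstart g = pos x" "pathfinish g = pos y" "path_image g = img {x, y}"
    using edge_arc by blast
  show ?case
  proof (cases zs)
    case Nil
    then show ?thesis using g by (intro exI[of _ g]) (auto simp: Img_def)
  next
    case (Cons z us)
    have "distinct (y # zs)" "2 \<le> length (y # zs)" "path_edges (y # zs) \<subseteq> E"
      using 1 Cons by auto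
    from "1.IH"[OF this] obtain h where
      h: "arc h" "pathstart h = pos y" "pathfinish h = pos (last (y # zs))" "path_image h = Img (path_edges (y # zs))"
      by auto
    have "{x, y} \<notin> path_edges (y # zs)"
      using path_edges_subset[of "{x, y}" "y # zs"] 1 by auto
    then have "Img {{x, y}} \<inter> Img (path_edges (y # zs)) = pos ` (\<Union>{{x,y}} \<inter> \<Union>(path_edges (y # zs)))"
      using 1 by (intro Img_Int) auto
    also have "\<Union>(path_edges (y # zs)) = set (y # zs)"
      using Cons by (intro Union_path_edges) auto
    also have "pos ` (\<Union>{{x,y}} \<inter> set (y # zs)) = {pos y}" using 1 by auto
    finally have "path_image g \<inter> path_image h = {pos y}"
      using g h by (simp add: Img_def)
    then have "arc (g +++ h)" using g h by (intro arc_join) auto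
    moreover have "path_image (g +++ h) = Img (path_edges (x # y # zs))"
      using g h by (simp add: path_image_join Img_def)
    ultimately show ?thesis using g h by (intro exI[of _ "g +++ h"]) auto
  qed
qed auto

lemma path_arc_ends:
  assumes "distinct (a # p @ [b])" "path_edges (a # p @ [b]) \<subseteq> E"
  obtains g where "arc g" "pathstart g = pos a" "pathfinish g = pos b"
    "path_image g = Img (path_edges (a # p @ [b]))"
  using path_arc[of "a # p @ [b]"] assms by auto

lemma paths_Int:
  assumes "distinct (a # p @ b # q)" "p \<noteq> [] \<or> q \<noteq> []"
    "path_edges (a # p @ [b]) \<subseteq> E" "path_edges (a # q @ [b]) \<subseteq> E"
  shows "Img (path_edges (a # p @ [b])) \<inter> Img (path_edges (a # q @ [b])) = {pos a, pos b}"
proof -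
  have "Img (path_edges (a # p @ [b])) \<inter> Img (path_edges (a # q @ [b]))
      = pos ` (\<Union>(path_edges (a # p @ [b])) \<inter> \<Union>(path_edges (a # q @ [b])))"
    using assms path_edges_disjoint[OF assms(1,2)] by (intro Img_Int)
  also have "\<Union>(path_edges (a # p @ [b])) = set (a # p @ [b])"
    by (rule Union_path_edges) auto
  also have "\<Union>(path_edges (a # q @ [b])) = set (a # q @ [b])"
    by (rule Union_path_edges) auto
  also have "set (a # p @ [b]) \<inter> set (a # q @ [b]) = {a, b}" using assms by auto
  finally show ?thesis by simp
qed

lemma cycle_Jordan:
  assumes "is_cycle C" "C \<subseteq> E"
  shows "connected (inside (Img C))" "connected (outside (Img C))"
    "open (inside (Img C))" "open (outside (Img C))"
    "inside (Img C) \<inter> outside (Img C) = {}" "inside (Img C) \<union> outside (Img C) = - Img C"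
    "frontier (inside (Img C)) = Img C" "frontier (outside (Img C)) = Img C"
proof -
  obtain a b p q where *: "distinct (a # p @ b # q)" "p \<noteq> [] \<or> q \<noteq> []"
     "C = path_edges (a # p @ [b]) \<union> path_edges (a # q @ [b])"
    using assms unfolding is_cycle_def by blast
  obtain g where g: "arc g" "pathstart g = pos a" "pathfinish g = pos b"
      "path_image g = Img (path_edges (a # p @ [b]))"
    using path_arc_ends[of a p b] * assms by auto
  obtain h where h: "arc h" "pathstart h = pos a" "pathfinish h = pos b"
      "path_image h = Img (path_edges (a # q @ [b]))"
    using path_arc_ends[of a q b] * assms by auto
  have "path_image g \<inter> path_image h = {pos a, pos b}"
    unfolding g h using * assms by (intro paths_Int) auto
  note J = Jordan_arcs[OF g(1) h(1) g(2,3) h(2,3) this]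
  have "path_image g \<union> path_image h = Img C" unfolding g h * Img_Un ..
  note J = J[unfolded this]
  show "connected (inside (Img C))" "connected (outside (Img C))"
    "open (inside (Img C))" "open (outside (Img C))"
    "inside (Img C) \<inter> outside (Img C) = {}" "inside (Img C) \<union> outside (Img C) = - Img C"
    "frontier (inside (Img C)) = Img C" "frontier (outside (Img C)) = Img C"
    by (rule J)+
qed

text \<open>\<open>F\<close> holds the boundary cycles of the bounded faces, each face being the
  inside of its cycle, and \<open>C0\<close> bounds the unbounded face. Because the faces cover the
  complement of the drawing, a further ear enters one of them. The last clause counts
  \<open>C0\<close> separately even if it also belongs to \<open>F\<close>: this reserves room for
  the cycle that an old outer edge gains when an ear is drawn in the unbounded face.\<close>

definition plane_faces :: "'a set set \<Rightarrow> 'a set set set \<Rightarrow> 'a set set \<Rightarrow> bool" where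
  "plane_faces H F C0 \<longleftrightarrow> is_cycle C0 \<and> C0 \<subseteq> H \<and> finite F \<and> (\<forall>C\<in>F. is_cycle C \<and> C \<subseteq> H) \<and>
     outside (Img C0) \<inter> Img H = {} \<and> (\<forall>C\<in>F. inside (Img C) \<inter> Img H = {}) \<and>
     (\<forall>C\<in>F. inside (Img C) \<inter> outside (Img C0) = {}) \<and>
     (\<forall>C\<in>F. \<forall>D\<in>F. C \<noteq> D \<longrightarrow> inside (Img C) \<inter> inside (Img D) = {}) \<and>
     - Img H \<subseteq> outside (Img C0) \<union> (\<Union>C\<in>F. inside (Img C)) \<and>
     (\<forall>e. card {C \<in> F. e \<in> C} + (if e \<in> C0 then 1 else 0) \<le> 2)"

lemma plane_facesD:
  assumes "plane_faces H F C0"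
  shows "is_cycle C0" "C0 \<subseteq> H" "finite F" "\<And>C. C \<in> F \<Longrightarrow> is_cycle C" "\<And>C. C \<in> F \<Longrightarrow> C \<subseteq> H"
    "outside (Img C0) \<inter> Img H = {}" "\<And>C. C \<in> F \<Longrightarrow> inside (Img C) \<inter> Img H = {}"
    "\<And>C. C \<in> F \<Longrightarrow> inside (Img C) \<inter> outside (Img C0) = {}"
    "\<And>C D. C \<in> F \<Longrightarrow> D \<in> F \<Longrightarrow> C \<noteq> D \<Longrightarrow> inside (Img C) \<inter> inside (Img D) = {}"
    "- Img H \<subseteq> outside (Img C0) \<union> (\<Union>C\<in>F. inside (Img C))"
    "\<And>e. card {C \<in> F. e \<in> C} + (if e \<in> C0 then 1 else 0) \<le> 2"
  using assms unfolding plane_faces_def by simp_all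

text \<open>The list \<open>p\<close> may be empty; the ear is then a chord, and disjointness from
  \<open>H\<close> says that it is a new edge.\<close>

definition ear :: "'a set set \<Rightarrow> 'a \<Rightarrow> 'a list \<Rightarrow> 'a \<Rightarrow> bool" where
  "ear H a p b \<longleftrightarrow> distinct (a # p @ [b]) \<and> a \<in> \<Union>H \<and> b \<in> \<Union>H \<and> set p \<inter> \<Union>H = {} \<and>
     path_edges (a # p @ [b]) \<inter> H = {} \<and> path_edges (a # p @ [b]) \<subseteq> E"

lemma ear_Img_Int:
  assumes "H \<subseteq> E" "ear H a p b"
  shows "Img (path_edges (a # p @ [b])) \<inter> Img H = {pos a, pos b}"
proof -
  have "Img (path_edges (a # p @ [b])) \<inter> Img H = pos ` (\<Union>(path_edges (a # p @ [b])) \<inter> \<Union>H)"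
    using assms unfolding ear_def by (intro Img_Int) auto
  also have "\<Union>(path_edges (a # p @ [b])) = set (a # p @ [b])"
    by (rule Union_path_edges) auto
  also have "set (a # p @ [b]) \<inter> \<Union>H = {a, b}" using assms unfolding ear_def by auto
  finally show ?thesis by simp
qed

lemma ear_open_arc:
  assumes "ear H a p b"
  defines "P \<equiv> Img (path_edges (a # p @ [b]))"
  shows "connected (P - {pos a, pos b})" "P - {pos a, pos b} \<noteq> {}"
    "P \<subseteq> closure (P - {pos a, pos b})"
proof -
  obtain g where g: "arc g" "pathstart g = pos a" "pathfinish g = pos b" "path_image g = P"
    using path_arc_ends[of a p b] assms unfolding ear_def P_def by auto
  then have sp: "simple_path g" by (simp add: arc_imp_simple_path)
  show "connected (P - {pos a, pos b})"
    using connected_simple_path_endless[OF sp] g by simp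
  show "P - {pos a, pos b} \<noteq> {}"
    using nonempty_simple_path_endless[OF sp] g by simp
  have eq: "P - {pos a, pos b} = g ` {0<..<1}"
    using simple_path_endless[OF sp] g by simp
  have "continuous_on (closure {0<..<1}) g"
    using g(1) by (simp add: arc_def path_def)
  then have "g ` closure {0<..<1} \<subseteq> closure (g ` {0<..<1})"
    by (intro image_closure_subset closure_subset) auto
  moreover have "P = g ` closure {0<..<1}" unfolding g(4)[symmetric] by (simp add: path_image_def)
  ultimately show "P \<subseteq> closure (P - {pos a, pos b})"
    unfolding eq by simp
qed

text \<open>The open ear is connected and misses the frontier of \<open>R\<close>, which belongs to
  the old drawing, so it stays in \<open>R\<close>. Its ends are limits of it and therefore lie on
  the boundary cycle. \<open>R\<close> will be a bounded face or the unbounded one.\<close>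

lemma ear_in_region:
  assumes HE: "H \<subseteq> E" and ear: "ear H a p b" and C: "C \<subseteq> H"
    and R: "open R" "frontier R = Img C" "R \<inter> Img H = {}"
    and meet: "(Img (path_edges (a # p @ [b])) - {pos a, pos b}) \<inter> R \<noteq> {}"
  shows "Img (path_edges (a # p @ [b])) - {pos a, pos b} \<subseteq> R" "a \<in> \<Union>C" "b \<in> \<Union>C"
proof -
  let ?P = "Img (path_edges (a # p @ [b]))"
  note op = ear_open_arc[OF ear]
  have "(?P - {pos a, pos b}) \<inter> frontier R = {}"
    using ear_Img_Int[OF HE ear] Img_mono[OF C] unfolding R(2) by blast
  then show sub: "?P - {pos a, pos b} \<subseteq> R"
    using connected_subset_component[OF op(1) meet] by blast
  have cl: "closure R = R \<union> Img C" using R(1,2) closure_subset[of R] by (auto simp: frontier_def interior_open)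
  have "x \<in> \<Union>C" if "x = a \<or> x = b" for x
  proof -
    have "pos x \<in> ?P \<inter> Img H" using ear_Img_Int[OF HE ear] that by blast
    moreover have "?P \<subseteq> R \<union> Img C" using op(3) closure_mono[OF sub] cl by blast
    ultimately have "pos x \<in> Img C" using R(3) by blast
    moreover have "x \<in> \<Union>E" using that ear HE unfolding ear_def by blast
    ultimately show ?thesis using pos_in_Img[of C x] C HE by blast
  qed
  then show "a \<in> \<Union>C" "b \<in> \<Union>C" by auto
qed

lemma ear_theta:
  assumes HE: "H \<subseteq> E" and ear: "ear H a p b"
    and d: "distinct (a # q @ b # r)" "q \<noteq> [] \<or> r \<noteq> []"
    and C: "path_edges (a # q @ [b]) \<union> path_edges (a # r @ [b]) \<subseteq> H"
  obtains g1 g2 g where "arc g1" "arc g2" "arc g"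
    "pathstart g1 = pos a" "pathfinish g1 = pos b" "pathstart g2 = pos a" "pathfinish g2 = pos b"
    "pathstart g = pos a" "pathfinish g = pos b" "pos a \<noteq> pos b"
    "path_image g1 = Img (path_edges (a # q @ [b]))" "path_image g2 = Img (path_edges (a # r @ [b]))"
    "path_image g = Img (path_edges (a # p @ [b]))"
    "path_image g1 \<inter> path_image g2 = {pos a, pos b}" "path_image g1 \<inter> path_image g = {pos a, pos b}"
    "path_image g2 \<inter> path_image g = {pos a, pos b}"
    "is_cycle (path_edges (a # q @ [b]) \<union> path_edges (a # p @ [b]))"
    "is_cycle (path_edges (a # r @ [b]) \<union> path_edges (a # p @ [b]))"
proof -
  obtain g1 where g1: "arc g1" "pathstart g1 = pos a" "pathfinish g1 = pos b"
      "path_image g1 = Img (path_edges (a # q @ [b]))"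
    by (rule path_arc_ends[of a q b]) (use d C HE in auto)
  obtain g2 where g2: "arc g2" "pathstart g2 = pos a" "pathfinish g2 = pos b"
      "path_image g2 = Img (path_edges (a # r @ [b]))"
    by (rule path_arc_ends[of a r b]) (use d C HE in auto)
  obtain g where g: "arc g" "pathstart g = pos a" "pathfinish g = pos b"
      "path_image g = Img (path_edges (a # p @ [b]))"
    using path_arc_ends[of a p b] ear unfolding ear_def by auto
  have ab: "pos a \<noteq> pos b" using arc_distinct_ends[OF g(1)] g by simp
  have U: "\<Union>(path_edges (a # q @ [b])) = set (a # q @ [b])" "\<Union>(path_edges (a # r @ [b])) = set (a # r @ [b])"
    by (rule Union_path_edges; simp)+
  have sub: "set q \<subseteq> \<Union>H" "set r \<subseteq> \<Union>H"
    using U Union_mono[of "path_edges (a # q @ [b])" H] Union_mono[of "path_edges (a # r @ [b])" H] C by auto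
  \<comment> \<open>If both lists were empty, the ear and the old path would be the same edge
    \<open>{a, b}\<close>, but no edge of the ear is in \<open>H\<close>.\<close>
  have ne: "x \<noteq> [] \<or> p \<noteq> []" if "path_edges (a # x @ [b]) \<subseteq> H" for x
    using ear that unfolding ear_def by auto
  have dq: "distinct (a # q @ b # p)" "q \<noteq> [] \<or> p \<noteq> []" and dr: "distinct (a # r @ b # p)" "r \<noteq> [] \<or> p \<noteq> []"
    using d ear sub ne[of q] ne[of r] C unfolding ear_def by auto
  show thesis
  proof (rule that[OF g1(1) g2(1) g(1) g1(2,3) g2(2,3) g(2,3) ab g1(4) g2(4) g(4)])
    show "path_image g1 \<inter> path_image g2 = {pos a, pos b}"
      unfolding g1 g2 using d C HE by (intro paths_Int) auto
    show "path_image g1 \<inter> path_image g = {pos a, pos b}"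
      unfolding g1 g using dq C HE ear unfolding ear_def by (intro paths_Int) auto
    show "path_image g2 \<inter> path_image g = {pos a, pos b}"
      unfolding g2 g using dr C HE ear unfolding ear_def by (intro paths_Int) auto
  qed (use dq dr in \<open>auto intro!: is_cycleI\<close>)
qed

text \<open>The ear cuts the inside of \<open>C\<close> into the insides of two cycles, each made of
  the ear and one half of \<open>C\<close>; these replace \<open>C\<close> in \<open>F\<close>.
  Edges of the ear lie on exactly these two cycles, and every edge of \<open>C\<close> passes to
  exactly one of them, so the covering bound survives.\<close>

lemma ear_step_inside:
  assumes HE: "H \<subseteq> E" and ear: "ear H a p b" and faces: "plane_faces H F C0" and CF: "C \<in> F"
    and meet: "(Img (path_edges (a # p @ [b])) - {pos a, pos b}) \<inter> inside (Img C) \<noteq> {}"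
  shows "\<exists>F'. plane_faces (H \<union> path_edges (a # p @ [b])) F' C0 \<and> card F' = card F + 1"
proof -
  let ?P = "path_edges (a # p @ [b])"
  note f = plane_facesD[OF faces]
  have C: "is_cycle C" "C \<subseteq> H" "inside (Img C) \<inter> Img H = {}" "finite F"
    "inside (Img C) \<inter> outside (Img C0) = {}"
    using f(3) f(4,5,7,8)[OF CF] by simp_all
  have "C \<subseteq> E" using C HE by auto
  note J = cycle_Jordan[OF C(1) this]
  note r = ear_in_region[OF HE ear C(2) J(3,7) C(3) meet]
  have ab: "a \<noteq> b" using ear by (auto simp: ear_def)
  obtain q s where d: "distinct (a # q @ b # s)" "q \<noteq> [] \<or> s \<noteq> []"
     and Ceq: "C = path_edges (a # q @ [b]) \<union> path_edges (a # s @ [b])"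
    by (rule is_cycle_split[OF C(1) r(2,3) ab]) blast
  let ?A1 = "path_edges (a # q @ [b])" and ?A2 = "path_edges (a # s @ [b])"
  obtain g1 g2 g where g: "arc g1" "arc g2" "arc g"
    "pathstart g1 = pos a" "pathfinish g1 = pos b" "pathstart g2 = pos a" "pathfinish g2 = pos b"
    "pathstart g = pos a" "pathfinish g = pos b" "pos a \<noteq> pos b"
    "path_image g1 = Img ?A1" "path_image g2 = Img ?A2"
    "path_image g = Img ?P"
    "path_image g1 \<inter> path_image g2 = {pos a, pos b}" "path_image g1 \<inter> path_image g = {pos a, pos b}"
    "path_image g2 \<inter> path_image g = {pos a, pos b}"
    and cyc: "is_cycle (?A1 \<union> ?P)" "is_cycle (?A2 \<union> ?P)"
    by (rule ear_theta[OF HE ear d]) (use C(2) Ceq in auto)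
  have ne: "path_image g \<inter> inside (path_image g1 \<union> path_image g2) \<noteq> {}"
    using meet unfolding g Ceq Img_Un by blast
  obtain dis: "inside (path_image g1 \<union> path_image g) \<inter> inside (path_image g2 \<union> path_image g) = {}"
    and un: "inside (path_image g1 \<union> path_image g) \<union> inside (path_image g2 \<union> path_image g) \<union>
           (path_image g - {pos a, pos b}) = inside (path_image g1 \<union> path_image g2)"
    by (rule split_inside_simple_closed_curve[OF arc_imp_simple_path[OF g(1)] g(4,5)
      arc_imp_simple_path[OF g(2)] g(6,7) arc_imp_simple_path[OF g(3)] g(8-10,14-16) ne])
  let ?C1 = "?A1 \<union> ?P" and ?C2 = "?A2 \<union> ?P"
  have dis: "inside (Img ?C1) \<inter> inside (Img ?C2) = {}"
    using dis unfolding g Img_Un .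
  have un: "inside (Img ?C1) \<union> inside (Img ?C2) \<union> (Img ?P - {pos a, pos b}) = inside (Img C)"
    using un unfolding g Ceq Img_Un .
  have dP: "?P \<inter> H = {}" using ear by (auto simp: ear_def)
  have neP: "?P \<noteq> {}" by (cases p) auto
  have neA: "?A1 \<noteq> {}" "?A2 \<noteq> {}" by (cases q; auto) (cases s; auto)
  have dA: "?A1 \<inter> ?A2 = {}" by (rule path_edges_disjoint[OF d])
  have AH: "?A1 \<subseteq> H" "?A2 \<subseteq> H" using C(2) Ceq by auto
  have FH: "D \<subseteq> H" if "D \<in> F" for D by (rule f(5)[OF that])
  have new: "?C1 \<notin> F" "?C2 \<notin> F" using FH[of ?C1] FH[of ?C2] dP neP by blast+
  have C12: "?C1 \<noteq> ?C2" using neA dA AH dP by blast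
  define F' where "F' = insert ?C1 (insert ?C2 (F - {C}))"
  have card: "card F' = card F + 1"
    unfolding F'_def using new C12 C(4) CF card_Suc_Diff1[OF C(4) CF] by simp
  have sub: "inside (Img ?C1) \<subseteq> inside (Img C)" "inside (Img ?C2) \<subseteq> inside (Img C)"
    using un by blast+
  have newin: "inside (Img (A \<union> ?P)) \<inter> Img (H \<union> ?P) = {}"
    if "inside (Img (A \<union> ?P)) \<subseteq> inside (Img C)" for A
  proof -
    have aux: "I \<inter> (X \<union> Q) = {}" if "I \<subseteq> J" "J \<inter> X = {}" "I \<inter> (B \<union> Q) = {}" for I J X B Q :: "complex set"
      using that by blast
    show ?thesis
      unfolding Img_Un by (rule aux[OF that[unfolded Img_Un] C(3)]) (rule inside_no_overlap)
  qed
  have PH: "Img ?P \<inter> Img H = {pos a, pos b}" by (rule ear_Img_Int[OF HE ear])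
  have Psub: "Img ?P \<subseteq> inside (Img C) \<union> Img H" using r(1) PH by blast
  have disC: "inside (Img D) \<inter> inside (Img C) = {}" if "D \<in> F - {C}" for D
    using f(9)[of D C] that CF by blast
  have cov: "card {D \<in> F'. e \<in> D} + (if e \<in> C0 then 1 else 0) \<le> 2" for e
  proof (cases "e \<in> ?P")
    case True
    then have "e \<notin> C0" "{D \<in> F'. e \<in> D} \<subseteq> {?C1, ?C2}" using dP f(2) FH unfolding F'_def by auto
    moreover have "card {?C1, ?C2} \<le> 2" by (simp add: card_insert_if)
    ultimately show ?thesis using card_mono[of "{?C1, ?C2}" "{D \<in> F'. e \<in> D}"] by auto
  next
    case False
    have fin: "finite {D \<in> F. e \<in> D}" using C(4) by auto
    have "card {D \<in> F'. e \<in> D} = card {D \<in> F. e \<in> D}"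
    proof (cases "e \<in> C")
      case True
      have in_C: "C \<in> {D \<in> F. e \<in> D}" using True CF by auto
      have ex: "\<exists>D. {D \<in> F'. e \<in> D} = insert D ({D \<in> F. e \<in> D} - {C}) \<and> D \<notin> F"
      proof (cases "e \<in> ?A1")
        case True
        then have "{D \<in> F'. e \<in> D} = insert ?C1 ({D \<in> F. e \<in> D} - {C})"
          using dA False unfolding F'_def by blast
        then show ?thesis using new by blast
      next
        case F2: False
        then have "e \<in> ?A2" using True Ceq by blast
        then have "{D \<in> F'. e \<in> D} = insert ?C2 ({D \<in> F. e \<in> D} - {C})"
          using F2 False unfolding F'_def by blast
        then show ?thesis using new by blast
      qed
      then obtain D where D: "{D \<in> F'. e \<in> D} = insert D ({D \<in> F. e \<in> D} - {C})" "D \<notin> F" by blast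
      then have "card {D \<in> F'. e \<in> D} = Suc (card ({D \<in> F. e \<in> D} - {C}))"
        using fin by simp
      then show ?thesis using card_Suc_Diff1[OF fin in_C] by simp
    next
      case F2: False
      then have "{D \<in> F'. e \<in> D} = {D \<in> F. e \<in> D}" using False Ceq unfolding F'_def by blast
      then show ?thesis by simp
    qed
    then show ?thesis using f(11)[of e] by simp
  qed
  have "plane_faces (H \<union> ?P) F' C0"
    unfolding plane_faces_def
  proof (intro conjI)
    show "is_cycle C0" "C0 \<subseteq> H \<union> ?P" "finite F'" using f(1-3) by (auto simp: F'_def)
    show "\<forall>D\<in>F'. is_cycle D \<and> D \<subseteq> H \<union> ?P" using f(4,5) cyc AH by (auto simp: F'_def)
    show "outside (Img C0) \<inter> Img (H \<union> ?P) = {}"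
    proof -
      show ?thesis using C(5) Psub f(6) unfolding Img_Un by blast
    qed
    show "\<forall>D\<in>F'. inside (Img D) \<inter> Img (H \<union> ?P) = {}"
    proof
      fix D assume D: "D \<in> F'"
      show "inside (Img D) \<inter> Img (H \<union> ?P) = {}"
      proof (cases "D \<in> F - {C}")
        case True
        then have "inside (Img D) \<inter> Img H = {}" using f(7) by blast
        then show ?thesis using disC[OF True] Psub unfolding Img_Un by blast
      next
        case False
        then have "D = ?C1 \<or> D = ?C2" using D unfolding F'_def by blast
        then show ?thesis using newin[OF sub(1)] newin[OF sub(2)] by (elim disjE) (simp_all only:)
      qed
    qed
    show "\<forall>D\<in>F'. inside (Img D) \<inter> outside (Img C0) = {}"
    proof
      fix D assume D: "D \<in> F'"
      show "inside (Img D) \<inter> outside (Img C0) = {}"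
      proof (cases "D \<in> F - {C}")
        case False
        then have "D = ?C1 \<or> D = ?C2" using D unfolding F'_def by blast
        then have "inside (Img D) \<subseteq> inside (Img C)" using sub by (elim disjE) (simp_all only:)
        then show ?thesis using C(5) by blast
      qed (use f(8) in blast)
    qed
    show "\<forall>D\<in>F'. \<forall>D'\<in>F'. D \<noteq> D' \<longrightarrow> inside (Img D) \<inter> inside (Img D') = {}"
    proof -
      have 1: "inside (Img D) \<inter> inside (Img D') = {}" if "D \<in> {?C1, ?C2}" "D' \<in> F - {C}" for D D'
      proof -
        have "inside (Img D) \<subseteq> inside (Img C)" using sub that(1) by blast
        then show ?thesis using disC[OF that(2)] by blast
      qed
      have 2: "inside (Img D) \<inter> inside (Img D') = {}" if "D \<in> F - {C}" "D' \<in> F - {C}" "D \<noteq> D'" for D D'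
        by (rule f(9)[OF _ _ that(3)]) (use that in blast)+
      have 3: "inside (Img D) \<inter> inside (Img D') = {}" if "D \<in> {?C1, ?C2}" "D' \<in> {?C1, ?C2}" "D \<noteq> D'" for D D'
        using that dis by (auto simp only: insert_iff empty_iff Int_commute)
      have "F' = {?C1, ?C2} \<union> (F - {C})" by (auto simp: F'_def)
      then show ?thesis using 1 2 3 by (metis (no_types, lifting) Int_commute UnE)
    qed
    show "- Img (H \<union> ?P) \<subseteq> outside (Img C0) \<union> (\<Union>D\<in>F'. inside (Img D))"
    proof
      fix z assume z: "z \<in> - Img (H \<union> ?P)"
      then have "z \<in> outside (Img C0) \<union> (\<Union>D\<in>F. inside (Img D))"
        using f(10) unfolding Img_Un by blast
      moreover have "z \<in> inside (Img ?C1) \<or> z \<in> inside (Img ?C2)" if "z \<in> inside (Img C)"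
      proof -
        have "z \<notin> Img ?P" using z unfolding Img_Un by blast
        then show ?thesis using that unfolding un[symmetric] by blast
      qed
      ultimately show "z \<in> outside (Img C0) \<union> (\<Union>D\<in>F'. inside (Img D))"
        unfolding F'_def by blast
    qed
    show "\<forall>e. card {D \<in> F'. e \<in> D} + (if e \<in> C0 then 1 else 0) \<le> 2" using cov by blast
  qed
  then show ?thesis using card by blast
qed

text \<open>The assumption \<open>ins\<close> says that the half \<open>s\<close> of
  \<open>C0\<close> is enclosed by the other half and the ear. These two form the new outer cycle,
  and the only new bounded face lies between the ear and the half \<open>s\<close>. Edges of that
  half exchange the outer cycle for the new face, edges of the other half stay on the outer cycle,
  and edges of the ear lie on both new cycles.\<close>

lemma ear_step_outside_aux:
  assumes HE: "H \<subseteq> E" and ear: "ear H a p b" and faces: "plane_faces H F C0"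
    and meet: "(Img (path_edges (a # p @ [b])) - {pos a, pos b}) \<inter> outside (Img C0) \<noteq> {}"
    and d: "distinct (a # q @ b # s)" "q \<noteq> [] \<or> s \<noteq> []"
    and Ceq: "C0 = path_edges (a # q @ [b]) \<union> path_edges (a # s @ [b])"
    and ins: "Img (path_edges (a # s @ [b])) \<inter>
      inside (Img (path_edges (a # q @ [b]) \<union> path_edges (a # p @ [b]))) \<noteq> {}"
  shows "\<exists>F' C0'. plane_faces (H \<union> path_edges (a # p @ [b])) F' C0' \<and> card F' = card F + 1"
proof -
  let ?P = "path_edges (a # p @ [b])"
  note f = plane_facesD[OF faces]
  have C: "is_cycle C0" "C0 \<subseteq> H" "outside (Img C0) \<inter> Img H = {}" "finite F"
    by (rule f)+
  have "C0 \<subseteq> E" using C HE by auto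
  note J = cycle_Jordan[OF C(1) this]
  note r = ear_in_region[OF HE ear C(2) J(4,8) C(3) meet]
  let ?A1 = "path_edges (a # q @ [b])" and ?A2 = "path_edges (a # s @ [b])"
  obtain g1 g2 g where g: "arc g1" "arc g2" "arc g"
    "pathstart g1 = pos a" "pathfinish g1 = pos b" "pathstart g2 = pos a" "pathfinish g2 = pos b"
    "pathstart g = pos a" "pathfinish g = pos b" "pos a \<noteq> pos b"
    "path_image g1 = Img ?A1" "path_image g2 = Img ?A2"
    "path_image g = Img ?P"
    "path_image g1 \<inter> path_image g2 = {pos a, pos b}" "path_image g1 \<inter> path_image g = {pos a, pos b}"
    "path_image g2 \<inter> path_image g = {pos a, pos b}"
    and cyc: "is_cycle (?A1 \<union> ?P)" "is_cycle (?A2 \<union> ?P)"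
    by (rule ear_theta[OF HE ear d]) (use C(2) Ceq in auto)
  have ne: "path_image g2 \<inter> inside (path_image g1 \<union> path_image g) \<noteq> {}"
    using ins unfolding g Img_Un .
  have com: "path_image g \<inter> path_image g2 = {pos a, pos b}" "path_image g1 \<inter> path_image g2 = {pos a, pos b}"
    using g by (simp_all add: Int_commute)
  \<comment> \<open>The splitting theorem is used with exchanged roles: the loop consists of
    \<open>g1\<close> and the ear \<open>g\<close>, and the old arc \<open>g2\<close> is the one
    that cuts its inside.\<close>
  obtain dis: "inside (path_image g1 \<union> path_image g2) \<inter> inside (path_image g \<union> path_image g2) = {}"
    and un: "inside (path_image g1 \<union> path_image g2) \<union> inside (path_image g \<union> path_image g2) \<union>
           (path_image g2 - {pos a, pos b}) = inside (path_image g1 \<union> path_image g)"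
    by (rule split_inside_simple_closed_curve[OF arc_imp_simple_path[OF g(1)] g(4,5)
      arc_imp_simple_path[OF g(3)] g(8,9) arc_imp_simple_path[OF g(2)] g(6,7,10,15) com(2,1) ne])
  let ?C1 = "?A1 \<union> ?P" and ?C2 = "?A2 \<union> ?P"
  have I: "path_image g1 \<union> path_image g2 = Img C0" "path_image g \<union> path_image g2 = Img ?C2"
    "path_image g1 \<union> path_image g = Img ?C1"
    unfolding g Ceq Img_Un by blast+
  have dis: "inside (Img C0) \<inter> inside (Img ?C2) = {}"
    using dis unfolding I .
  have un: "inside (Img C0) \<union> inside (Img ?C2) \<union> (Img ?A2 - {pos a, pos b}) = inside (Img ?C1)"
    using un[unfolded I, unfolded g(12)] .
  have dP: "?P \<inter> H = {}" using ear by (auto simp: ear_def)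
  have neP: "?P \<noteq> {}" by (cases p) auto
  have dA: "?A1 \<inter> ?A2 = {}" by (rule path_edges_disjoint[OF d])
  have AH: "?A1 \<subseteq> H" "?A2 \<subseteq> H" using C(2) Ceq by auto
  have FH: "D \<subseteq> H" if "D \<in> F" for D by (rule f(5)[OF that])
  have new: "?C2 \<notin> F" using FH[of ?C2] dP neP by blast
  define F' where "F' = insert ?C2 F"
  have card: "card F' = card F + 1" unfolding F'_def using new C(4) by simp
  have "?C1 \<subseteq> E" using AH HE ear unfolding ear_def by blast
  note J1 = cycle_Jordan[OF cyc(1) this]
  have no2: "inside (Img ?C2) \<inter> Img ?C2 = {}" and no1: "inside (Img ?C1) \<inter> Img ?C1 = {}"
    by (simp_all only: inside_no_overlap)
  have sub: "inside (Img C0) \<subseteq> inside (Img ?C1)" "inside (Img ?C2) \<subseteq> inside (Img ?C1)"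
    using un by blast+
  have out: "inside (Img ?C2) \<subseteq> outside (Img C0)"
  proof -
    have aux: "I \<inter> (A \<union> B) = {}" if "I \<inter> (B \<union> Q) = {}" "I \<subseteq> J" "J \<inter> (A \<union> Q) = {}" for I J A B Q :: "complex set"
      using that by blast
    have "inside (Img ?C2) \<inter> Img C0 = {}"
      unfolding Ceq Img_Un by (rule aux[OF no2[unfolded Img_Un] sub(2)[unfolded Img_Un] no1[unfolded Img_Un]])
    then show ?thesis using dis J(6) by blast
  qed
  have out1: "outside (Img ?C1) \<subseteq> outside (Img C0)"
  proof -
    have "Img ?A2 \<subseteq> inside (Img ?C1) \<union> {pos a, pos b}" unfolding un[symmetric] by blast
    moreover have "{pos a, pos b} \<subseteq> Img ?A1" using g(14) unfolding g(11,12) by blast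
    ultimately have "Img C0 \<subseteq> inside (Img ?C1) \<union> Img ?C1"
      unfolding Ceq Img_Un by blast
    then show ?thesis using J(6) J1(5,6) sub(1) by blast
  qed
  have cov: "card {D \<in> F'. e \<in> D} + (if e \<in> ?C1 then 1 else 0) \<le> 2" for e
  proof -
    have fe: "card {D \<in> F. e \<in> D} + (if e \<in> C0 then 1 else 0) \<le> 2" using f(11) by blast
    have fin: "finite {D \<in> F. e \<in> D}" using C(4) by auto
    show ?thesis
    proof (cases "e \<in> ?P")
      case True
      then have "{D \<in> F'. e \<in> D} = {?C2}" using dP FH unfolding F'_def by auto
      then show ?thesis by simp
    next
      case False
      show ?thesis
      proof (cases "e \<in> ?A2")
        case True
        then have "{D \<in> F'. e \<in> D} = insert ?C2 {D \<in> F. e \<in> D}" "e \<in> C0" "e \<notin> ?C1"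
          using False dA unfolding F'_def Ceq by blast+
        then show ?thesis using fe fin new by simp
      next
        case F2: False
        then have "{D \<in> F'. e \<in> D} = {D \<in> F. e \<in> D}" "e \<in> C0 \<longleftrightarrow> e \<in> ?C1"
          using False unfolding F'_def Ceq by blast+
        then show ?thesis using fe by simp
      qed
    qed
  qed
  have PH: "Img ?P \<inter> Img H = {pos a, pos b}" by (rule ear_Img_Int[OF HE ear])
  have Psub: "Img ?P \<subseteq> outside (Img C0) \<union> Img H" using r(1) PH by blast
  have new2: "inside (Img ?C2) \<inter> Img (H \<union> ?P) = {}"
  proof -
    have aux: "I \<inter> (X \<union> Q) = {}" if "I \<subseteq> J" "J \<inter> X = {}" "I \<inter> (B \<union> Q) = {}" for I J X B Q :: "complex set"
      using that by blast
    show ?thesis unfolding Img_Un by (rule aux[OF out[unfolded Img_Un] C(3)]) (rule inside_no_overlap)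
  qed
  have "plane_faces (H \<union> ?P) F' ?C1"
    unfolding plane_faces_def
  proof (intro conjI)
    show "is_cycle ?C1" by (rule cyc)
    show "?C1 \<subseteq> H \<union> ?P" "finite F'" using AH C(4) by (auto simp: F'_def)
    show "\<forall>D\<in>F'. is_cycle D \<and> D \<subseteq> H \<union> ?P" using f(4,5) cyc AH by (auto simp: F'_def)
    show "outside (Img ?C1) \<inter> Img (H \<union> ?P) = {}"
    proof -
      have aux: "I \<inter> (X \<union> Q) = {}" if "I \<subseteq> J" "J \<inter> X = {}" "I \<inter> (B \<union> Q) = {}" for I J X B Q :: "complex set"
        using that by blast
      show ?thesis unfolding Img_Un by (rule aux[OF out1[unfolded Img_Un] C(3)]) (rule outside_no_overlap)
    qed
    show "\<forall>D\<in>F'. inside (Img D) \<inter> Img (H \<union> ?P) = {}"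
    proof
      fix D assume D: "D \<in> F'"
      show "inside (Img D) \<inter> Img (H \<union> ?P) = {}"
      proof (cases "D \<in> F")
        case True
        then have "inside (Img D) \<inter> Img H = {}" "inside (Img D) \<inter> outside (Img C0) = {}" using f(7,8) by blast+
        then show ?thesis using Psub unfolding Img_Un by blast
      next
        case False
        then have "D = ?C2" using D unfolding F'_def by blast
        then show ?thesis using new2 by (simp only:)
      qed
    qed
    show "\<forall>D\<in>F'. inside (Img D) \<inter> outside (Img ?C1) = {}"
    proof
      fix D assume D: "D \<in> F'"
      show "inside (Img D) \<inter> outside (Img ?C1) = {}"
      proof (cases "D \<in> F")
        case True
        then have "inside (Img D) \<inter> outside (Img C0) = {}" by (rule f(8))
        then show ?thesis using out1 by blast
      next
        case False
        then have "D = ?C2" using D unfolding F'_def by blast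
        then have "inside (Img D) \<subseteq> inside (Img ?C1)" using sub(2) by (simp only:)
        then show ?thesis using J1(5) by blast
      qed
    qed
    show "\<forall>D\<in>F'. \<forall>D'\<in>F'. D \<noteq> D' \<longrightarrow> inside (Img D) \<inter> inside (Img D') = {}"
    proof -
      have 1: "inside (Img D) \<inter> inside (Img ?C2) = {}" if "D \<in> F" for D
      proof -
        have "inside (Img D) \<inter> outside (Img C0) = {}" by (rule f(8)[OF that])
        then show ?thesis using out by blast
      qed
      have 2: "inside (Img D) \<inter> inside (Img D') = {}" if "D \<in> F" "D' \<in> F" "D \<noteq> D'" for D D'
        by (rule f(9)[OF _ _ that(3)]) (use that in blast)+
      show ?thesis using 1 2 unfolding F'_def by (metis Int_commute insertE)
    qed
    show "- Img (H \<union> ?P) \<subseteq> outside (Img ?C1) \<union> (\<Union>D\<in>F'. inside (Img D))"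
    proof
      fix z assume z: "z \<in> - Img (H \<union> ?P)"
      then have "z \<in> outside (Img C0) \<union> (\<Union>D\<in>F. inside (Img D))"
        using f(10) unfolding Img_Un by blast
      moreover have "z \<in> outside (Img ?C1) \<or> z \<in> inside (Img ?C2)" if "z \<in> outside (Img C0)"
      proof -
        have "z \<notin> Img ?C1" "z \<notin> Img ?A2"
          using z Img_mono[OF AH(1)] Img_mono[OF AH(2)] unfolding Img_Un by blast+
        moreover have "z \<notin> inside (Img C0)" using that J(5) by blast
        ultimately have "z \<in> outside (Img ?C1)" if "z \<notin> inside (Img ?C2)"
          using that J1(6) unfolding un[symmetric] by blast
        then show ?thesis by blast
      qed
      ultimately show "z \<in> outside (Img ?C1) \<union> (\<Union>D\<in>F'. inside (Img D))"
        unfolding F'_def by blast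
    qed
    show "\<forall>e. card {D \<in> F'. e \<in> D} + (if e \<in> ?C1 then 1 else 0) \<le> 2" using cov by blast
  qed
  then show ?thesis using card by blast
qed

text \<open>For an ear in the unbounded face, \<open>theta_arc_inside\<close> shows that one half of
  \<open>C0\<close> becomes enclosed. Which half is left open, and the two cases are
  symmetric.\<close>

lemma ear_step:
  assumes HE: "H \<subseteq> E" and ear: "ear H a p b" and faces: "plane_faces H F C0"
  shows "\<exists>F' C0'. plane_faces (H \<union> path_edges (a # p @ [b])) F' C0' \<and> card F' = card F + 1"
proof -
  let ?P = "Img (path_edges (a # p @ [b])) - {pos a, pos b}"
  note f = plane_facesD[OF faces]
  have "?P \<subseteq> - Img H" using ear_Img_Int[OF HE ear] by blast
  then have "?P \<subseteq> outside (Img C0) \<union> (\<Union>C\<in>F. inside (Img C))" using f(10) by blast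
  moreover have "?P \<noteq> {}" by (rule ear_open_arc[OF ear])
  ultimately consider (ins) C where "C \<in> F" "?P \<inter> inside (Img C) \<noteq> {}" | (out) "?P \<inter> outside (Img C0) \<noteq> {}"
    by blast
  then show ?thesis
  proof cases
    case ins
    then show ?thesis using ear_step_inside[OF HE ear faces] by blast
  next
    case out
    have C: "is_cycle C0" "C0 \<subseteq> H" "outside (Img C0) \<inter> Img H = {}" "finite F"
    by (rule f)+
    have "C0 \<subseteq> E" using C HE by auto
    note J = cycle_Jordan[OF C(1) this]
    note r = ear_in_region[OF HE ear C(2) J(4,8) C(3) out]
    have ab: "a \<noteq> b" using ear by (auto simp: ear_def)
    obtain q s where d: "distinct (a # q @ b # s)" "q \<noteq> [] \<or> s \<noteq> []"
       and Ceq: "C0 = path_edges (a # q @ [b]) \<union> path_edges (a # s @ [b])"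
      by (rule is_cycle_split[OF C(1) r(2,3) ab]) blast
    let ?A1 = "path_edges (a # q @ [b])" and ?A2 = "path_edges (a # s @ [b])"
    obtain g1 g2 g where g: "arc g1" "arc g2" "arc g"
      "pathstart g1 = pos a" "pathfinish g1 = pos b" "pathstart g2 = pos a" "pathfinish g2 = pos b"
      "pathstart g = pos a" "pathfinish g = pos b" "pos a \<noteq> pos b"
      "path_image g1 = Img ?A1" "path_image g2 = Img ?A2"
      "path_image g = Img (path_edges (a # p @ [b]))"
      "path_image g1 \<inter> path_image g2 = {pos a, pos b}" "path_image g1 \<inter> path_image g = {pos a, pos b}"
      "path_image g2 \<inter> path_image g = {pos a, pos b}"
      by (rule ear_theta[OF HE ear d]) (use C(2) Ceq in auto)
    have I: "path_image g1 \<union> path_image g2 = Img C0"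
      unfolding g Ceq Img_Un by blast
    have "path_image g \<inter> inside (path_image g1 \<union> path_image g2) = {}"
    proof -
      have "path_image g \<subseteq> outside (Img C0) \<union> Img C0" using r(1) g(11,13,14) I by blast
      then show ?thesis using J(5,6) unfolding I by blast
    qed
    then have "path_image g2 \<inter> inside (path_image g1 \<union> path_image g) \<noteq> {} \<or>
        path_image g1 \<inter> inside (path_image g2 \<union> path_image g) \<noteq> {}"
      by (intro theta_arc_inside[OF g(1-9) g(14-16)])
    then show ?thesis
    proof
      assume "path_image g2 \<inter> inside (path_image g1 \<union> path_image g) \<noteq> {}"
      then have "Img ?A2 \<inter> inside (Img (?A1 \<union> path_edges (a # p @ [b]))) \<noteq> {}"
        unfolding g Img_Un .
      then show ?thesis by (rule ear_step_outside_aux[OF HE ear faces out d Ceq])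
    next
      assume *: "path_image g1 \<inter> inside (path_image g2 \<union> path_image g) \<noteq> {}"
      have d': "distinct (a # s @ b # q)" "s \<noteq> [] \<or> q \<noteq> []" using d by auto
      have Ceq': "C0 = ?A2 \<union> ?A1" using Ceq by blast
      have "Img ?A1 \<inter> inside (Img (?A2 \<union> path_edges (a # p @ [b]))) \<noteq> {}"
        using * unfolding g Img_Un .
      then show ?thesis by (rule ear_step_outside_aux[OF HE ear faces out d' Ceq'])
    qed
  qed
qed

text \<open>The same cycle bounds both faces of the Jordan curve, so each of its edges is already
  counted twice.\<close>

lemma cycle_plane_faces:
  assumes "is_cycle C" "C \<subseteq> E"
  shows "plane_faces C {C} C"
proof -
  note J = cycle_Jordan[OF assms]
  show ?thesis
    unfolding plane_faces_def
  proof (intro conjI)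
    show "outside (Img C) \<inter> Img C = {}" "\<forall>D\<in>{C}. inside (Img D) \<inter> Img C = {}"
      using outside_no_overlap[of "Img C"] inside_no_overlap[of "Img C"] by auto
    show "- Img C \<subseteq> outside (Img C) \<union> (\<Union>D\<in>{C}. inside (Img D))" using J(6) by blast
    show "\<forall>D\<in>{C}. inside (Img D) \<inter> outside (Img C) = {}" using J(5) by blast
    have "{D \<in> {C}. e \<in> D} = (if e \<in> C then {C} else {})" for e by auto
    then show "\<forall>e. card {D \<in> {C}. e \<in> D} + (if e \<in> C then 1 else 0) \<le> 2" by simp
  qed (use assms in auto)
qed

end

section \<open>A cycle family covering every edge at most twice\<close>

definition edge_conn :: "'a set set \<Rightarrow> ('a \<times> 'a) set" where
  "edge_conn S = {(x, y). {x, y} \<in> S}\<^sup>*"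

lemma edge_conn_refl [simp]: "(x, x) \<in> edge_conn S"
  by (simp add: edge_conn_def)

lemma edge_conn_trans: "(x, y) \<in> edge_conn S \<Longrightarrow> (y, z) \<in> edge_conn S \<Longrightarrow> (x, z) \<in> edge_conn S"
  unfolding edge_conn_def by (rule rtrancl_trans)

lemma edge_conn_sym: "(x, y) \<in> edge_conn S \<Longrightarrow> (y, x) \<in> edge_conn S"
proof -
  have "sym {(x, y). {x, y} \<in> S}" by (auto simp: sym_def insert_commute)
  then have "sym (edge_conn S)" unfolding edge_conn_def by (rule sym_rtrancl)
  then show "(x, y) \<in> edge_conn S \<Longrightarrow> (y, x) \<in> edge_conn S" by (rule symD)
qed

lemma edge_conn_mono: "S \<subseteq> T \<Longrightarrow> (x, y) \<in> edge_conn S \<Longrightarrow> (x, y) \<in> edge_conn T"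
  unfolding edge_conn_def using rtrancl_mono[of "{(x, y). {x, y} \<in> S}" "{(x, y). {x, y} \<in> T}"] by blast

lemma edge_conn_step: "{x, y} \<in> S \<Longrightarrow> (x, y) \<in> edge_conn S"
  unfolding edge_conn_def by blast

lemma edge_conn_hd: "path_edges xs \<subseteq> S \<Longrightarrow> x \<in> set xs \<Longrightarrow> (hd xs, x) \<in> edge_conn S"
proof (induction xs rule: path_edges.induct)
  case (1 y z zs)
  show ?case
  proof (cases "x = y")
    case False
    then have "(z, x) \<in> edge_conn S" using 1 by simp
    moreover have "(y, z) \<in> edge_conn S" using 1 by (intro edge_conn_step) simp
    ultimately show ?thesis using edge_conn_trans by fastforce
  qed simp
qed auto

lemma edge_conn_path:
  assumes "(x, y) \<in> edge_conn S"
  shows "\<exists>xs. distinct (x # xs) \<and> last (x # xs) = y \<and> path_edges (x # xs) \<subseteq> S"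
  using assms unfolding edge_conn_def
proof (induction rule: converse_rtrancl_induct)
  case base
  show ?case by (intro exI[of _ "[]"]) simp
next
  case (step x z)
  then obtain xs where xs: "distinct (z # xs)" "last (z # xs) = y" "path_edges (z # xs) \<subseteq> S" by blast
  show ?case
  proof (cases "x \<in> set (z # xs)")
    case True
    then obtain us vs where uv: "z # xs = us @ x # vs" by (meson split_list)
    have "path_edges (x # vs) \<subseteq> S" using xs(3) path_edges_append[of us x vs] unfolding uv by blast
    moreover have "last (x # vs) = y" "distinct (x # vs)" using xs(1,2) unfolding uv by simp_all
    ultimately show ?thesis by blast
  next
    case False
    then show ?thesis using step(1) xs by (intro exI[of _ "z # xs"]) auto
  qed
qed

lemma is_cycle_nonempty: "is_cycle C \<Longrightarrow> C \<noteq> {}"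
proof -
  have "path_edges (a # p @ [b]) \<noteq> {}" for a b :: 'a and p by (cases p) auto
  then show "is_cycle C \<Longrightarrow> C \<noteq> {}" unfolding is_cycle_def by blast
qed

section \<open>Blocks grown from an edge by ears\<close>

context edge_drawing begin

text \<open>A path from \<open>a\<close> to \<open>b\<close> that avoids the edges of
  \<open>H\<close> is cut at its first return to a vertex of \<open>H\<close>. The ear may thus end
  at a vertex \<open>c\<close> other than \<open>b\<close>.\<close>

lemma ex_ear:
  assumes S: "S \<subseteq> E" and ab: "a \<in> \<Union>H" "b \<in> \<Union>H" "a \<noteq> b" "(a, b) \<in> edge_conn (S - H)"
  obtains c p where "ear H a p c" "path_edges (a # p @ [c]) \<subseteq> S"
proof -
  obtain xs where xs: "distinct (a # xs)" "last (a # xs) = b" "path_edges (a # xs) \<subseteq> S - H"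
    using edge_conn_path[OF ab(4)] by blast
  have "b \<in> set xs" using xs(2) ab(3) by (cases "xs = []") auto
  then have "\<exists>x\<in>set xs. x \<in> \<Union>H" using ab(2) by blast
  then obtain us c vs where uv: "xs = us @ c # vs" "c \<in> \<Union>H" "\<forall>u\<in>set us. u \<notin> \<Union>H"
    by (rule split_list_first_propE)
  have "path_edges (a # us @ [c]) \<subseteq> S - H"
    using xs(3) path_edges_append[of "a # us" c vs] unfolding uv(1) by auto
  then show thesis using that[of us c] xs(1) uv ab(1) S unfolding ear_def by auto
qed

text \<open>The equation is Euler's formula without the unbounded face. A single edge bounds no
  cycle, hence the separate alternative with \<open>F = {}\<close>, from which the first ear makes a
  cycle.\<close>

definition block :: "'a set set \<Rightarrow> 'a set set set \<Rightarrow> bool" where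
  "block H F \<longleftrightarrow> H \<subseteq> E \<and> H \<noteq> {} \<and> card H + 1 = card F + card (\<Union>H) \<and>
     (\<forall>x\<in>\<Union>H. \<forall>y\<in>\<Union>H. (x, y) \<in> edge_conn H) \<and>
     ((\<exists>u v. u \<noteq> v \<and> H = {{u, v}} \<and> F = {}) \<or> (\<exists>C0. plane_faces H F C0))"

lemma block_edge: "{u, v} \<in> E \<Longrightarrow> u \<noteq> v \<Longrightarrow> block {{u, v}} {}"
  unfolding block_def by (auto simp: edge_conn_step insert_commute)

lemma block_cases:
  assumes "block H F"
  obtains (edge) u v where "u \<noteq> v" "H = {{u, v}}" "F = {}" | (faces) C0 where "plane_faces H F C0"
proof -
  have "(\<exists>u v. u \<noteq> v \<and> H = {{u, v}} \<and> F = {}) \<or> (\<exists>C0. plane_faces H F C0)"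
    using assms unfolding block_def by (elim conjE)
  then show thesis
  proof (elim disjE exE conjE)
    fix u v assume "u \<noteq> v" "H = {{u, v}}" "F = {}"
    then show thesis by (rule edge)
  next
    fix C0 assume "plane_faces H F C0"
    then show thesis by (rule faces)
  qed
qed

lemma block_cycles:
  assumes "block H F"
  shows "finite F" "\<And>C. C \<in> F \<Longrightarrow> is_cycle C \<and> C \<subseteq> H" "card {C \<in> F. e \<in> C} \<le> 2"
proof -
  from assms have "finite F \<and> (\<forall>C\<in>F. is_cycle C \<and> C \<subseteq> H) \<and> card {C \<in> F. e \<in> C} \<le> 2"
  proof (cases rule: block_cases)
    case faces
    have "card {C \<in> F. e \<in> C} \<le> 2" using plane_facesD(11)[OF faces, of e] by simp
    then show ?thesis using plane_facesD(3-5)[OF faces] by blast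
  qed auto
  then show "finite F" "\<And>C. C \<in> F \<Longrightarrow> is_cycle C \<and> C \<subseteq> H" "card {C \<in> F. e \<in> C} \<le> 2" by simp_all
qed

lemma finite_Union_edges:
  assumes "S \<subseteq> E"
  shows "finite (\<Union>S)"
proof (rule finite_Union)
  show "finite S" using assms finite_edges finite_subset by blast
  show "finite e" if "e \<in> S" for e using edge_doubleton[of e] that assms by auto
qed

text \<open>The ear adds \<open>length p\<close> vertices, one edge more than that, and one face, so
  Euler's formula is preserved.\<close>

lemma block_ear:
  assumes block: "block H F" and ear: "ear H a p b"
  shows "\<exists>F'. block (H \<union> path_edges (a # p @ [b])) F'"
proof -
  let ?P = "path_edges (a # p @ [b])"
  have H: "H \<subseteq> E" "H \<noteq> {}" "card H + 1 = card F + card (\<Union>H)"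
    "\<And>x y. x \<in> \<Union>H \<Longrightarrow> y \<in> \<Union>H \<Longrightarrow> (x, y) \<in> edge_conn H"
    using block unfolding block_def by blast+
  have e: "distinct (a # p @ [b])" "a \<in> \<Union>H" "b \<in> \<Union>H" "set p \<inter> \<Union>H = {}" "?P \<inter> H = {}" "?P \<subseteq> E"
    using ear unfolding ear_def by auto
  have UP: "\<Union>?P = set (a # p @ [b])" by (rule Union_path_edges) simp
  have "card (H \<union> ?P) = card H + card ?P"
    using e(5) H(1) finite_edges finite_subset by (subst card_Un_disjoint) auto
  also have "card ?P = length p + 1" using card_path_edges[OF e(1)] by simp
  finally have cH: "card (H \<union> ?P) = card H + (length p + 1)" .
  have "\<Union>(H \<union> ?P) = \<Union>H \<union> set p" using UP e(2,3) by auto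
  then have "card (\<Union>(H \<union> ?P)) = card (\<Union>H) + card (set p)"
    using e(4) finite_Union_edges[OF H(1)] by (simp add: card_Un_disjoint Int_commute)
  also have "card (set p) = length p" using e(1) by (simp add: distinct_card)
  finally have cV: "card (\<Union>(H \<union> ?P)) = card (\<Union>H) + length p" .
  have conn: "(x, y) \<in> edge_conn (H \<union> ?P)" if "x \<in> \<Union>(H \<union> ?P)" "y \<in> \<Union>(H \<union> ?P)" for x y
  proof -
    have "(a, x) \<in> edge_conn (H \<union> ?P)" if "x \<in> \<Union>(H \<union> ?P)" for x
    proof (cases "x \<in> \<Union>H")
      case True
      then show ?thesis using H(4)[OF e(2)] edge_conn_mono[of H "H \<union> ?P"] by blast
    next
      case False
      then have "x \<in> set (a # p @ [b])" using that UP by auto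
      then show ?thesis using edge_conn_hd[of "a # p @ [b]" "H \<union> ?P" x] by simp
    qed
    then show ?thesis using that edge_conn_sym edge_conn_trans by metis
  qed
  from block have "\<exists>F' C0. plane_faces (H \<union> ?P) F' C0 \<and> card F' = card F + 1"
  proof (cases rule: block_cases)
    case edge
    have "a \<noteq> b" using e(1) by auto
    then have H_eq: "H = path_edges (a # [] @ [b])" using edge e(2,3) by auto
    then have "p \<noteq> []" using e(5) by auto
    then have "is_cycle (H \<union> ?P)" unfolding H_eq using e(1) by (intro is_cycleI) auto
    then have "plane_faces (H \<union> ?P) {H \<union> ?P} (H \<union> ?P)" using H(1) e(6) by (intro cycle_plane_faces) auto
    then show ?thesis using edge by (intro exI[of _ "{H \<union> ?P}"]) auto
  next
    case faces
    show ?thesis by (rule ear_step[OF H(1) ear faces])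
  qed
  then obtain F' C0 where F': "plane_faces (H \<union> ?P) F' C0" "card F' = card F + 1" by blast
  have "block (H \<union> ?P) F'"
    unfolding block_def
  proof (intro conjI)
    show "H \<union> ?P \<subseteq> E" "H \<union> ?P \<noteq> {}" using H(1,2) e(6) by blast+
    show "card (H \<union> ?P) + 1 = card F' + card (\<Union>(H \<union> ?P))" using F'(2) cH cV H(3) by linarith
    show "\<forall>x\<in>\<Union>(H \<union> ?P). \<forall>y\<in>\<Union>(H \<union> ?P). (x, y) \<in> edge_conn (H \<union> ?P)" using conn by blast
  qed (intro disjI2 exI, rule F'(1))
  then show ?thesis by blast
qed

text \<open>In a block with the largest number of edges, two vertices connected through
  \<open>S - H\<close> would yield an ear and thus a larger block. So each component of
  \<open>S - H\<close> contains at most one vertex of \<open>H\<close>.\<close>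

lemma maximal_block:
  assumes S: "S \<subseteq> E" "S \<noteq> {}"
  obtains H F where "block H F" "H \<subseteq> S"
    "\<And>a b. a \<in> \<Union>H \<Longrightarrow> b \<in> \<Union>H \<Longrightarrow> a \<noteq> b \<Longrightarrow> (a, b) \<notin> edge_conn (S - H)"
proof -
  obtain e where e: "e \<in> S" using S by blast
  then have eE: "e \<in> E" using S by blast
  then obtain u v where uv: "u \<noteq> v" "e = {u, v}" using edge_doubleton[OF eE] by blast
  have "block {e} {}" using block_edge[of u v] eE uv by simp
  then have ex: "\<exists>F. block {e} F \<and> {e} \<subseteq> S" using e by blast
  have fin: "finite S" using S finite_edges finite_subset by blast
  let ?Q = "\<lambda>H. (\<exists>F. block H F) \<and> H \<subseteq> S"
  have "\<forall>H. ?Q H \<longrightarrow> card H < Suc (card S)" using card_mono[OF fin] by (simp add: less_Suc_eq_le)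
  then obtain H where H: "?Q H" "\<And>H'. ?Q H' \<Longrightarrow> card H' \<le> card H"
    using ex_has_greatest_nat[of ?Q "{e}" card "Suc (card S)"] ex by blast
  then obtain F where F: "block H F" by blast
  have "(a, b) \<notin> edge_conn (S - H)" if ab: "a \<in> \<Union>H" "b \<in> \<Union>H" "a \<noteq> b" for a b
  proof
    assume conn: "(a, b) \<in> edge_conn (S - H)"
    obtain c p where ear: "ear H a p c" "path_edges (a # p @ [c]) \<subseteq> S"
      by (rule ex_ear[OF S(1) ab conn])
    let ?P = "path_edges (a # p @ [c])"
    obtain F' where "block (H \<union> ?P) F'" using block_ear[OF F ear(1)] by blast
    then have le: "card (H \<union> ?P) \<le> card H" using H ear(2) by blast
    have "H \<inter> ?P = {}" "?P \<noteq> {}" using ear(1) unfolding ear_def by (auto, cases p, auto)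
    then have "H \<subset> H \<union> ?P" by blast
    moreover have "finite (H \<union> ?P)" using fin H(1) finite_subset by auto
    ultimately show False using le psubset_card_mono[of "H \<union> ?P" H] by simp
  qed
  then show thesis using that[OF F] H(1) by blast
qed

text \<open>Euler's inequality for edge sets that may be disconnected, where an arbitrary set
  \<open>R\<close> with at most one vertex in each component replaces the number of components.
  Quantifying over \<open>R\<close> drives the induction: the vertices of a maximal block
  \<open>H\<close> lie in different components of \<open>S - H\<close>, so they may all be added to
  \<open>R\<close> once its possible member in the component of \<open>H\<close> is dropped. Cycles
  from different blocks share no edge, which keeps the covering bound.\<close>

lemma cycle_family_aux:
  assumes "S \<subseteq> E" "finite V" "\<Union>S \<subseteq> V"
  shows "\<exists>F. finite F \<and> (\<forall>C\<in>F. is_cycle C \<and> C \<subseteq> S) \<and> (\<forall>e. card {C \<in> F. e \<in> C} \<le> 2) \<and>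
    (\<forall>R\<subseteq>V. (\<forall>x\<in>R. \<forall>y\<in>R. x \<noteq> y \<longrightarrow> (x, y) \<notin> edge_conn S) \<longrightarrow> card S + card R \<le> card V + card F)"
  using assms
proof (induction "card S" arbitrary: S rule: less_induct)
  case less
  have finS: "finite S" by (rule finite_subset[OF less.prems(1) finite_edges])
  show ?case
  proof (cases "S = {}")
    case True
    then show ?thesis using card_mono[OF assms(2)] by (intro exI[of _ "{}"]) auto
  next
    case False
    obtain H F1 where H: "block H F1" "H \<subseteq> S"
      and noear: "\<And>a b. a \<in> \<Union>H \<Longrightarrow> b \<in> \<Union>H \<Longrightarrow> a \<noteq> b \<Longrightarrow> (a, b) \<notin> edge_conn (S - H)"
      using maximal_block[OF less.prems(1) False] by blast
    note F1 = block_cycles[OF H(1)]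
    have bl: "H \<noteq> {}" "card H + 1 = card F1 + card (\<Union>H)"
      "\<And>x y. x \<in> \<Union>H \<Longrightarrow> y \<in> \<Union>H \<Longrightarrow> (x, y) \<in> edge_conn H"
      using H(1) unfolding block_def by blast+
    have cS: "card S = card (S - H) + card H"
      using card_Diff_subset[of H S] card_mono[OF finS H(2)] finite_subset[OF H(2) finS] H(2) by simp
    have "card H > 0" using bl(1) finite_subset[OF H(2) finS] by (simp add: card_gt_0_iff)
    then have "card (S - H) < card S" using cS by simp
    then have "\<exists>F. finite F \<and> (\<forall>C\<in>F. is_cycle C \<and> C \<subseteq> S - H) \<and> (\<forall>e. card {C \<in> F. e \<in> C} \<le> 2) \<and>
      (\<forall>R\<subseteq>V. (\<forall>x\<in>R. \<forall>y\<in>R. x \<noteq> y \<longrightarrow> (x, y) \<notin> edge_conn (S - H)) \<longrightarrow>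
        card (S - H) + card R \<le> card V + card F)"
      using less.prems by (intro less.hyps) auto
    then obtain F2 where X: "finite F2 \<and> (\<forall>C\<in>F2. is_cycle C \<and> C \<subseteq> S - H) \<and> (\<forall>e. card {C \<in> F2. e \<in> C} \<le> 2) \<and>
      (\<forall>R\<subseteq>V. (\<forall>x\<in>R. \<forall>y\<in>R. x \<noteq> y \<longrightarrow> (x, y) \<notin> edge_conn (S - H)) \<longrightarrow>
        card (S - H) + card R \<le> card V + card F2)" ..
    note F2 = X[THEN conjunct1] bspec[OF X[THEN conjunct2, THEN conjunct1]]
      spec[OF X[THEN conjunct2, THEN conjunct2, THEN conjunct1]]
    note bound = mp[OF mp[OF spec[OF X[THEN conjunct2, THEN conjunct2, THEN conjunct2]]]]
    have dis: "F1 \<inter> F2 = {}"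
    proof -
      have False if "C \<in> F1" "C \<in> F2" for C
        using F1(2)[OF that(1)] F2(2)[OF that(2)] is_cycle_nonempty[of C] by blast
      then show ?thesis by blast
    qed
    have cF: "card (F1 \<union> F2) = card F1 + card F2" using dis F1(1) F2(1) by (simp add: card_Un_disjoint)
    have cov: "card {C \<in> F1 \<union> F2. e \<in> C} \<le> 2" for e
    proof (cases "e \<in> H")
      case True
      then have "{C \<in> F1 \<union> F2. e \<in> C} = {C \<in> F1. e \<in> C}" using F2(2) by blast
      then show ?thesis using F1(3) by simp
    next
      case False
      then have "{C \<in> F1 \<union> F2. e \<in> C} = {C \<in> F2. e \<in> C}" using F1(2) by blast
      then show ?thesis using F2(3) by simp
    qed
    have "card S + card R \<le> card V + card (F1 \<union> F2)"
      if R: "R \<subseteq> V" "\<forall>x\<in>R. \<forall>y\<in>R. x \<noteq> y \<longrightarrow> (x, y) \<notin> edge_conn S" for R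
    proof -
      obtain u where u: "u \<in> \<Union>H" using bl(1) H less.prems(1) edge_doubleton by blast
      define K where "K = {x. (u, x) \<in> edge_conn S}"
      have HK: "\<Union>H \<subseteq> K" using bl(3)[OF u] edge_conn_mono[OF H(2)] unfolding K_def by blast
      have finR: "finite R" using R(1) assms(2) finite_subset by blast
      have finH: "finite (\<Union>H)" using finite_Union_edges H(2) less.prems(1) by blast
      have "x = y" if "x \<in> R \<inter> K" "y \<in> R \<inter> K" for x y
        using that R(2) edge_conn_sym edge_conn_trans unfolding K_def by (metis IntD1 IntD2 mem_Collect_eq)
      then have "card (R \<inter> K) \<le> 1" using finR by (simp add: card_le_Suc0_iff_eq)
      moreover have "card R = card (R - K) + card (R \<inter> K)"
        using card_Int_Diff[OF finR, of K] by simp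
      moreover have "card ((R - K) \<union> \<Union>H) = card (R - K) + card (\<Union>H)"
        using HK finR finH by (intro card_Un_disjoint) auto
      \<comment> \<open>\<open>R\<close> loses at most one vertex and gains
        \<open>card (\<Union>H)\<close>; the net gain is what Euler's formula for the block
        \<open>H\<close> requires.\<close>
      moreover have "card (S - H) + card ((R - K) \<union> \<Union>H) \<le> card V + card F2"
      proof (rule bound)
        show "R - K \<union> \<Union>H \<subseteq> V" using R(1) H(2) less.prems(3) by blast
        have mono: "(x, y) \<in> edge_conn (S - H) \<Longrightarrow> (x, y) \<in> edge_conn S" for x y
          using edge_conn_mono[of "S - H" S] by blast
        have sep: "(x, y) \<notin> edge_conn S" if "x \<in> R - K" "y \<in> \<Union>H" for x y
        proof
          assume "(x, y) \<in> edge_conn S"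
          moreover have "(u, y) \<in> edge_conn S" using that(2) HK unfolding K_def by blast
          ultimately have "(u, x) \<in> edge_conn S" using edge_conn_sym edge_conn_trans by metis
          then show False using that(1) unfolding K_def by blast
        qed
        show "\<forall>x\<in>R - K \<union> \<Union>H. \<forall>y\<in>R - K \<union> \<Union>H. x \<noteq> y \<longrightarrow> (x, y) \<notin> edge_conn (S - H)"
        proof (intro ballI impI)
          fix x y assume *: "x \<in> R - K \<union> \<Union>H" "y \<in> R - K \<union> \<Union>H" "x \<noteq> y"
          consider "x \<in> R - K" "y \<in> R - K" | "x \<in> R - K" "y \<in> \<Union>H" | "x \<in> \<Union>H" "y \<in> R - K"
            | "x \<in> \<Union>H" "y \<in> \<Union>H" using *(1,2) by blast
          then show "(x, y) \<notin> edge_conn (S - H)"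
          proof cases
            case 1
            then have "(x, y) \<notin> edge_conn S" using R(2) *(3) by blast
            then show ?thesis using mono by blast
          next
            case 2
            then show ?thesis using sep mono by blast
          next
            case 3
            then have "(y, x) \<notin> edge_conn S" using sep by blast
            then show ?thesis using mono[of x y] edge_conn_sym[of x y S] by blast
          next
            case 4
            then show ?thesis using noear[OF _ _ *(3)] by blast
          qed
        qed
      qed
      ultimately show ?thesis using cS cF bl(2) by linarith
    qed
    moreover have "finite (F1 \<union> F2)" using F1(1) F2(1) by simp
    moreover have "\<forall>C\<in>F1 \<union> F2. is_cycle C \<and> C \<subseteq> S" using F1(2) F2(2) H(2) by blast
    ultimately show ?thesis
      using cov by (intro exI[of _ "F1 \<union> F2"] conjI allI impI)
  qed
qed

text \<open>This is the easy direction of MacLane's planarity criterion; the family consists of the bounded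
  faces of all blocks.\<close>

theorem cycle_family:
  assumes "finite V" "V \<noteq> {}" "\<Union>E \<subseteq> V"
  obtains F where "finite F" "\<And>C. C \<in> F \<Longrightarrow> is_cycle C \<and> C \<subseteq> E"
    "\<And>e. card {C \<in> F. e \<in> C} \<le> 2" "card E + 1 \<le> card V + card F"
proof -
  obtain v where "v \<in> V" using assms by blast
  obtain F where F: "finite F \<and> (\<forall>C\<in>F. is_cycle C \<and> C \<subseteq> E) \<and> (\<forall>e. card {C \<in> F. e \<in> C} \<le> 2) \<and>
    (\<forall>R\<subseteq>V. (\<forall>x\<in>R. \<forall>y\<in>R. x \<noteq> y \<longrightarrow> (x, y) \<notin> edge_conn E) \<longrightarrow> card E + card R \<le> card V + card F)"
    using cycle_family_aux[OF subset_refl assms(1,3)] ..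
  have 1: "{v} \<subseteq> V" using \<open>v \<in> V\<close> by blast
  have 2: "\<forall>x\<in>{v}. \<forall>y\<in>{v}. x \<noteq> y \<longrightarrow> (x, y) \<notin> edge_conn E" by blast
  have "card E + card {v} \<le> card V + card F"
    by (rule F[THEN conjunct2, THEN conjunct2, THEN conjunct2, THEN spec, THEN mp, OF 1, THEN mp, OF 2])
  then have 3: "card E + 1 \<le> card V + card F" by simp
  show thesis
  proof (rule that[OF _ _ _ 3])
    show "finite F" by (rule F[THEN conjunct1])
    show "\<And>C. C \<in> F \<Longrightarrow> is_cycle C \<and> C \<subseteq> E" using F[THEN conjunct2, THEN conjunct1] by blast
    show "\<And>e. card {C \<in> F. e \<in> C} \<le> 2" using F[THEN conjunct2, THEN conjunct2, THEN conjunct1] by blast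
  qed
qed

end

section \<open>Counting edges\<close>

lemma is_cycle_edges_at:
  assumes "is_cycle C" "a \<in> \<Union>C"
  obtains x y where "x \<noteq> y" "x \<noteq> a" "y \<noteq> a" "{e \<in> C. a \<in> e} = {{a, x}, {a, y}}"
proof -
  obtain xs where xs: "distinct (a # xs)" "length xs \<ge> 2" "C = path_edges (a # xs @ [a])"
    using is_cycle_from[OF assms] by blast
  have ne: "xs \<noteq> []" using xs(2) by auto
  have "C = insert {a, hd xs} (insert {a, last xs} (path_edges xs))"
    unfolding xs(3) using ne by (simp add: path_edges_Cons path_edges_snoc insert_commute)
  moreover have "a \<notin> e" if "e \<in> path_edges xs" for e using path_edges_subset[OF that] xs(1) by auto
  ultimately have "{e \<in> C. a \<in> e} = {{a, hd xs}, {a, last xs}}" by blast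
  moreover have "hd xs \<noteq> last xs"
    using xs(1,2) by (cases xs) auto
  moreover have "hd xs \<noteq> a" "last xs \<noteq> a" using ne xs(1) by (metis distinct.simps(2) hd_in_set, metis distinct.simps(2) last_in_set)
  ultimately show thesis using that by blast
qed

lemma card_cycle:
  assumes "is_cycle C"
  shows "finite C" "card C \<ge> 3"
    and "a \<in> \<Union>C \<Longrightarrow> \<exists>xs. distinct (a # xs) \<and> length xs + 1 = card C \<and> C = path_edges (a # xs @ [a])"
proof -
  have *: "card (path_edges (a # xs @ [a])) = length xs + 1" if d: "distinct (a # xs)" "length xs \<ge> 2" for a :: 'a and xs
  proof -
    have ne: "xs \<noteq> []" using d by auto
    have "{a, hd xs} \<notin> path_edges (xs @ [a])"
    proof
      assume "{a, hd xs} \<in> path_edges (xs @ [a])"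
      then have "{a, hd xs} = {last xs, a} \<or> {a, hd xs} \<in> path_edges xs" using ne by (simp add: path_edges_snoc)
      moreover have "hd xs \<noteq> last xs" using d by (cases xs) auto
      ultimately have "{a, hd xs} \<in> path_edges xs" by (auto simp: doubleton_eq_iff)
      then show False using path_edges_subset d(1) by fastforce
    qed
    moreover have "card (path_edges (xs @ [a])) = length xs"
      using card_path_edges[of "xs @ [a]"] d by simp
    ultimately show ?thesis using ne by (simp add: path_edges_Cons)
  qed
  show fin: "finite C" using is_cycle_closed_list[OF assms] by (metis finite_path_edges)
  show 3: "\<exists>xs. distinct (a # xs) \<and> length xs + 1 = card C \<and> C = path_edges (a # xs @ [a])" if "a \<in> \<Union>C" for a
    using is_cycle_from[OF assms that] * by metis
  obtain xs where xs: "distinct xs" "length xs \<ge> 3" "C = path_edges (xs @ [hd xs])"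
    using is_cycle_closed_list[OF assms] by blast
  obtain a ys where "xs = a # ys" using xs(2) by (cases xs) auto
  then show "card C \<ge> 3" using *[of a ys] xs by simp
qed

lemma five_cycle:
  assumes "is_cycle C" "card C = 5" "v \<in> \<Union>C"
  obtains p a b q where "distinct [v, p, a, b, q]" "C = {{v, p}, {p, a}, {a, b}, {b, q}, {q, v}}"
    "{e \<in> C. v \<in> e} = {{v, p}, {v, q}}"
proof -
  obtain xs where xs: "distinct (v # xs)" "length xs = 4" "C = path_edges (v # xs @ [v])"
    using card_cycle(3)[OF assms(1,3)] assms(2) by auto
  obtain p xs1 where "xs = p # xs1" "length xs1 = 3" using xs(2) by (cases xs) auto
  moreover then obtain a xs2 where "xs1 = a # xs2" "length xs2 = 2" by (cases xs1) auto
  moreover then obtain b xs3 where "xs2 = b # xs3" "length xs3 = 1" by (cases xs2) auto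
  moreover then obtain q where "xs3 = [q]" by (cases xs3) auto
  ultimately have "xs = [p, a, b, q]" by simp
  then show thesis using that[of p a b q] xs by auto
qed

definition cycle_free :: "'a set set \<Rightarrow> nat \<Rightarrow> bool" where
  "cycle_free E k \<longleftrightarrow> (\<nexists>xs. distinct xs \<and> length xs = k \<and> path_edges (xs @ [hd xs]) \<subseteq> E)"

lemma cycle_freeD:
  assumes "cycle_free E k" "is_cycle C" "C \<subseteq> E"
  shows "card C \<noteq> k"
proof -
  obtain ys where ys: "length ys \<ge> 3" "C = path_edges (ys @ [hd ys])"
    using is_cycle_closed_list[OF assms(2)] by blast
  then obtain a zs where "ys = a # zs" by (cases ys) auto
  then have "a \<in> \<Union>C" using Union_path_edges[of "ys @ [hd ys]"] ys by auto
  then obtain xs where "distinct (a # xs)" "length (a # xs) = card C" "C = path_edges ((a # xs) @ [hd (a # xs)])"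
    using card_cycle(3)[OF assms(2)] by auto
  then show ?thesis using assms(1,3) unfolding cycle_free_def by blast
qed

text \<open>Two different such 5-cycles would differ by a 3-, 4- or 6-cycle.\<close>

lemma five_cycles_eq:
  assumes free: "cycle_free E 3" "cycle_free E 4" "cycle_free E 6"
    and C: "is_cycle C" "C \<subseteq> E" "card C = 5" "v \<in> \<Union>C"
    and D: "is_cycle D" "D \<subseteq> E" "card D = 5" "v \<in> \<Union>D"
    and eq: "{e \<in> C. v \<in> e} = {e \<in> D. v \<in> e}"
  shows "C = D"
proof -
  obtain p a b q where c: "distinct [v, p, a, b, q]" "C = {{v, p}, {p, a}, {a, b}, {b, q}, {q, v}}"
      "{e \<in> C. v \<in> e} = {{v, p}, {v, q}}"
    by (rule five_cycle[OF C(1,3,4)])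
  obtain p' c' d' q' where d': "distinct [v, p', c', d', q']" "D = {{v, p'}, {p', c'}, {c', d'}, {d', q'}, {q', v}}"
      "{e \<in> D. v \<in> e} = {{v, p'}, {v, q'}}"
    by (rule five_cycle[OF D(1,3,4)])
  have "{{v, p}, {v, q}} = {{v, p'}, {v, q'}}" using eq c(3) d'(3) by simp
  then have "p' = p \<and> q' = q \<or> p' = q \<and> q' = p" using c(1) d'(1) by (auto simp: doubleton_eq_iff)
  then obtain c' d' where d: "distinct [v, p, c', d', q]" "D = {{v, p}, {p, c'}, {c', d'}, {d', q}, {q, v}}"
  proof
    assume "p' = q \<and> q' = p"
    then have "distinct [v, p, d', c', q]" "D = {{v, p}, {p, d'}, {d', c'}, {c', q}, {q, v}}"
      using d' by (auto simp: insert_commute)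
    then show thesis using that by blast
  qed (use that d' in blast)
  have no: "\<not> path_edges (xs @ [hd xs]) \<subseteq> E" if "distinct xs" "length xs = 3 \<or> length xs = 4 \<or> length xs = 6" for xs
    using that free unfolding cycle_free_def by blast
  have E: "{p, a} \<in> E" "{a, b} \<in> E" "{b, q} \<in> E" "{p, c'} \<in> E" "{c', d'} \<in> E" "{d', q} \<in> E"
    using C(2) D(2) c(2) d(2) by auto
  have E': "{q, d'} \<in> E" "{d', a} \<in> E \<or> c' \<noteq> a" "{d', c'} \<in> E" "{c', p} \<in> E" "{a, p} \<in> E" "{b, p} \<in> E \<or> c' \<noteq> b" "{b, c'} \<in> E \<or> d' \<noteq> b"
    using E by (auto simp: insert_commute)
  \<comment> \<open>Both cycles contain the path \<open>p, v, q\<close> and are completed by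
    \<open>a, b\<close> and by \<open>c', d'\<close>. A single coincidence in the same position
    leaves a 4-cycle, a crossed coincidence a triangle, and no coincidence the 6-cycle
    \<open>p, a, b, q, d', c'\<close>.\<close>
  consider "a = c'" "b = d'" | "a = c'" "b \<noteq> d'" | "a = d'" | "b = c'" | "b = d'" "a \<noteq> c'" "a \<noteq> d'" "b \<noteq> c'"
    | "a \<noteq> c'" "a \<noteq> d'" "b \<noteq> c'" "b \<noteq> d'" by blast
  then show ?thesis
  proof cases
    case 1
    then show ?thesis using c(2) d(2) by simp
  next
    case 2
    then show ?thesis using no[of "[a, b, q, d']"] c(1) d(1) E E' by auto
  next
    case 3
    then show ?thesis using no[of "[p, c', a]"] c(1) d(1) E E' by auto
  next
    case 4
    then show ?thesis using no[of "[p, a, b]"] c(1) d(1) E E' by auto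
  next
    case 5
    then show ?thesis using no[of "[p, a, b, c']"] c(1) d(1) E E' by auto
  next
    case 6
    then show ?thesis using no[of "[p, a, b, q, d', c']"] c(1) d(1) E E' by auto
  qed
qed

section \<open>Double counting of faces, edges and degrees\<close>

lemma sum_card_swap:
  assumes "finite A" "finite B"
  shows "(\<Sum>a\<in>A. card {b \<in> B. P a b}) = (\<Sum>b\<in>B. card {a \<in> A. P a b})"
proof -
  have "card {b \<in> B. P a b} = (\<Sum>b\<in>B. if P a b then 1 else 0)" for a
    using assms by (simp add: sum.If_cases Int_def)
  moreover have "card {a \<in> A. P a b} = (\<Sum>a\<in>A. if P a b then 1 else 0)" for b
    using assms by (simp add: sum.If_cases Int_def)
  ultimately show ?thesis by (simp only: sum.swap[of _ A B])
qed

definition edge_degree :: "'a set set \<Rightarrow> 'a \<Rightarrow> nat" where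
  "edge_degree E v = card {e \<in> E. v \<in> e}"

lemma sum_edge_degree:
  assumes "finite V" "finite E" "\<And>e. e \<in> E \<Longrightarrow> \<exists>u v. u \<noteq> v \<and> e = {u, v}" "\<Union>E \<subseteq> V"
  shows "(\<Sum>v\<in>V. edge_degree E v) = 2 * card E"
proof -
  have "card {v \<in> V. v \<in> e} = 2" if e: "e \<in> E" for e
  proof -
    obtain u v where "u \<noteq> v" "e = {u, v}" using assms(3)[OF e] by blast
    moreover have "{v \<in> V. v \<in> e} = e" using e assms(4) by blast
    ultimately show ?thesis by simp
  qed
  then show ?thesis
    unfolding edge_degree_def sum_card_swap[OF assms(1,2)] by simp
qed

text \<open>Discharging on the faces: a face of length at least 7 can afford 4/3 for each of its vertices
  of degree 2, and a vertex of degree 2 cannot lie on two faces of length 5.\<close>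

lemma sparse_bound:
  assumes finV: "finite V" and finE: "finite E" and EV: "\<Union>E \<subseteq> V"
    and edges: "\<And>e. e \<in> E \<Longrightarrow> \<exists>u v. u \<noteq> v \<and> e = {u, v}"
    and free: "cycle_free E 3" "cycle_free E 4" "cycle_free E 6"
    and indep: "\<And>u v. {u, v} \<in> E \<Longrightarrow> edge_degree E u = 2 \<Longrightarrow> edge_degree E v \<noteq> 2"
    and finF: "finite F" and F: "\<And>C. C \<in> F \<Longrightarrow> is_cycle C \<and> C \<subseteq> E"
    and cov: "\<And>e. card {C \<in> F. e \<in> C} \<le> 2" and count: "card E + 1 \<le> card V + card F"
  shows "9 * (\<Sum>v\<in>V. edge_degree E v) + 4 * card {v \<in> V. edge_degree E v = 2} + 30 \<le> 30 * card V"
proof -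
  define T where "T = {v \<in> V. edge_degree E v = 2}"
  define N where "N v = {e \<in> E. v \<in> e}" for v
  define k where "k e = card {C \<in> F. e \<in> C}" for e
  define kv where "kv v = card {C \<in> F. v \<in> \<Union>C}" for v
  define t where "t C = card {v \<in> T. v \<in> \<Union>C}" for C
  define m where "m v = card {C \<in> {C \<in> F. card C \<noteq> 5}. v \<in> \<Union>C}" for v
  have finT: "finite T" using finV unfolding T_def by simp
  have N2: "card (N v) = 2" if "v \<in> T" for v using that unfolding T_def N_def edge_degree_def by simp
  have Nfin: "finite (N v)" for v unfolding N_def using finE by simp
  have NC: "{e \<in> C. v \<in> e} = N v" if vC: "v \<in> T" "is_cycle C" "C \<subseteq> E" "v \<in> \<Union>C" for v C
  proof -
    obtain x y where xy: "x \<noteq> y" "x \<noteq> v" "y \<noteq> v" "{e \<in> C. v \<in> e} = {{v, x}, {v, y}}"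
      using is_cycle_edges_at[OF vC(2,4)] by blast
    have "card {{v, x}, {v, y}} = 2" using xy by (auto simp: doubleton_eq_iff card_insert_if)
    moreover have "{e \<in> C. v \<in> e} \<subseteq> N v" using vC(3) unfolding N_def by blast
    ultimately show ?thesis using card_subset_eq[OF Nfin] N2[OF vC(1)] xy(4) by metis
  qed
  have Ndis: "N u \<inter> N v = {}" if "u \<in> T" "v \<in> T" "u \<noteq> v" for u v
  proof (rule ccontr)
    assume "N u \<inter> N v \<noteq> {}"
    then obtain e where e: "e \<in> E" "u \<in> e" "v \<in> e" unfolding N_def by blast
    then have "e = {u, v}" using edges[of e] \<open>u \<noteq> v\<close> by auto
    then show False using indep[of u v] e that unfolding T_def by simp
  qed
  \<comment> \<open>A cycle through a vertex of degree 2 uses both of its edges, and these pairs are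
    disjoint because such vertices are not adjacent.\<close>
  have tC: "2 * t C \<le> card C" if "C \<in> F" for C
  proof -
    have "card (\<Union>v\<in>{v \<in> T. v \<in> \<Union>C}. N v) = (\<Sum>v\<in>{v \<in> T. v \<in> \<Union>C}. card (N v))"
      using finT Nfin Ndis by (intro card_UN_disjoint) auto
    also have "\<dots> = 2 * t C" unfolding t_def using N2 by simp
    finally have "2 * t C = card (\<Union>v\<in>{v \<in> T. v \<in> \<Union>C}. N v)" ..
    also have "\<dots> \<le> card C"
    proof (rule card_mono)
      show "finite C" using card_cycle(1) F[OF that] by blast
      show "(\<Union>v\<in>{v \<in> T. v \<in> \<Union>C}. N v) \<subseteq> C" using NC F[OF that] by blast
    qed
    finally show ?thesis .
  qed
  have face: "30 + 4 * (if card C \<noteq> 5 then t C else 0) \<le> 6 * card C" if "C \<in> F" for C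
  proof -
    have "card C \<ge> 3" "card C \<noteq> 3" "card C \<noteq> 4" "card C \<noteq> 6"
      using card_cycle(2) F[OF that] cycle_freeD free by blast+
    then have "card C = 5 \<or> card C \<ge> 7" by linarith
    then show ?thesis
    proof
      assume "7 \<le> card C"
      \<comment> \<open>The case \<open>m = 7\<close> needs integrality: \<open>n \<le> 3\<close>,
        and then both sides are 42. From 8 on, \<open>30 + 2 * m \<le> 6 * m\<close>
        suffices.\<close>
      moreover have "30 + 4 * n \<le> 6 * m" if "7 \<le> m" "2 * n \<le> m" for m n :: nat
        using that by (cases "m = 7") auto
      ultimately show ?thesis using tC[OF that] by simp
    qed simp
  qed
  have kE: "(\<Sum>C\<in>F. card C) = (\<Sum>e\<in>E. k e)"
  proof -
    have "(\<Sum>C\<in>F. card C) = (\<Sum>C\<in>F. card {e \<in> E. e \<in> C})"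
    proof (rule sum.cong)
      fix C assume "C \<in> F"
      then have "{e \<in> E. e \<in> C} = C" using F by blast
      then show "card C = card {e \<in> E. e \<in> C}" by simp
    qed simp
    then show ?thesis unfolding k_def using sum_card_swap[OF finF finE] by simp
  qed
  have tm: "(\<Sum>C\<in>F. if card C \<noteq> 5 then t C else 0) = (\<Sum>v\<in>T. m v)"
  proof -
    have "(\<Sum>C\<in>F. if card C \<noteq> 5 then t C else 0) = (\<Sum>C\<in>{C \<in> F. card C \<noteq> 5}. t C)"
      using finF by (simp add: sum.inter_filter)
    also have "\<dots> = (\<Sum>v\<in>T. m v)"
      unfolding t_def m_def by (rule sum_card_swap) (use finF finT in auto)
    finally show ?thesis .
  qed
  have "(\<Sum>C\<in>F. 30 + 4 * (if card C \<noteq> 5 then t C else 0)) \<le> (\<Sum>C\<in>F. 6 * card C)"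
    by (rule sum_mono) (rule face)
  then have A: "30 * card F + 4 * (\<Sum>v\<in>T. m v) \<le> 6 * (\<Sum>e\<in>E. k e)"
    unfolding sum.distrib sum_distrib_left[symmetric] tm kE by simp
  have kk: "k e = kv v" if "v \<in> T" "e \<in> N v" for v e
  proof -
    have "{C \<in> F. e \<in> C} = {C \<in> F. v \<in> \<Union>C}"
      using NC[OF that(1)] F that(2) unfolding N_def by blast
    then show ?thesis unfolding k_def kv_def by simp
  qed
  \<comment> \<open>An edge on fewer than two cycles leaves slack in the bound
    \<open>2 * card E\<close>. The two edges at a vertex \<open>v\<close> of degree 2 lie on the
    same \<open>kv v\<close> cycles, so both have slack \<open>2 - kv v\<close>; the subtraction is
    never truncated since \<open>k e \<le> 2\<close>.\<close>
  have "(\<Sum>v\<in>T. 2 * (2 - kv v)) = (\<Sum>v\<in>T. \<Sum>e\<in>N v. 2 - k e)"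
  proof (rule sum.cong)
    fix v assume v: "v \<in> T"
    have "(\<Sum>e\<in>N v. 2 - k e) = (\<Sum>e\<in>N v. 2 - kv v)" by (rule sum.cong) (use kk[OF v] in auto)
    then show "2 * (2 - kv v) = (\<Sum>e\<in>N v. 2 - k e)" using N2[OF v] by simp
  qed simp
  also have "\<dots> = (\<Sum>e\<in>(\<Union>v\<in>T. N v). 2 - k e)"
    using finT Nfin Ndis by (intro sum.UNION_disjoint[symmetric]) auto
  also have "\<dots> \<le> (\<Sum>e\<in>E. 2 - k e)"
    by (rule sum_mono2[OF finE]) (auto simp: N_def)
  finally have B: "(\<Sum>v\<in>T. 2 * (2 - kv v)) \<le> (\<Sum>e\<in>E. 2 - k e)" .
  have k2: "k e \<le> 2" for e unfolding k_def by (rule cov)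
  have "(\<Sum>e\<in>E. k e) + (\<Sum>e\<in>E. 2 - k e) = (\<Sum>e\<in>E. 2)"
    unfolding sum.distrib[symmetric] by (rule sum.cong) (use k2 in auto)
  then have D: "(\<Sum>e\<in>E. k e) + (\<Sum>e\<in>E. 2 - k e) = 2 * card E" by simp
  \<comment> \<open>Each vertex of degree 2 is paid its 4 in one of two ways. If it lies on two
    cycles of the family, one of them is not a 5-cycle; otherwise each of its two edges has slack,
    and slack weighs 6.\<close>
  have "4 \<le> 4 * m v + 6 * (2 * (2 - kv v))" if v: "v \<in> T" for v
  proof -
    have "{C \<in> F. v \<in> \<Union>C} = {C \<in> {C \<in> F. card C \<noteq> 5}. v \<in> \<Union>C} \<union> {C \<in> F. card C = 5 \<and> v \<in> \<Union>C}"
      by blast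
    then have "kv v = card ({C \<in> {C \<in> F. card C \<noteq> 5}. v \<in> \<Union>C} \<union> {C \<in> F. card C = 5 \<and> v \<in> \<Union>C})"
      unfolding kv_def by (rule arg_cong)
    also have "\<dots> \<le> m v + card {C \<in> F. card C = 5 \<and> v \<in> \<Union>C}"
      unfolding m_def by (rule card_Un_le)
    finally have "kv v \<le> m v + card {C \<in> F. card C = 5 \<and> v \<in> \<Union>C}" .
    moreover have "card {C \<in> F. card C = 5 \<and> v \<in> \<Union>C} \<le> Suc 0"
    proof (subst card_le_Suc0_iff_eq)
      show "finite {C \<in> F. card C = 5 \<and> v \<in> \<Union>C}" using finF by simp
      show "\<forall>C\<in>{C \<in> F. card C = 5 \<and> v \<in> \<Union>C}. \<forall>D\<in>{C \<in> F. card C = 5 \<and> v \<in> \<Union>C}. C = D"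
      proof (intro ballI)
        fix C D assume "C \<in> {C \<in> F. card C = 5 \<and> v \<in> \<Union>C}" "D \<in> {C \<in> F. card C = 5 \<and> v \<in> \<Union>C}"
        then have *: "C \<in> F" "card C = 5" "v \<in> \<Union>C" "D \<in> F" "card D = 5" "v \<in> \<Union>D" by auto
        have CD: "is_cycle C" "C \<subseteq> E" "is_cycle D" "D \<subseteq> E" using F *(1,4) by blast+
        show "C = D"
          by (rule five_cycles_eq[OF free CD(1,2) *(2,3) CD(3,4) *(5,6)])
            (simp only: NC[OF v CD(1,2) *(3)] NC[OF v CD(3,4) *(6)])
      qed
    qed
    moreover have "kv v \<le> 2"
    proof -
      have "N v \<noteq> {}" using N2[OF v] by auto
      then obtain e where "e \<in> N v" by blast
      then show ?thesis using kk[OF v] k2[of e] by simp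
    qed
    ultimately show ?thesis by linarith
  qed
  then have "(\<Sum>v\<in>T. 4) \<le> (\<Sum>v\<in>T. 4 * m v + 6 * (2 * (2 - kv v)))" by (rule sum_mono)
  then have G: "4 * card T \<le> 4 * (\<Sum>v\<in>T. m v) + 6 * (\<Sum>v\<in>T. 2 * (2 - kv v))"
    unfolding sum.distrib sum_distrib_left[symmetric] by simp
  have "(\<Sum>v\<in>V. edge_degree E v) = 2 * card E" by (rule sum_edge_degree[OF finV finE edges EV])
  \<comment> \<open>\<open>A\<close>, \<open>B\<close>, \<open>D\<close> and \<open>G\<close>
    combine to \<open>30 * card F + 4 * card T \<le> 12 * card E\<close>, into which the lower bound
    on \<open>card F\<close> is inserted.\<close>
  then show ?thesis using A B D G count unfolding T_def[symmetric] by linarith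
qed

section \<open>A minimal graph without a (2,4)-coloring\<close>

text \<open>The setting of the recoloring arguments. Induced subgraphs are represented by vertex
  sets \<open>U\<close>, so that deleting and reinserting a vertex changes only a set.\<close>

locale sparse_graph =
  fixes adj :: "'a \<Rightarrow> 'a \<Rightarrow> bool"
  assumes adj_sym: "adj u v \<Longrightarrow> adj v u"
    and adj_irrefl: "\<not> adj v v"
    and no_triangle: "adj a b \<Longrightarrow> adj b c \<Longrightarrow> \<not> adj c a"
    and no_square: "adj a b \<Longrightarrow> adj b c \<Longrightarrow> adj c d \<Longrightarrow> adj d a \<Longrightarrow> a = c \<or> b = d"
begin

definition cap :: "bool \<Rightarrow> nat" where "cap b = (if b then 2 else 4)"

definition nb :: "'a set \<Rightarrow> ('a \<Rightarrow> bool) \<Rightarrow> bool \<Rightarrow> 'a \<Rightarrow> 'a set" where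
  "nb U c b v = {w \<in> U. adj v w \<and> c w = b}"

text \<open>Color 1 is encoded as \<open>True\<close> and color 2 as \<open>False\<close>.\<close>

definition proper :: "'a set \<Rightarrow> ('a \<Rightarrow> bool) \<Rightarrow> bool" where
  "proper U c \<longleftrightarrow> (\<forall>v\<in>U. card (nb U c (c v) v) \<le> cap (c v))"

lemma finite_nb [simp]: "finite U \<Longrightarrow> finite (nb U c b v)"
  by (simp add: nb_def)

lemma proper_mono:
  assumes "proper U c" "U' \<subseteq> U" "finite U"
  shows "proper U' c"
  unfolding proper_def
proof
  fix v assume "v \<in> U'"
  then have "card (nb U c (c v) v) \<le> cap (c v)" using assms unfolding proper_def by blast
  moreover have "card (nb U' c (c v) v) \<le> card (nb U c (c v) v)"
    using assms(2,3) by (intro card_mono) (auto simp: nb_def)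
  ultimately show "card (nb U' c (c v) v) \<le> cap (c v)" by linarith
qed

lemma proper_insert:
  assumes "proper U c" "finite U" "v \<notin> U" "card (nb U c b v) \<le> cap b"
    and sat: "\<And>w. w \<in> nb U c b v \<Longrightarrow> card (nb U c b w) < cap b"
  shows "proper (insert v U) (c(v := b))"
  unfolding proper_def
proof
  fix x assume x: "x \<in> insert v U"
  let ?c = "c(v := b)"
  show "card (nb (insert v U) ?c (?c x) x) \<le> cap (?c x)"
  proof (cases "x = v")
    case True
    then have "nb (insert v U) ?c (?c x) x = nb U c b v"
      using assms(3) adj_irrefl by (auto simp: nb_def)
    then show ?thesis using assms(4) True by simp
  next
    case False
    then have xU: "x \<in> U" using x by simp
    show ?thesis
    proof (cases "x \<in> nb U c b v")
      case True
      then have "nb (insert v U) ?c (?c x) x \<subseteq> insert v (nb U c b x)"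
        using False by (auto simp: nb_def)
      then have "card (nb (insert v U) ?c (?c x) x) \<le> card (insert v (nb U c b x))"
        using assms(2) by (intro card_mono) simp_all
      also have "\<dots> \<le> Suc (card (nb U c b x))" by (rule card_insert_le_m1) simp_all
      also have "\<dots> \<le> cap b" using sat[OF True] by simp
      finally show ?thesis using True False by (simp add: nb_def)
    next
      case F2: False
      then have "nb (insert v U) ?c (?c x) x = nb U c (c x) x"
        using False xU adj_sym[of x v] assms(3) by (auto simp: nb_def)
      then show ?thesis using assms(1) xU False unfolding proper_def by simp
    qed
  qed
qed

text \<open>After the flip a vertex of \<open>Q\<close> has no neighbor of its own color at all, and
  no vertex outside \<open>Q\<close> gains one, since all neighbors of \<open>Q\<close> have the
  abandoned color \<open>b\<close>.\<close>

lemma proper_flip: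
  assumes "proper U c" "finite U" "\<And>q. q \<in> Q \<Longrightarrow> c q = b"
    and mono: "\<And>q x. q \<in> Q \<Longrightarrow> x \<in> U \<Longrightarrow> adj q x \<Longrightarrow> c x = b \<and> x \<notin> Q"
  shows "proper U (\<lambda>x. if x \<in> Q then \<not> b else c x)"
  unfolding proper_def
proof
  fix v assume v: "v \<in> U"
  let ?c = "\<lambda>x. if x \<in> Q then \<not> b else c x"
  show "card (nb U ?c (?c v) v) \<le> cap (?c v)"
  proof (cases "v \<in> Q")
    case True
    then have "nb U ?c (?c v) v = {}" using mono[OF True] by (auto simp: nb_def)
    then show ?thesis by simp
  next
    case False
    have "x \<notin> Q" if "c v \<noteq> b" "adj v x" for x
      using mono[of x v] that v adj_sym by blast
    then have "nb U ?c (?c v) v \<subseteq> nb U c (c v) v"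
      using False by (auto simp: nb_def split: if_splits)
    then have "card (nb U ?c (?c v) v) \<le> card (nb U c (c v) v)"
      using assms(2) by (intro card_mono) simp_all
    then show ?thesis using assms(1) v False unfolding proper_def by fastforce
  qed
qed

text \<open>Otherwise \<open>w\<close> could trade colors with its only neighbor of color 1.\<close>

lemma forced_neighbor:
  assumes finU: "finite U" and c: "proper U c" and w: "w \<in> U"
    and all_forced: "\<forall>c'. proper U c' \<longrightarrow> \<not> c' w"
    and sat: "card (nb U c False w) = 4" and d5: "card {x \<in> U. adj w x} = 5"
  obtains t where "t \<in> U" "adj w t"
    "card {x \<in> U. adj t x} \<ge> 5 \<or>
      card {x \<in> U. adj t x} = 4 \<and> (\<exists>t'\<in>U. adj t t' \<and> t' \<noteq> w \<and> card {x \<in> U. adj t' x} \<ge> 6)"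
proof -
  let ?N = "\<lambda>v. {x \<in> U. adj v x}"
  have forced: "\<not> c' w" if "proper U c'" for c' using all_forced that by blast
  have cw: "\<not> c w" using forced[OF c] .
  have fN: "finite (?N v)" for v using finU by simp
  have split: "?N w = nb U c False w \<union> nb U c True w" by (auto simp: nb_def)
  have "card (?N w) = card (nb U c False w) + card (nb U c True w)"
    unfolding split by (rule card_Un_disjoint) (use finU in \<open>auto simp: nb_def\<close>)
  then have "card (nb U c True w) = 1" using sat d5 by simp
  then obtain t where t: "nb U c True w = {t}" by (auto simp: card_1_singleton_iff)
  then have tU: "t \<in> U" "adj w t" "c t" by (auto simp: nb_def)
  have wF: "\<not> c x" if "x \<in> U" "adj w x" "x \<noteq> t" for x
    using t that by (auto simp: nb_def)
  have "t \<noteq> w" using tU adj_irrefl by auto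
  \<comment> \<open>Otherwise \<open>w\<close> could simply change to color 1: its only neighbor of
    that color is \<open>t\<close>, which would have room for it.\<close>
  have two: "card (nb U c True t) \<ge> 2"
  proof (rule ccontr)
    assume "\<not> 2 \<le> card (nb U c True t)"
    moreover have "proper (U - {w}) c" using proper_mono[OF c _ finU] by blast
    moreover have "nb (U - {w}) c True w = {t}" using t tU adj_irrefl by (auto simp: nb_def)
    moreover have "nb (U - {w}) c True t = nb U c True t" using cw by (auto simp: nb_def)
    ultimately have "proper (insert w (U - {w})) (c(w := True))"
      using finU by (intro proper_insert) (auto simp: cap_def)
    then have "proper U (c(w := True))" using w by (simp add: insert_absorb)
    then show False using forced by fastforce
  qed
  have ok': "proper (U - {t}) c" using proper_mono[OF c _ finU] by blast
  have insert_t: "insert t (U - {t}) = U" using tU by blast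
  show thesis
  proof (cases "card (?N t) \<ge> 5")
    case True
    then show ?thesis using that tU by blast
  next
    case small: False
    let ?c1 = "\<lambda>x. if x \<in> {w} then \<not> False else c x"
    have c1: "proper (U - {t}) ?c1"
      using finU cw wF adj_irrefl by (intro proper_flip[OF ok']) auto
    \<comment> \<open>With \<open>t\<close> deleted, \<open>w\<close> has moved to color 1.
      Returning \<open>t\<close> with color 2 must fail, and \<open>t\<close> has at most four
      neighbors, so the obstruction is a saturated neighbor \<open>t'\<close> of color 2.\<close>
    have "\<exists>t'\<in>nb (U - {t}) ?c1 False t. card (nb (U - {t}) ?c1 False t') \<ge> 4"
    proof (rule ccontr)
      assume "\<not> ?thesis"
      moreover have "card (nb (U - {t}) ?c1 False t) \<le> card (?N t)"
        by (rule card_mono[OF fN]) (auto simp: nb_def)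
      ultimately have "proper (insert t (U - {t})) (?c1(t := False))"
        using finU small by (intro proper_insert[OF c1]) (auto simp: cap_def not_le)
      then have "\<not> (?c1(t := False)) w" unfolding insert_t by (rule forced)
      then show False using \<open>t \<noteq> w\<close> by simp
    qed
    then obtain t' where t': "t' \<in> nb (U - {t}) ?c1 False t" "card (nb (U - {t}) ?c1 False t') \<ge> 4"
      by blast
    then have t'U: "t' \<in> U" "t' \<noteq> t" "adj t t'" "t' \<noteq> w" "\<not> c t'" by (auto simp: nb_def split: if_splits)
    have nbt: "insert w (insert t' (nb U c True t)) \<subseteq> ?N t"
      using t'U tU w adj_sym by (auto simp: nb_def)
    have "card (insert w (insert t' (nb U c True t))) = card (nb U c True t) + 2"
      using t'U cw finU by (simp add: nb_def)
    then have four: "card (?N t) = 4" and eqt: "insert w (insert t' (nb U c True t)) = ?N t"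
      using two small card_mono[OF fN nbt] card_subset_eq[OF fN nbt] by linarith+
    have sub: "insert t (nb (U - {t}) ?c1 False t') \<subseteq> ?N t'"
      using t'U tU adj_sym by (auto simp: nb_def)
    have c5: "card (insert t (nb (U - {t}) ?c1 False t')) = card (nb (U - {t}) ?c1 False t') + 1"
      using finU by (simp add: nb_def)
    \<comment> \<open>If \<open>t'\<close> had just \<open>t\<close> and four neighbors of color 2,
      it could join \<open>w\<close> in color 1; the two are not adjacent because of the triangle
      with \<open>t\<close>. Then \<open>t\<close> would have no neighbor of color 2 and could take
      that color.\<close>
    have "card (?N t') \<ge> 6"
    proof (rule ccontr)
      assume "\<not> ?thesis"
      then have eq: "insert t (nb (U - {t}) ?c1 False t') = ?N t'"
        using t'(2) c5 card_mono[OF fN sub] card_subset_eq[OF fN sub] by linarith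
      have t'F: "\<not> c x" if "x \<in> U" "adj t' x" "x \<noteq> t" for x
      proof -
        have "x \<in> nb (U - {t}) ?c1 False t'" using that eq by blast
        then show ?thesis by (auto simp: nb_def split: if_splits)
      qed
      have nadj: "\<not> adj w t'" using no_triangle[of w t' t] adj_sym tU t'U by blast
      let ?c2 = "\<lambda>x. if x \<in> {w, t'} then \<not> False else c x"
      have c2: "proper (U - {t}) ?c2"
        using finU cw wF t'F t'U nadj adj_irrefl adj_sym by (intro proper_flip[OF ok']) auto
      have "nb (U - {t}) ?c2 False t = {}"
        using eqt by (auto simp: nb_def split: if_splits)
      then have "proper (insert t (U - {t})) (?c2(t := False))"
        using finU by (intro proper_insert[OF c2]) (auto simp: cap_def)
      then have "\<not> (?c2(t := False)) w" unfolding insert_t by (rule forced)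
      then show False using \<open>t \<noteq> w\<close> by simp
    qed
    then show ?thesis using that[OF tU(1,2)] four t'U by blast
  qed
qed

end

locale critical_graph = sparse_graph adj for adj :: "'a \<Rightarrow> 'a \<Rightarrow> bool" +
  fixes W :: "'a set"
  assumes finW: "finite W"
    and not_proper: "\<not> proper W c"
    and critical: "U \<subset> W \<Longrightarrow> \<exists>c. proper U c"
begin

section \<open>Degree conditions in a critical graph\<close>

definition N :: "'a \<Rightarrow> 'a set" where "N v = {w \<in> W. adj v w}"
definition deg :: "'a \<Rightarrow> nat" where "deg v = card (N v)"

lemma finN [simp]: "finite (N v)"
  using finW by (simp add: N_def)

lemma N_sym: "w \<in> N v \<Longrightarrow> v \<in> W \<Longrightarrow> v \<in> N w"
  by (auto simp: N_def adj_sym)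

lemma N_in_W: "w \<in> N v \<Longrightarrow> w \<in> W"
  by (simp add: N_def)

lemma color_minus_vertex:
  assumes "v \<in> W"
  obtains c where "proper (W - {v}) c"
  using critical[of "W - {v}"] assms by blast

lemma not_extendable:
  assumes "v \<in> W" "proper (W - {v}) c" "card (nb (W - {v}) c b v) \<le> cap b"
    "\<And>w. w \<in> nb (W - {v}) c b v \<Longrightarrow> card (nb (W - {v}) c b w) < cap b"
  shows False
proof -
  have "proper (insert v (W - {v})) (c(v := b))"
    using assms finW by (intro proper_insert) auto
  then show False using assms(1) not_proper by (simp add: insert_absorb)
qed

lemma nb_minus: "nb (W - {v}) c b w \<subseteq> N w"
  by (auto simp: nb_def N_def)

lemma card_nb_neighbor:
  assumes "v \<in> W" "w \<in> N v"
  shows "card (nb (W - {v}) c b w) + 1 \<le> deg w"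
proof -
  have "insert v (nb (W - {v}) c b w) \<subseteq> N w"
    using assms by (auto simp: nb_def N_def adj_sym)
  then have "card (insert v (nb (W - {v}) c b w)) \<le> deg w" unfolding deg_def by (intro card_mono) simp_all
  moreover have "card (insert v (nb (W - {v}) c b w)) = card (nb (W - {v}) c b w) + 1"
    using finW by (simp add: nb_def)
  ultimately show ?thesis by simp
qed

text \<open>The deleted vertex \<open>v\<close> is itself a neighbor of \<open>w\<close>, so
  \<open>deg w - 1\<close> neighbors of color \<open>b\<close> are all that remain.\<close>

lemma nb_full:
  assumes "v \<in> W" "w \<in> N v" "card (nb (W - {v}) c b w) + 1 \<ge> deg w" "x \<in> W - {v}" "adj w x"
  shows "c x = b"
proof -
  have sub: "insert v (nb (W - {v}) c b w) \<subseteq> N w"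
    using assms by (auto simp: nb_def N_def adj_sym)
  moreover have "card (insert v (nb (W - {v}) c b w)) = card (nb (W - {v}) c b w) + 1"
    using finW by (simp add: nb_def)
  ultimately have "insert v (nb (W - {v}) c b w) = N w"
    using assms(3) unfolding deg_def by (intro card_seteq) simp_all
  moreover have "x \<in> N w" using assms by (simp add: N_def)
  ultimately show ?thesis using assms(4) by (auto simp: nb_def)
qed

text \<open>A vertex with at most one neighbor can take the color which that neighbor does not
  have.\<close>

lemma deg_ge_2:
  assumes v: "v \<in> W"
  shows "deg v \<ge> 2"
proof (rule ccontr)
  assume "\<not> 2 \<le> deg v"
  then have d: "card (N v) \<le> Suc 0" by (simp add: deg_def)
  obtain c where c: "proper (W - {v}) c" using color_minus_vertex[OF v] .
  obtain b where b: "\<And>w. w \<in> N v \<Longrightarrow> c w \<noteq> b"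
  proof (cases "N v = {}")
    case False
    then obtain w where "w \<in> N v" by blast
    then have "N v = {w}" using d card_le_Suc0_iff_eq[of "N v"] by auto
    then show ?thesis using that[of "\<not> c w"] by simp
  qed (use that in simp)
  have "nb (W - {v}) c b v = {}" using b by (auto simp: nb_def N_def)
  then show False using not_extendable[OF v c, of b] by simp
qed

text \<open>Suppose all neighbors have degree at most 5. A neighbor of \<open>v\<close> saturated in
  color 2 then has only neighbors of color 2 apart from \<open>v\<close>, so all such neighbors can
  be moved to color 1 together; they are independent since there is no triangle. Now
  \<open>v\<close> may take color 2, having at most four neighbors.\<close>

lemma big_neighbor:
  assumes v: "v \<in> W" and d: "deg v \<le> 4"
  shows "\<exists>w\<in>N v. deg w \<ge> 6"
proof (rule ccontr)
  assume "\<not> ?thesis"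
  then have small: "deg w \<le> 5" if "w \<in> N v" for w using that by force
  obtain c where c: "proper (W - {v}) c" using color_minus_vertex[OF v] .
  let ?U = "W - {v}"
  define Q where "Q = {w \<in> N v. \<not> c w \<and> card (nb ?U c False w) \<ge> 4}"
  let ?c = "\<lambda>x. if x \<in> Q then \<not> False else c x"
  have full: "\<not> c x" if "q \<in> Q" "x \<in> ?U" "adj q x" for q x
    using nb_full[OF v, of q c False x] that small[of q] unfolding Q_def by auto
  have indep: "x \<notin> Q" if "q \<in> Q" "adj q x" for q x
    using no_triangle[of v q x] that adj_sym unfolding Q_def N_def by blast
  have "proper ?U ?c"
  proof (rule proper_flip[OF c])
    show "finite ?U" using finW by simp
    show "c q = False" if "q \<in> Q" for q using that by (simp add: Q_def)
    show "c x = False \<and> x \<notin> Q" if "q \<in> Q" "x \<in> ?U" "adj q x" for q x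
      using full[OF that] indep[OF that(1,3)] by simp
  qed
  moreover have "card (nb ?U ?c False v) \<le> cap False"
    using card_mono[OF finN nb_minus[of v ?c False v]] d by (simp add: cap_def deg_def)
  moreover have "card (nb ?U ?c False w) < cap False" if "w \<in> nb ?U ?c False v" for w
  proof -
    have "w \<in> N v" "\<not> c w" "w \<notin> Q" using that by (auto simp: nb_def N_def split: if_splits)
    then have "card (nb ?U c False w) < 4" unfolding Q_def by auto
    moreover have "card (nb ?U ?c False w) \<le> card (nb ?U c False w)"
      using finW by (intro card_mono) (auto simp: nb_def split: if_splits)
    ultimately show ?thesis by (simp add: cap_def)
  qed
  ultimately show False by (rule not_extendable[OF v])
qed

text \<open>If both neighbors \<open>p\<close> and \<open>q\<close> of \<open>v\<close> have the
  same color, \<open>v\<close> takes the other one. If not, \<open>v\<close> takes the color of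
  \<open>q\<close> unless \<open>q\<close> is saturated; with at most two further neighbors this
  means that \<open>q\<close> and both of them have color 1, and moving \<open>q\<close> to color 2
  makes \<open>p\<close> and \<open>q\<close> agree.\<close>

lemma deg2_neighbor:
  assumes v: "v \<in> W" and d: "deg v = 2" and q: "q \<in> N v"
  shows "deg q \<ge> 4"
proof (rule ccontr)
  assume "\<not> 4 \<le> deg q"
  then have dq: "deg q \<le> 3" by simp
  have "card (N v - {q}) = 1" using d q by (simp add: deg_def)
  then obtain p where "N v - {q} = {p}" by (auto simp: card_1_singleton_iff)
  then have p: "N v = {p, q}" "p \<noteq> q" using q by blast+
  obtain c where c: "proper (W - {v}) c" using color_minus_vertex[OF v] .
  let ?U = "W - {v}"
  have nbv: "nb ?U c' b v = {w \<in> {p, q}. c' w = b}" for c' b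
    using p(1) adj_irrefl by (auto simp: nb_def N_def)
  have same: False if "proper ?U c'" "c' p = c' q" for c'
  proof -
    have "nb ?U c' (\<not> c' q) v = {}" using that(2) unfolding nbv by auto
    then show False using not_extendable[OF v that(1), of "\<not> c' q"] by simp
  qed
  have cq: "card (nb ?U c b q) \<le> 2" for b using card_nb_neighbor[OF v q, of c b] dq by simp
  have only_q: "nb ?U c (c q) v = {q}" if "c p \<noteq> c q" using that by (auto simp: nbv)
  show False
  proof (cases "card (nb ?U c (c q) q) < cap (c q)")
    case True
    show False
    proof (cases "c p = c q")
      case False
      show False
        by (rule not_extendable[OF v c, of "c q"]) (use only_q[OF False] True in \<open>simp_all add: cap_def\<close>)
    qed (rule same[OF c])
  next
    case False
    then have cqT: "c q" and two: "card (nb ?U c True q) = 2" using cq[of "c q"] by (auto simp: cap_def split: if_splits)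
    let ?c = "\<lambda>x. if x \<in> {q} then \<not> True else c x"
    have "proper ?U ?c"
      by (rule proper_flip[OF c]) (use finW cqT nb_full[OF v q, of c True] two dq adj_irrefl in auto)
    then show False
    proof (cases "c p")
      case True
      then show False using same[OF c] cqT by simp
    next
      case False
      then show False using same[OF \<open>proper ?U ?c\<close>] p(2) by simp
    qed
  qed
qed

section \<open>Stars: vertices with all but one neighbor of degree 2\<close>

definition star :: "'a \<Rightarrow> 'a \<Rightarrow> 'a set \<Rightarrow> ('a \<Rightarrow> 'a) \<Rightarrow> bool" where
  "star u x Y z \<longleftrightarrow> u \<in> W \<and> N u = insert x Y \<and> x \<notin> Y \<and> (\<forall>y\<in>Y. N y = {u, z y} \<and> z y \<noteq> u)"

abbreviation rest :: "'a \<Rightarrow> 'a set \<Rightarrow> 'a set" where "rest u Y \<equiv> W - insert u Y"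

text \<open>The absence of triangles keeps \<open>Y\<close> independent and \<open>x\<close> away
  from \<open>Y\<close>; the absence of 4-cycles makes the far neighbors \<open>z y\<close>
  distinct, so the colors on \<open>Y\<close> can be chosen independently of each other.\<close>

lemma starD:
  assumes "star u x Y z"
  shows "u \<in> W" "x \<in> W" "adj u x" "Y \<subseteq> W" "x \<in> rest u Y" "finite Y"
    "\<And>y. y \<in> Y \<Longrightarrow> adj u y" "\<And>y. y \<in> Y \<Longrightarrow> adj y (z y)" "\<And>y. y \<in> Y \<Longrightarrow> z y \<in> rest u Y"
    "\<And>y v. y \<in> Y \<Longrightarrow> v \<in> W \<Longrightarrow> adj v y \<Longrightarrow> v = u \<or> v = z y"
    "\<And>y. y \<in> Y \<Longrightarrow> \<not> adj x y" "\<And>y y'. y \<in> Y \<Longrightarrow> y' \<in> Y \<Longrightarrow> adj (z y) y' \<Longrightarrow> y' = y"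
    "\<And>y y'. y \<in> Y \<Longrightarrow> y' \<in> Y \<Longrightarrow> \<not> adj y y'" "\<And>y. y \<in> Y \<Longrightarrow> N y = {u, z y}"
proof -
  have s: "u \<in> W" "N u = insert x Y" "x \<notin> Y" "\<And>y. y \<in> Y \<Longrightarrow> N y = {u, z y}" "\<And>y. y \<in> Y \<Longrightarrow> z y \<noteq> u"
    using assms unfolding star_def by auto
  show u: "u \<in> W" by (rule s)
  have "x \<in> N u" using s(2) by simp
  then show xW: "x \<in> W" "adj u x" and xU: "x \<in> rest u Y" using s(3) adj_irrefl by (auto simp: N_def)
  have YN: "y \<in> N u" if "y \<in> Y" for y using s(2) that by simp
  show "Y \<subseteq> W" using YN by (auto simp: N_def)
  show "finite Y" using finN[of u] s(2) by simp
  show uy: "adj u y" if "y \<in> Y" for y using YN[OF that] by (simp add: N_def)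
  show yz: "adj y (z y)" if "y \<in> Y" for y using s(4)[OF that] by (auto simp: N_def)
  show yy: "\<not> adj y y'" if "y \<in> Y" "y' \<in> Y" for y y'
    using no_triangle[of u y y'] uy that adj_sym by blast
  show "z y \<in> rest u Y" if "y \<in> Y" for y
    using s(4,5)[OF that] yz[OF that] yy[OF that] by (auto simp: N_def)
  show "v = u \<or> v = z y" if "y \<in> Y" "v \<in> W" "adj v y" for y v
    using s(4)[OF that(1)] that adj_sym by (auto simp: N_def)
  show "\<not> adj x y" if "y \<in> Y" for y
    using no_triangle[of u x y] uy[OF that] xW adj_sym by blast
  show "y' = y" if "y \<in> Y" "y' \<in> Y" "adj (z y) y'" for y y'
    using no_square[of u y "z y" y'] uy that yz s(5) adj_sym by blast
  show "N y = {u, z y}" if "y \<in> Y" for y by (rule s(4)[OF that])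
qed

text \<open>The common form of the star recolorings: \<open>\<beta>\<close> colors \<open>Y\<close>,
  then \<open>\<alpha>\<close> colors \<open>u\<close>. A vertex \<open>y\<close> may repeat the
  color of \<open>z y\<close> only if it is 2 and \<open>z y\<close> has room; the remaining
  assumptions say that \<open>u\<close> and its neighbors of color \<open>\<alpha>\<close> tolerate
  the choice. Such choices cannot exist in a critical graph.\<close>

lemma star_not_extendable:
  assumes star: "star u x Y z" and c: "proper (rest u Y) c"
    and \<beta>: "\<And>y. y \<in> Y \<Longrightarrow> \<beta> y = c (z y) \<Longrightarrow> \<not> \<beta> y \<and> card (nb (rest u Y) c False (z y)) < 4"
    and count: "card ({w \<in> {x}. c w = \<alpha>} \<union> {y \<in> Y. \<beta> y = \<alpha>}) \<le> cap \<alpha>"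
    and satY: "\<And>y. y \<in> Y \<Longrightarrow> \<beta> y = \<alpha> \<Longrightarrow> c (z y) \<noteq> \<alpha>"
    and satx: "c x = \<alpha> \<Longrightarrow> card (nb (rest u Y) c \<alpha> x) < cap \<alpha>"
  shows False
proof -
  note s = starD[OF star]
  let ?U = "rest u Y"
  let ?c = "\<lambda>v. if v \<in> Y then \<beta> v else c v"
  have WU: "W - {u} = ?U \<union> Y" using s(4,7) adj_irrefl by auto
  have finU: "finite ?U" using finW by simp
  have ok: "proper (W - {u}) ?c"
    unfolding proper_def
  proof
    fix v assume v: "v \<in> W - {u}"
    show "card (nb (W - {u}) ?c (?c v) v) \<le> cap (?c v)"
    proof (cases "v \<in> Y")
      case True
      have "nb (W - {u}) ?c (?c v) v \<subseteq> {z v}"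
        using s(14)[OF True] by (auto simp: nb_def N_def)
      then have "card (nb (W - {u}) ?c (?c v) v) \<le> card {z v}" by (intro card_mono) simp_all
      also have "\<dots> \<le> cap (?c v)" unfolding cap_def by simp
      finally show ?thesis .
    next
      case False
      then have vU: "v \<in> ?U" using v by simp
      have old: "card (nb ?U c (c v) v) \<le> cap (c v)" using c vU unfolding proper_def by blast
      have un: "nb (W - {u}) ?c (?c v) v = nb ?U c (c v) v \<union> {y \<in> Y. adj v y \<and> \<beta> y = c v}"
        using False s(4,7) adj_irrefl by (auto simp: nb_def)
      show ?thesis
      proof (cases "{y \<in> Y. adj v y \<and> \<beta> y = c v} = {}")
        case True
        then show ?thesis using old unfolding un by (simp only: True Un_empty_right False if_False)
      next
        case F2: False
        then obtain y where y: "y \<in> Y" "adj v y" "\<beta> y = c v" by blast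
        then have vz: "v = z y" using s(10)[OF y(1) _ y(2)] v by blast
        have sat: "\<not> c v" "card (nb ?U c False v) < 4" using \<beta>[OF y(1)] y(3) unfolding vz by auto
        \<comment> \<open>The vertex \<open>z y\<close> has no other neighbor in \<open>Y\<close>,
          so coloring \<open>Y\<close> adds at most one to its count.\<close>
        have "{y \<in> Y. adj v y \<and> \<beta> y = c v} = {y}" using s(12)[OF y(1)] y unfolding vz by blast
        then have "card (nb (W - {u}) ?c (?c v) v) \<le> card (nb ?U c (c v) v) + card {y}"
          unfolding un by (metis card_Un_le)
        then show ?thesis using sat False by (simp add: cap_def)
      qed
    qed
  qed
  have nbu: "nb (W - {u}) ?c \<alpha> u = {w \<in> {x}. c w = \<alpha>} \<union> {y \<in> Y. \<beta> y = \<alpha>}"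
  proof -
    have "N u = insert x Y" "x \<notin> Y" using star unfolding star_def by auto
    then have "nb (W - {u}) ?c \<alpha> u = {w \<in> insert x Y. ?c w = \<alpha>}"
      using adj_irrefl by (auto simp: nb_def N_def)
    then show ?thesis using \<open>x \<notin> Y\<close> by auto
  qed
  have sat: "card (nb (W - {u}) ?c \<alpha> w) < cap \<alpha>" if w: "w \<in> nb (W - {u}) ?c \<alpha> u" for w
  proof -
    consider "w = x" "c x = \<alpha>" | "w \<in> Y" "\<beta> w = \<alpha>" using w unfolding nbu by blast
    then show ?thesis
    proof cases
      case 1
      have "nb (W - {u}) ?c \<alpha> x = nb ?U c \<alpha> x"
        using s(7,11) by (auto simp: nb_def)
      then show ?thesis using satx 1 by simp
    next
      case 2
      have "nb (W - {u}) ?c \<alpha> w = {}"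
      proof -
        have "nb (W - {u}) ?c \<alpha> w \<subseteq> {z w}" using s(14)[OF 2(1)] by (auto simp: nb_def N_def)
        moreover have "z w \<notin> nb (W - {u}) ?c \<alpha> w" using satY[OF 2] s(9)[OF 2(1)] by (auto simp: nb_def)
        ultimately show ?thesis by blast
      qed
      then show ?thesis by (simp add: cap_def)
    qed
  qed
  have "card (nb (W - {u}) ?c \<alpha> u) \<le> cap \<alpha>" unfolding nbu by (rule count)
  then show False by (rule not_extendable[OF s(1) ok]) (rule sat)
qed

text \<open>If \<open>x\<close> had color 1, every \<open>y\<close> could take the color opposite to
  \<open>z y\<close>, and \<open>u\<close> color 2 with at most four neighbors of that
  color.\<close>

lemma star_x_color2:
  assumes star: "star u x Y z" and c: "proper (rest u Y) c" and Y: "card Y \<le> 4"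
  shows "\<not> c x"
proof
  assume x: "c x"
  show False
  proof (rule star_not_extendable[OF star c, of "\<lambda>y. \<not> c (z y)" False])
    have "card ({w \<in> {x}. c w = False} \<union> {y \<in> Y. (\<not> c (z y)) = False}) \<le> card Y"
      using x starD(6)[OF star] by (intro card_mono) auto
    then show "card ({w \<in> {x}. c w = False} \<union> {y \<in> Y. (\<not> c (z y)) = False}) \<le> cap False"
      using Y by (simp add: cap_def)
  qed (use x in auto)
qed

lemma ex_star:
  assumes u: "u \<in> W" and Y: "Y \<subseteq> {y \<in> N u. deg y = 2}" "card Y + 1 = deg u"
  obtains x z where "star u x Y z"
proof -
  have YN: "Y \<subseteq> N u" using Y by blast
  have "finite Y" using YN finite_subset[OF _ finN] by blast
  then have "card (N u - Y) = 1" using Y(2) YN by (simp add: card_Diff_subset deg_def)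
  then obtain x where x: "N u - Y = {x}" by (auto simp: card_1_singleton_iff)
  have "\<exists>z. N y = {u, z} \<and> z \<noteq> u" if y: "y \<in> Y" for y
  proof -
    have "card (N y) = 2" "u \<in> N y" using Y(1) y N_sym u unfolding deg_def by auto
    then show ?thesis unfolding card_2_iff by (metis doubleton_eq_iff insertE singletonD)
  qed
  then obtain z where "\<forall>y\<in>Y. N y = {u, z y} \<and> z y \<noteq> u" by metis
  then show thesis using that[of x z] x YN u unfolding star_def by blast
qed

text \<open>The fifth neighbor \<open>x\<close> has color 2 in every coloring of the rest. Were it
  saturated, its degree at most 5 would let it flip to color 1; so it has room. Let each
  \<open>y\<close> avoid the color of \<open>z y\<close>. If some \<open>z y\<close> has color 2,
  then \<open>u\<close> takes color 2 beside \<open>x\<close> and at most three of \<open>Y\<close>;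
  otherwise all neighbors of \<open>u\<close> have color 2 and \<open>u\<close> takes color
  1.\<close>

lemma deg5_big_neighbor:
  assumes u: "u \<in> W" "deg u = 5" and two: "card {y \<in> N u. deg y = 2} \<ge> 4"
  shows "\<exists>w\<in>N u. deg w \<ge> 6"
proof (rule ccontr)
  assume "\<not> ?thesis"
  then have small: "deg w \<le> 5" if "w \<in> N u" for w using that by force
  obtain Y where Y: "Y \<subseteq> {y \<in> N u. deg y = 2}" "card Y = 4"
    by (rule obtain_subset_with_card_n[OF two]) (rule that)
  obtain x z where star: "star u x Y z" using ex_star[OF u(1) Y(1)] Y(2) u(2) by auto
  note s = starD[OF star]
  let ?U = "rest u Y"
  have finU: "finite ?U" using finW by simp
  obtain c where c: "proper ?U c" using critical[of ?U] s(1) by blast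
  have x2: "\<not> c' x" if "proper ?U c'" for c' using star_x_color2[OF star that] Y(2) by simp
  have xN: "x \<in> N u" using s(2,3) by (simp add: N_def)
  have satx: "card (nb ?U c False x) < 4"
  proof (rule ccontr)
    assume "\<not> ?thesis"
    then have ge: "card (nb ?U c False x) \<ge> 4" by simp
    have sub: "insert u (nb ?U c False x) \<subseteq> N x" using s(1,3) adj_sym by (auto simp: nb_def N_def)
    have "u \<notin> nb ?U c False x" by (simp add: nb_def)
    then have "card (insert u (nb ?U c False x)) = card (nb ?U c False x) + 1"
      using finite_nb[OF finU] by simp
    then have eq: "insert u (nb ?U c False x) = N x"
      using ge small[OF xN] sub unfolding deg_def by (intro card_seteq) simp_all
    have F: "\<not> c v" if "v \<in> ?U" "adj x v" for v
    proof -
      have "v \<in> N x" "v \<noteq> u" using that by (auto simp: N_def)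
      then show ?thesis using eq by (auto simp: nb_def)
    qed
    have "proper ?U (\<lambda>v. if v \<in> {x} then \<not> False else c v)"
      by (rule proper_flip[OF c finU]) (use x2[OF c] F adj_irrefl in auto)
    then show False using x2 by fastforce
  qed
  show False
  proof (cases "\<exists>y\<in>Y. \<not> c (z y)")
    case True
    then obtain y0 where y0: "y0 \<in> Y" "\<not> c (z y0)" by blast
    show False
    proof (rule star_not_extendable[OF star c, of "\<lambda>y. \<not> c (z y)" False])
      have "card ({w \<in> {x}. c w = False} \<union> {y \<in> Y. (\<not> c (z y)) = False}) \<le> card (insert x (Y - {y0}))"
        using y0 s(6) by (intro card_mono) auto
      also have "\<dots> \<le> Suc (card (Y - {y0}))" using s(6) by (simp add: card_insert_if)
      also have "card (Y - {y0}) = 3" using Y(2) y0 s(6) by simp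
      finally show "card ({w \<in> {x}. c w = False} \<union> {y \<in> Y. (\<not> c (z y)) = False}) \<le> cap False"
        by (simp add: cap_def)
    qed (use satx in \<open>auto simp: cap_def\<close>)
  next
    case False
    show False
    proof (rule star_not_extendable[OF star c, of "\<lambda>y. \<not> c (z y)" True])
      have "{w \<in> {x}. c w = True} \<union> {y \<in> Y. (\<not> c (z y)) = True} = {}" using False x2[OF c] by auto
      then show "card ({w \<in> {x}. c w = True} \<union> {y \<in> Y. (\<not> c (z y)) = True}) \<le> cap True" by (simp only: card.empty)
    qed (use x2[OF c] in auto)
  qed
qed

text \<open>If some \<open>z y0\<close> had color 1 or room in color 2, then \<open>y0\<close> could
  take color 2, leaving \<open>u\<close> with at most two neighbors of color 1. If \<open>x\<close>
  had room, \<open>u\<close> could take color 2 beside \<open>x\<close> and the three vertices of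
  \<open>Y\<close>.\<close>

lemma star3_saturated:
  assumes star: "star u x Y z" and c: "proper (rest u Y) c" and Y: "card Y = 3"
    and w: "w = x \<or> (\<exists>y\<in>Y. w = z y)"
  shows "\<not> c w" "card (nb (rest u Y) c False w) = 4"
proof -
  note s = starD[OF star]
  let ?U = "rest u Y"
  have x2: "\<not> c x" using star_x_color2[OF star c] Y by simp
  have zy: "\<not> c (z y0) \<and> card (nb ?U c False (z y0)) \<ge> 4" if y0: "y0 \<in> Y" for y0
  proof (rule ccontr)
    assume *: "\<not> ?thesis"
    show False
    proof (rule star_not_extendable[OF star c, of "\<lambda>y. y \<noteq> y0 \<and> \<not> c (z y)" True])
      have "card ({w \<in> {x}. c w = True} \<union> {y \<in> Y. (y \<noteq> y0 \<and> \<not> c (z y)) = True}) \<le> card (Y - {y0})"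
        using s(6) x2 by (intro card_mono) auto
      also have "card (Y - {y0}) = 2" using Y y0 s(6) by simp
      finally show "card ({w \<in> {x}. c w = True} \<union> {y \<in> Y. (y \<noteq> y0 \<and> \<not> c (z y)) = True}) \<le> cap True"
        by (simp add: cap_def)
    qed (use * x2 in auto)
  qed
  have xs: "card (nb ?U c False x) \<ge> 4"
  proof (rule ccontr)
    assume *: "\<not> ?thesis"
    show False
    proof (rule star_not_extendable[OF star c, of "\<lambda>y. \<not> c (z y)" False])
      have "card ({w \<in> {x}. c w = False} \<union> {y \<in> Y. (\<not> c (z y)) = False}) \<le> card (insert x Y)"
        using s(6) by (intro card_mono) auto
      also have "\<dots> \<le> Suc (card Y)" using s(6) by (simp add: card_insert_if)
      finally show "card ({w \<in> {x}. c w = False} \<union> {y \<in> Y. (\<not> c (z y)) = False}) \<le> cap False"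
        using Y by (simp add: cap_def)
    qed (use * in \<open>auto simp: cap_def\<close>)
  qed
  show cw: "\<not> c w" using w x2 zy by blast
  have "w \<in> ?U" using w s(5,9) by blast
  then have "card (nb ?U c (c w) w) \<le> cap (c w)" using c unfolding proper_def by blast
  then have "card (nb ?U c False w) \<le> 4" using cw by (simp add: cap_def)
  moreover have "card (nb ?U c False w) \<ge> 4" using w xs zy by blast
  ultimately show "card (nb ?U c False w) = 4" by simp
qed

section \<open>Vertices of degree 6 near a poor vertex\<close>

definition big :: "'a \<Rightarrow> 'a set" where "big v = {w \<in> N v. deg w \<ge> 6}"
definition two :: "'a \<Rightarrow> 'a set" where "two v = {w \<in> N v. deg w = 2}"

text \<open>The only vertices that the basic discharging rules leave with a negative charge.\<close>

definition poor :: "'a \<Rightarrow> bool" where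
  "poor u \<longleftrightarrow> deg u = 4 \<and> card (big u) = 1 \<and> card (two u) = 3"

lemma finite_big_two [simp]: "finite (big v)" "finite (two v)"
  by (simp_all add: big_def two_def)

text \<open>Such a \<open>w\<close> is one of the four saturated vertices of the star at the poor
  vertex: \<open>x\<close> if adjacent to it, some \<open>z y\<close> if reached through a vertex of
  degree 2. Without the star it has five neighbors and a forced color, so
  \<open>forced_neighbor\<close> applies. The resulting \<open>t\<close> asks little of
  \<open>w\<close>, which finances the extra gifts.\<close>

lemma near_poor:
  assumes w: "w \<in> W" "deg w = 6"
    and near: "v \<in> N w" "poor v \<or> deg v = 2 \<and> (\<exists>u\<in>N v. poor u)"
  obtains t where "t \<in> N w" "deg t \<ge> 5 \<or> deg t = 4 \<and> card (big t) \<ge> 2"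
proof -
  obtain u where u: "u \<in> W" "poor u" "u = v \<or> deg v = 2 \<and> u \<in> N v"
    using near N_in_W by blast
  have two_u: "card (two u) = 3" "deg u = 4" using u(2) by (auto simp: poor_def)
  then obtain x z where star: "star u x (two u) z"
    using ex_star[OF u(1), of "two u"] by (auto simp: two_def)
  note s = starD[OF star]
  let ?Y = "two u" and ?U = "rest u (two u)"
  have finU: "finite ?U" using finW by simp
  have "w \<noteq> u" using w two_u by auto
  have role: "w = x \<or> (\<exists>y\<in>?Y. w = z y)"
  proof (cases "u = v")
    case True
    then have "w \<in> N u" using N_sym[OF near(1) w(1)] by simp
    moreover have "w \<notin> ?Y" using w by (simp add: two_def)
    ultimately show ?thesis using star unfolding star_def by blast
  next
    case False
    then have "v \<in> ?Y" using u N_in_W[OF near(1)] N_sym by (auto simp: two_def)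
    moreover have "w \<in> N v" using N_sym[OF near(1) w(1)] .
    ultimately show ?thesis using s(14) \<open>w \<noteq> u\<close> by blast
  qed
  have wU: "w \<in> ?U" using role s(5,9) by blast
  obtain c where c: "proper ?U c" using critical[of ?U] u(1) by blast
  have Y3: "card ?Y = 3" using two_u by simp
  have forced: "\<forall>c'. proper ?U c' \<longrightarrow> \<not> c' w" using star3_saturated(1)[OF star _ Y3 role] by blast
  have sat: "card (nb ?U c False w) = 4" using star3_saturated(2)[OF star c Y3 role] .
  \<comment> \<open>Deleting \<open>u\<close> and \<open>Y\<close> removes exactly one neighbor of
    \<open>w\<close>: \<open>u\<close> if \<open>w = x\<close>, and \<open>y\<close> if
    \<open>w = z y\<close>, where a further edge to \<open>u\<close> would close a triangle.\<close>
  obtain r where r: "N w - {x \<in> ?U. adj w x} = {r}"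
  proof (cases "w = x")
    case True
    then have "N w - {v \<in> ?U. adj w v} = {u}"
      using s(1,3,11) adj_sym by (auto simp: N_def)
    then show ?thesis by (rule that)
  next
    case False
    then obtain y where y: "y \<in> ?Y" "w = z y" using role by blast
    have "\<not> adj w u" using no_triangle[of u y w] s(7,8)[OF y(1)] y(2) adj_sym by blast
    then have "N w - {v \<in> ?U. adj w v} = {y}"
      using s(4) s(8)[OF y(1)] s(12)[OF y(1)] y adj_sym by (auto simp: N_def)
    then show ?thesis by (rule that)
  qed
  have sub: "{x \<in> ?U. adj w x} \<subseteq> N w" by (auto simp: N_def)
  have "card (N w - {x \<in> ?U. adj w x}) = deg w - card {x \<in> ?U. adj w x}"
    unfolding deg_def by (rule card_Diff_subset[OF _ sub]) (use finU in simp)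
  then have d5: "card {x \<in> ?U. adj w x} = 5" using r w(2) by simp
  have le: "card {x \<in> ?U. adj t x} \<le> deg t" for t
    unfolding deg_def by (rule card_mono) (auto simp: N_def finW)
  obtain t where t: "t \<in> ?U" "adj w t"
    "card {x \<in> ?U. adj t x} \<ge> 5 \<or>
      card {x \<in> ?U. adj t x} = 4 \<and> (\<exists>t'\<in>?U. adj t t' \<and> t' \<noteq> w \<and> card {x \<in> ?U. adj t' x} \<ge> 6)"
    by (rule forced_neighbor[OF finU c wU forced sat d5])
  have tN: "t \<in> N w" using t by (auto simp: N_def)
  show thesis
  proof (cases "deg t \<ge> 5")
    case False
    then have d4: "card {x \<in> ?U. adj t x} = 4" "deg t = 4" using t(3) le[of t] by linarith+
    then obtain t' where t': "t' \<in> ?U" "adj t t'" "t' \<noteq> w" "card {x \<in> ?U. adj t' x} \<ge> 6" using t(3) by auto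
    have "{w, t'} \<subseteq> big t" using t' t w le[of t'] adj_sym by (auto simp: big_def N_def)
    then have "card {w, t'} \<le> card (big t)" by (intro card_mono) simp_all
    then show ?thesis using that[OF tN] d4 t'(3) by simp
  qed (use that[OF tN] in blast)
qed

end

section \<open>Discharging\<close>

context critical_graph begin

text \<open>All charges are doubled to stay in the integers.\<close>

definition give :: "'a \<Rightarrow> 'a \<Rightarrow> int" where
  "give w v =
    (if deg w \<ge> 6 then
       (if deg v \<ge> 6 then 0 else if deg v = 5 then 2
        else if deg v = 4 then (if poor v then 9 else if card (big v) = 1 then 8 else 2)
        else if deg v = 3 then 8
        else if \<exists>u\<in>N v. poor u then 9 else 8)
     else if (deg w = 4 \<or> deg w = 5) \<and> deg v = 2 then (if poor w then 7 else 8)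
     else 0)"

definition charge :: "'a \<Rightarrow> int" where
  "charge v = 18 * int (deg v) - 60 + (if deg v = 2 then 8 else 0)"

lemma give_small: "deg w \<le> 3 \<Longrightarrow> give w v = 0"
  by (simp add: give_def)

lemma give_nonneg: "give w v \<ge> 0"
  by (simp add: give_def)

lemma give_le_9: "give w v \<le> 9"
  by (simp add: give_def)

lemma card_big_two_le: "card (big v) + card (two v) \<le> deg v"
proof -
  have "big v \<inter> two v = {}" by (auto simp: big_def two_def)
  then have "card (big v) + card (two v) = card (big v \<union> two v)" by (simp add: card_Un_disjoint)
  also have "\<dots> \<le> deg v" unfolding deg_def by (rule card_mono) (auto simp: big_def two_def)
  finally show ?thesis .
qed

lemma sum_give_out:
  assumes "deg v = 4 \<or> deg v = 5"
  shows "(\<Sum>w\<in>N v. give v w) = (if poor v then 7 else 8) * int (card (two v))"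
proof -
  have "(\<Sum>w\<in>N v. give v w) = (\<Sum>w\<in>two v. give v w)"
    by (rule sum.mono_neutral_right) (use assms in \<open>auto simp: two_def give_def\<close>)
  also have "\<dots> = (\<Sum>w\<in>two v. if poor v then 7 else 8)"
    by (rule sum.cong) (use assms in \<open>auto simp: two_def give_def\<close>)
  finally show ?thesis by simp
qed

lemma sum_give_in:
  assumes "\<And>w. w \<in> big v \<Longrightarrow> give w v = r"
  shows "(\<Sum>w\<in>N v. give w v) \<ge> r * int (card (big v))"
proof -
  have "(\<Sum>w\<in>big v. give w v) = (\<Sum>w\<in>big v. r)" by (rule sum.cong) (use assms in auto)
  moreover have "(\<Sum>w\<in>big v. give w v) \<le> (\<Sum>w\<in>N v. give w v)"
    by (rule sum_mono2) (auto simp: big_def give_nonneg)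
  ultimately show ?thesis by (simp add: mult.commute)
qed

lemma card_big_pos: "v \<in> W \<Longrightarrow> deg v \<le> 4 \<Longrightarrow> card (big v) \<ge> 1"
  using big_neighbor[of v] by (auto simp: big_def Suc_le_eq card_gt_0_iff)

text \<open>The doubled initial charges for degrees 2 to 6 are -16, -6, 12, 30 and 48. Degree 3 is
  settled by one large neighbor; the rules are tight for degree 2 and for poor vertices, while
  degree 6 needs the saving from \<open>near_poor\<close>.\<close>

lemma final_charge_nonneg:
  assumes v: "v \<in> W"
  shows "charge v + (\<Sum>w\<in>N v. give w v) - (\<Sum>w\<in>N v. give v w) \<ge> 0"
proof -
  have in0: "(\<Sum>w\<in>N v. give w v) \<ge> 0" by (rule sum_nonneg) (rule give_nonneg)
  consider "deg v = 2" | "deg v = 3" | "deg v = 4" | "deg v = 5" | "deg v = 6" | "deg v \<ge> 7"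
    using deg_ge_2[OF v] by linarith
  then show ?thesis
  proof cases
    case 1
    have out: "(\<Sum>w\<in>N v. give v w) = 0" using 1 give_small by simp
    obtain p where p: "p \<in> N v" "deg p \<ge> 6" using big_neighbor[OF v] 1 by auto
    have "card (N v - {p}) = 1" using p 1 by (simp add: deg_def)
    then obtain q where "N v - {p} = {q}" by (auto simp: card_1_singleton_iff)
    then have N: "N v = {p, q}" "p \<noteq> q" using p by blast+
    have "poor u \<Longrightarrow> u \<noteq> p" for u using p by (auto simp: poor_def)
    then have ex: "(\<exists>u\<in>N v. poor u) \<longleftrightarrow> poor q" unfolding N by auto
    have q4: "deg q \<ge> 4" using deg2_neighbor[OF v 1, of q] N by simp
    \<comment> \<open>When \<open>q\<close> is poor, it pays 7 and the large neighbor
      \<open>p\<close> pays 9, so the total stays 16.\<close>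
    have "give p v + give q v \<ge> 16"
    proof (cases "poor q")
      case True
      then show ?thesis using p 1 ex by (simp add: give_def poor_def)
    next
      case False
      then have "give p v = 8" using p 1 ex by (simp add: give_def)
      moreover have "give q v = 8" using q4 1 ex False by (auto simp: give_def)
      ultimately show ?thesis by simp
    qed
    then show ?thesis using out N 1 by (simp add: charge_def)
  next
    case 2
    have out: "(\<Sum>w\<in>N v. give v w) = 0" using 2 give_small by simp
    have "(\<Sum>w\<in>N v. give w v) \<ge> 8 * int (card (big v))"
      by (rule sum_give_in) (use 2 in \<open>simp add: give_def big_def\<close>)
    then show ?thesis using out card_big_pos[OF v] 2 by (simp add: charge_def)
  next
    case 3
    have out: "(\<Sum>w\<in>N v. give v w) = (if poor v then 7 else 8) * int (card (two v))"
      using 3 by (intro sum_give_out) simp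
    have b: "card (big v) \<ge> 1" using card_big_pos[OF v] 3 by simp
    have le: "card (big v) + card (two v) \<le> 4" using card_big_two_le[of v] 3 by simp
    consider "poor v" | "\<not> poor v" "card (big v) = 1" | "\<not> poor v" "card (big v) \<ge> 2" using b by linarith
    then show ?thesis
    proof cases
      case 1
      have "(\<Sum>w\<in>N v. give w v) \<ge> 9 * int (card (big v))"
        by (rule sum_give_in) (use 1 3 in \<open>simp add: give_def big_def\<close>)
      \<comment> \<open>A poor vertex comes out exactly even:
        \<open>12 + 9 - 3 * 7 = 0\<close>.\<close>
      then show ?thesis using out 1 3 by (simp add: charge_def poor_def)
    next
      case 2
      have "(\<Sum>w\<in>N v. give w v) \<ge> 8 * int (card (big v))"
        by (rule sum_give_in) (use 2 3 in \<open>simp add: give_def big_def\<close>)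
      moreover have "card (two v) \<le> 2" using 2 3 le by (auto simp: poor_def)
      ultimately show ?thesis using out 2 3 by (simp add: charge_def)
    next
      case c3: 3
      have "(\<Sum>w\<in>N v. give w v) \<ge> 2 * int (card (big v))"
        by (rule sum_give_in) (use c3 3 in \<open>simp add: give_def big_def\<close>)
      \<comment> \<open>Two large neighbors leave room for at most two of degree 2, and
        \<open>12 + 2 * 2 - 2 * 8 = 0\<close>. This is why a gift of 2 is enough here.\<close>
      then show ?thesis using out le c3 3 by (simp add: charge_def)
    qed
  next
    case 4
    have np: "\<not> poor v" using 4 by (simp add: poor_def)
    have out: "(\<Sum>w\<in>N v. give v w) = 8 * int (card (two v))"
      using sum_give_out[of v] 4 np by simp
    have le: "card (big v) + card (two v) \<le> 5" using card_big_two_le[of v] 4 by simp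
    have inn: "(\<Sum>w\<in>N v. give w v) \<ge> 2 * int (card (big v))"
      by (rule sum_give_in) (use 4 in \<open>simp add: give_def big_def\<close>)
    show ?thesis
    proof (cases "big v = {}")
      case True
      then have "\<not> card (two v) \<ge> 4"
        using deg5_big_neighbor[OF v 4] unfolding two_def big_def by blast
      then show ?thesis using out in0 4 by (simp add: charge_def)
    next
      case False
      then have "card (big v) \<ge> 1" by (simp add: Suc_le_eq card_gt_0_iff)
      \<comment> \<open>One large neighbor and four of degree 2 give
        \<open>30 + 2 - 4 * 8 = 0\<close>.\<close>
      then show ?thesis using out inn le 4 by (simp add: charge_def)
    qed
  next
    case 5
    show ?thesis
    proof (cases "\<exists>u\<in>N v. give v u = 9")
      case False
      have "give v u \<le> 8" if "u \<in> N v" for u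
        using False that by (auto simp: give_def split: if_splits)
      then have "(\<Sum>w\<in>N v. give v w) \<le> of_nat (card (N v)) * 8" by (intro sum_bounded_above)
      then show ?thesis using in0 5 by (simp add: charge_def deg_def)
    next
      case True
      then obtain u where u: "u \<in> N v" "give v u = 9" by blast
      have "deg u \<ge> 2" using deg_ge_2 N_in_W[OF u(1)] by blast
      then have "poor u \<or> deg u = 2 \<and> (\<exists>x\<in>N u. poor x)"
        using u(2) by (auto simp: give_def split: if_splits)
      then obtain t where t: "t \<in> N v" "deg t \<ge> 5 \<or> deg t = 4 \<and> card (big t) \<ge> 2"
        using near_poor[OF v 5 u(1)] by blast
      \<comment> \<open>With at most 2 for \<open>t\<close> and at most 9 for each of the other
        five, \<open>v\<close> spends at most 47 of its 48.\<close>
      have "give v t \<le> 2" using t(2) 5 by (auto simp: give_def poor_def)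
      moreover have "(\<Sum>w\<in>N v - {t}. give v w) \<le> of_nat (card (N v - {t})) * 9"
        by (intro sum_bounded_above give_le_9)
      moreover have "card (N v - {t}) = 5" using t(1) 5 by (simp add: deg_def)
      moreover have "(\<Sum>w\<in>N v. give v w) = give v t + (\<Sum>w\<in>N v - {t}. give v w)"
        using t(1) by (simp add: sum.remove)
      ultimately show ?thesis using in0 5 by (simp add: charge_def)
    qed
  next
    case 6
    have "(\<Sum>w\<in>N v. give v w) \<le> of_nat (card (N v)) * 9"
      by (intro sum_bounded_above give_le_9)
    \<comment> \<open>From degree 7 on, \<open>18 * deg v - 60 \<ge> 9 * deg v\<close>, so every
      neighbor can receive 9.\<close>
    then show ?thesis using in0 6 by (simp add: charge_def deg_def)
  qed
qed

text \<open>Gifts cancel in the sum over all vertices, so the total initial charge is nonnegative;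
  halving it undoes the doubling.\<close>

lemma degree_sum_bound:
  "30 * card W \<le> 9 * (\<Sum>v\<in>W. deg v) + 4 * card {v \<in> W. deg v = 2}"
proof -
  have swap: "(\<Sum>v\<in>W. \<Sum>w\<in>N v. give w v) = (\<Sum>v\<in>W. \<Sum>w\<in>N v. give v w)"
  proof -
    have "(\<Sum>v\<in>W. \<Sum>w\<in>{w \<in> W. adj v w}. give w v) = (\<Sum>w\<in>W. \<Sum>v\<in>{v \<in> W. adj v w}. give w v)"
      by (rule sum.swap_restrict[OF finW finW])
    moreover have "{v \<in> W. adj v w} = {v \<in> W. adj w v}" for w using adj_sym by blast
    ultimately show ?thesis unfolding N_def by simp
  qed
  have "0 \<le> (\<Sum>v\<in>W. charge v + (\<Sum>w\<in>N v. give w v) - (\<Sum>w\<in>N v. give v w))"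
    by (rule sum_nonneg) (rule final_charge_nonneg)
  also have "\<dots> = (\<Sum>v\<in>W. charge v)"
    unfolding sum.distrib sum_subtractf swap by simp
  also have "\<dots> = 18 * int (\<Sum>v\<in>W. deg v) - 60 * int (card W) + 8 * int (card {v \<in> W. deg v = 2})"
  proof -
    have "(\<Sum>v\<in>W. if deg v = 2 then 8 else 0 :: int) = 8 * int (card {v \<in> W. deg v = 2})"
      using finW by (simp add: sum.If_cases Int_def)
    then show ?thesis
      unfolding charge_def sum.distrib sum_subtractf by (simp add: sum_distrib_left)
  qed
  finally show ?thesis by linarith
qed

end

section \<open>From planar graphs to edge drawings\<close>

lemma pair_graph_facts:
  assumes "pair_graph G"
  shows "finite (pverts G)" "sym (parcs G)" "(v, v) \<notin> parcs G"
    "(u, v) \<in> parcs G \<Longrightarrow> u \<in> pverts G" "(u, v) \<in> parcs G \<Longrightarrow> v \<in> pverts G"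
proof -
  interpret pair_graph G by (rule assms)
  show "finite (pverts G)" by (rule pair_finite_verts)
  show "sym (parcs G)" using pair_sym_arcs by (simp add: symmetric_def)
  show "(v, v) \<notin> parcs G" using pair_no_loops by fastforce
  show "(u, v) \<in> parcs G \<Longrightarrow> u \<in> pverts G" "(u, v) \<in> parcs G \<Longrightarrow> v \<in> pverts G"
    using in_arcsD1 in_arcsD2 by blast+
qed

text \<open>Library cycles are lists of arcs, whereas cycles here are vertex lists; this function
  translates between them.\<close>

fun list_arcs :: "'a list \<Rightarrow> ('a \<times> 'a) list" where
  "list_arcs (x # y # zs) = (x, y) # list_arcs (y # zs)"
| "list_arcs _ = []"

lemma list_arcs_walk:
  "pcas x (list_arcs (x # xs)) (last (x # xs))" "pawalk_verts x (list_arcs (x # xs)) = x # xs"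
  "length (list_arcs (x # xs)) = length xs"
  by (induction xs arbitrary: x) auto

definition edges_on :: "('a \<times> 'a) set \<Rightarrow> 'a set \<Rightarrow> 'a set set" where
  "edges_on A W = {{u, v} | u v. (u, v) \<in> A \<and> u \<in> W \<and> v \<in> W}"

lemma edges_on_iff:
  assumes "sym A"
  shows "{u, v} \<in> edges_on A W \<longleftrightarrow> (u, v) \<in> A \<and> u \<in> W \<and> v \<in> W"
  using assms unfolding edges_on_def sym_def by (auto simp: doubleton_eq_iff)

lemma list_arcs_subset:
  assumes "sym A" "path_edges xs \<subseteq> edges_on A W"
  shows "set (list_arcs xs) \<subseteq> A"
  using assms(2) by (induction xs rule: path_edges.induct) (auto simp: edges_on_iff[OF assms(1)])

text \<open>A forbidden vertex list, closed up and read as arcs, is an arc walk that repeats only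
  its first vertex, hence a cycle of the digraph. The condition \<open>k > 0\<close> provides this
  first vertex.\<close>

lemma cycle_free_edges_on:
  assumes G: "pair_graph G" and no: "\<not> has_cycle_of_length G k" and k: "k > 0"
  shows "cycle_free (edges_on (parcs G) W) k"
  unfolding cycle_free_def
proof
  interpret pair_graph G by (rule G)
  have sym: "sym (parcs G)" using pair_sym_arcs by (simp add: symmetric_def)
  assume "\<exists>xs. distinct xs \<and> length xs = k \<and> path_edges (xs @ [hd xs]) \<subseteq> edges_on (parcs G) W"
  then obtain xs where xs: "distinct xs" "length xs = k" "path_edges (xs @ [hd xs]) \<subseteq> edges_on (parcs G) W"
    by blast
  obtain a ys where a: "xs = a # ys" using xs(2) k by (cases xs) auto
  define p where "p = list_arcs (a # (ys @ [a]))"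
  have arcs: "set p \<subseteq> parcs G" using list_arcs_subset[OF sym xs(3)] by (simp add: p_def a)
  have len: "length p = k" using xs(2) unfolding p_def list_arcs_walk(3) by (simp add: a)
  have walk: "pcas a p a" using list_arcs_walk(1)[of a "ys @ [a]"] by (simp add: p_def)
  have verts: "pawalk_verts a p = a # ys @ [a]" unfolding p_def by (rule list_arcs_walk(2))
  have "p \<noteq> []" using len k by auto
  then have "(fst (hd p), snd (hd p)) \<in> parcs G" "fst (hd p) = a" using arcs walk by (cases p; auto)+
  then have "a \<in> pverts G" using in_arcsD1 by metis
  then have "awalk a p a" using arcs walk by (simp add: awalk_def)
  then have "cycle p" unfolding cycle_def using verts xs(1) a \<open>p \<noteq> []\<close> by (intro exI[of _ a]) auto
  then show False using no len unfolding has_cycle_of_length_def by blast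
qed

lemma cycle_free_listD:
  "cycle_free E k \<Longrightarrow> distinct xs \<Longrightarrow> path_edges (xs @ [hd xs]) \<subseteq> E \<Longrightarrow> length xs \<noteq> k"
  unfolding cycle_free_def by blast

text \<open>The image of an unordered edge is the union over its orientations, which avoids choosing
  one; both contribute the same set, since opposite arcs are drawn as reversed paths.\<close>

lemma plane_edge_drawing:
  assumes G: "pair_graph G" and W: "W \<subseteq> pverts G" and draw: "plane_drawing G pos \<gamma>"
  shows "edge_drawing (edges_on (parcs G) W) pos
    (\<lambda>e. \<Union>{path_image (\<gamma> u v) | u v. (u, v) \<in> parcs G \<and> {u, v} = e})"
proof -
  note G = pair_graph_facts[OF G]
  let ?E = "edges_on (parcs G) W"
  let ?img = "\<lambda>e. \<Union>{path_image (\<gamma> u v) | u v. (u, v) \<in> parcs G \<and> {u, v} = e}"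
  have arcD: "arc (\<gamma> u v)" "pathstart (\<gamma> u v) = pos u" "pathfinish (\<gamma> u v) = pos v"
      "\<gamma> v u = reversepath (\<gamma> u v)"
      "(path_image (\<gamma> u v) - {pos u, pos v}) \<inter> pos ` pverts G = {}"
    if "(u, v) \<in> parcs G" for u v
    using draw that unfolding plane_drawing_def by fast+
  have cross: "(path_image (\<gamma> u v) - {pos u, pos v}) \<inter> path_image (\<gamma> x y) = {}"
    if "(u, v) \<in> parcs G" "(x, y) \<in> parcs G" "{x, y} \<noteq> {u, v}" for u v x y
    using draw that unfolding plane_drawing_def by fast
  have inj: "inj_on pos (pverts G)" using draw unfolding plane_drawing_def by blast
  have img: "?img {u, v} = path_image (\<gamma> u v)" if uv: "(u, v) \<in> parcs G" for u v
  proof -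
    have "path_image (\<gamma> v u) = path_image (\<gamma> u v)" using arcD(4)[OF uv] by simp
    then show ?thesis using uv by (auto simp: doubleton_eq_iff)
  qed
  have edgeE: "\<exists>u v. e = {u, v} \<and> (u, v) \<in> parcs G \<and> u \<noteq> v \<and> u \<in> W \<and> v \<in> W" if e: "e \<in> ?E" for e
  proof -
    obtain u v where "e = {u, v}" "(u, v) \<in> parcs G" "u \<in> W" "v \<in> W" using e unfolding edges_on_def by blast
    moreover then have "u \<noteq> v" using G(3) by metis
    ultimately show ?thesis by blast
  qed
  have UE: "\<Union>?E \<subseteq> pverts G" using W unfolding edges_on_def by blast
  show ?thesis
  proof
    have "?E \<subseteq> Pow (pverts G)" using UE by blast
    then show "finite ?E" using G(1) by (simp add: finite_subset)
    show "inj_on pos (\<Union>?E)" by (rule inj_on_subset[OF inj UE])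
    show "\<exists>u v. u \<noteq> v \<and> e = {u, v}" if "e \<in> ?E" for e using edgeE[OF that] by blast
    show "\<exists>g. arc g \<and> pathstart g = pos u \<and> pathfinish g = pos v \<and> path_image g = ?img {u, v}"
      if "{u, v} \<in> ?E" "u \<noteq> v" for u v
    proof -
      have uv: "(u, v) \<in> parcs G" using that(1) edges_on_iff[OF G(2)] by blast
      show ?thesis by (intro exI[of _ "\<gamma> u v"] conjI arcD[OF uv] img[OF uv, symmetric])
    qed
    show "x \<in> e" if e: "e \<in> ?E" "x \<in> \<Union>?E" "pos x \<in> ?img e" for e x
    proof -
      obtain u v where uv: "e = {u, v}" "(u, v) \<in> parcs G" using edgeE[OF e(1)] by blast
      have xV: "x \<in> pverts G" using e(2) UE by blast
      have "pos x \<in> path_image (\<gamma> u v)" using e(3) img[OF uv(2)] uv(1) by simp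
      then have "pos x = pos u \<or> pos x = pos v" using arcD(5)[OF uv(2)] xV by blast
      moreover have "u \<in> pverts G" "v \<in> pverts G" using G(4,5)[OF uv(2)] by simp_all
      ultimately show ?thesis using inj xV uv(1) by (auto dest: inj_onD)
    qed
    show "?img e \<inter> ?img f \<subseteq> pos ` (e \<inter> f)" if ef: "e \<in> ?E" "f \<in> ?E" "e \<noteq> f" for e f
    proof
      fix p assume p: "p \<in> ?img e \<inter> ?img f"
      obtain u v where uv: "e = {u, v}" "(u, v) \<in> parcs G" using edgeE[OF ef(1)] by blast
      obtain x y where xy: "f = {x, y}" "(x, y) \<in> parcs G" using edgeE[OF ef(2)] by blast
      have pp: "p \<in> path_image (\<gamma> u v)" "p \<in> path_image (\<gamma> x y)"
        using p img[OF uv(2)] img[OF xy(2)] uv(1) xy(1) by simp_all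
      have V: "u \<in> pverts G" "v \<in> pverts G" "x \<in> pverts G" "y \<in> pverts G"
        using G(4,5)[OF uv(2)] G(4,5)[OF xy(2)] by simp_all
      have "p \<in> {pos u, pos v}" using cross[OF uv(2) xy(2)] pp ef(3) uv(1) xy(1) by blast
      moreover have "p \<in> {pos x, pos y}" using cross[OF xy(2) uv(2)] pp ef(3) uv(1) xy(1) by blast
      ultimately obtain s t where st: "s \<in> e" "t \<in> f" "p = pos s" "p = pos t" unfolding uv(1) xy(1) by blast
      then have "s = t" using inj V uv(1) xy(1) by (auto dest: inj_onD)
      then show "p \<in> pos ` (e \<inter> f)" using st by blast
    qed
  qed
qed

theorem theorem1p2:
  fixes G :: "'a pair_pre_digraph"
  assumes "pair_graph G"
    and "planar G"
    and "\<not> has_cycle_of_length G 3"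
    and "\<not> has_cycle_of_length G 4"
    and "\<not> has_cycle_of_length G 6"
  shows "defective_colorable 2 4 G"
proof (rule ccontr)
  assume not_col: "\<not> defective_colorable 2 4 G"
  note G = pair_graph_facts[OF assms(1)]
  note sym = G(2) and irrefl = G(3) and vert = G(4,5)
  let ?E = "edges_on (parcs G)"
  have free: "cycle_free (?E W) 3" "cycle_free (?E W) 4" "cycle_free (?E W) 6" for W
    using cycle_free_edges_on[OF assms(1)] assms(3-5) by simp_all
  have inE: "{u, v} \<in> ?E (pverts G)" if "(u, v) \<in> parcs G" for u v
    using that vert edges_on_iff[OF sym] by blast
  let ?adj = "\<lambda>u v. (u, v) \<in> parcs G"
  interpret sparse_graph ?adj
  proof
    show "?adj v u" if "?adj u v" for u v using sym that by (rule symD)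
    show "\<not> ?adj v v" for v by (rule irrefl)
    show "\<not> ?adj c a" if abc: "?adj a b" "?adj b c" for a b c
    proof
      assume "?adj c a"
      then have "distinct [a, b, c]" "path_edges ([a, b, c] @ [hd [a, b, c]]) \<subseteq> ?E (pverts G)"
        using abc irrefl inE by auto
      then have "length [a, b, c] \<noteq> 3" by (rule cycle_free_listD[OF free(1)])
      then show False by simp
    qed
    show "a = c \<or> b = d" if abcd: "?adj a b" "?adj b c" "?adj c d" "?adj d a" for a b c d
    proof (rule ccontr)
      assume "\<not> ?thesis"
      then have "distinct [a, b, c, d]" "path_edges ([a, b, c, d] @ [hd [a, b, c, d]]) \<subseteq> ?E (pverts G)"
        using abcd irrefl inE by auto
      then have "length [a, b, c, d] \<noteq> 4" by (rule cycle_free_listD[OF free(2)])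
      then show False by simp
    qed
  qed
  have fin: "finite (pverts G)" by (rule G(1))
  have "\<not> proper (pverts G) c" for c
  proof
    assume c: "proper (pverts G) c"
    let ?c = "\<lambda>v. if c v then 1 else 2 :: nat"
    have eq: "{w. (v, w) \<in> parcs G \<and> ?c w = 1} = nb (pverts G) c True v"
      "{w. (v, w) \<in> parcs G \<and> ?c w = 2} = nb (pverts G) c False v" for v
      using vert by (auto simp: nb_def split: if_splits)
    have bound: "card (nb (pverts G) c (c v) v) \<le> cap (c v)" if "v \<in> pverts G" for v
      using c that unfolding proper_def by blast
    have "defective_coloring 2 4 G ?c"
      unfolding defective_coloring_def eq
    proof (intro conjI ballI impI)
      fix v assume v: "v \<in> pverts G"
      show "?c v \<in> {1, 2}" by simp
      show "card (nb (pverts G) c True v) \<le> 2" if "?c v = 1"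
        using bound[OF v] that by (simp add: cap_def split: if_splits)
      show "card (nb (pverts G) c False v) \<le> 4" if "?c v = 2"
        using bound[OF v] that by (simp add: cap_def split: if_splits)
    qed
    then show False using not_col unfolding defective_colorable_def by blast
  qed
  then have ex: "pverts G \<subseteq> pverts G \<and> (\<forall>c. \<not> proper (pverts G) c)" by blast
  \<comment> \<open>The smallest vertex set without a coloring, in cardinality, so every proper
    subset has one; the induced subgraph on it inherits the drawing.\<close>
  obtain W where W: "W \<subseteq> pverts G" "\<And>c. \<not> proper W c"
    and min: "\<And>U. U \<subseteq> pverts G \<and> (\<forall>c. \<not> proper U c) \<Longrightarrow> card W \<le> card U"
    using ex_has_least_nat[of "\<lambda>U. U \<subseteq> pverts G \<and> (\<forall>c. \<not> proper U c)" "pverts G" card] ex by metis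
  have finW: "finite W" using W(1) fin finite_subset by blast
  interpret critical_graph ?adj W
  proof
    show "finite W" by (rule finW)
    show "\<not> proper W c" for c by (rule W(2))
    show "\<exists>c. proper U c" if "U \<subset> W" for U
    proof (rule ccontr)
      assume "\<not> ?thesis"
      then have "card W \<le> card U" using min[of U] that W(1) by blast
      then show False using psubset_card_mono[OF finW that] by simp
    qed
  qed
  have ne: "W \<noteq> {}" using W(2) by (auto simp: proper_def)
  have UE: "\<Union>(?E W) \<subseteq> W" unfolding edges_on_def by blast
  obtain pos \<gamma> where "plane_drawing G pos \<gamma>" using assms(2) unfolding planar_def by blast
  then interpret edge_drawing "?E W" pos "\<lambda>e. \<Union>{path_image (\<gamma> u v) | u v. (u, v) \<in> parcs G \<and> {u, v} = e}"
    by (rule plane_edge_drawing[OF assms(1) W(1)])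
  have deg_eq: "edge_degree (?E W) v = deg v" if v: "v \<in> W" for v
  proof -
    have "{e \<in> ?E W. v \<in> e} = (\<lambda>w. {v, w}) ` N v"
    proof (rule set_eqI, rule iffI)
      fix e assume "e \<in> {e \<in> ?E W. v \<in> e}"
      then obtain x y where "e = {x, y}" "(x, y) \<in> parcs G" "x \<in> W" "y \<in> W" "v = x \<or> v = y"
        unfolding edges_on_def by blast
      then show "e \<in> (\<lambda>w. {v, w}) ` N v" using adj_sym[of x y] by (auto simp: N_def insert_commute)
    next
      fix e assume "e \<in> (\<lambda>w. {v, w}) ` N v"
      then show "e \<in> {e \<in> ?E W. v \<in> e}" using v by (auto simp: N_def edges_on_iff[OF sym])
    qed
    moreover have "inj_on (\<lambda>w. {v, w}) (N v)" by (auto simp: inj_on_def doubleton_eq_iff)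
    ultimately show ?thesis unfolding edge_degree_def deg_def by (simp add: card_image)
  qed
  have indep: "edge_degree (?E W) v \<noteq> 2" if uv: "{u, v} \<in> ?E W" "edge_degree (?E W) u = 2" for u v
  proof -
    have "(u, v) \<in> parcs G" "u \<in> W" "v \<in> W" using uv(1) edges_on_iff[OF sym] by blast+
    then have "deg v \<ge> 4" using deg2_neighbor[of u v] uv(2) deg_eq[of u] by (simp add: N_def)
    then show ?thesis using deg_eq[OF \<open>v \<in> W\<close>] by simp
  qed
  obtain F where F: "finite F" "\<And>C. C \<in> F \<Longrightarrow> is_cycle C \<and> C \<subseteq> ?E W"
    "\<And>e. card {C \<in> F. e \<in> C} \<le> 2" "card (?E W) + 1 \<le> card W + card F"
    using cycle_family[OF finW ne UE] by blast
  have "9 * (\<Sum>v\<in>W. edge_degree (?E W) v) + 4 * card {v \<in> W. edge_degree (?E W) v = 2} + 30 \<le> 30 * card W"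
    by (rule sparse_bound[OF finW finite_edges UE edge_doubleton free indep F])
  moreover have "(\<Sum>v\<in>W. edge_degree (?E W) v) = (\<Sum>v\<in>W. deg v)"
    by (rule sum.cong) (simp_all add: deg_eq)
  moreover have "{v \<in> W. edge_degree (?E W) v = 2} = {v \<in> W. deg v = 2}" using deg_eq by auto
  \<comment> \<open>The bounds from the faces and from the discharging contradict each other by the
    additive 30.\<close>
  ultimately show False using degree_sum_bound by simp
qed

end
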